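(* The linear operator $A$ is self-adjoint in the Hilbert space $H$.
   Context: Data. Let $-1<h_1<h_2<h_3<1$ and $I=[-1,h_1)\cup(h_1,h_2)\cup(h_2,h_3)\cup(h_3,1]$. Let $p_1,p_2,p_3,p_4$ be nonzero real constants, and let $p(x)=p_1^2$ on $[-1,h_1)$, $p(x)=p_2^2$ on $(h_1,h_2)$, $p(x)=p_3^2$ on $(h_2,h_3)$, $p(x)=p_4^2$ on $(h_3,1]$. Let $q\in L^1(I,\mathbb{R})$, and let $\alpha_i,\beta_i$ ($i=1,\dots,8$), $\beta_1',\beta_2'$ be real numbers (primes on $\beta_1',\beta_2'$ are part of the name). Assume throughout $$\theta=\alpha_3\beta_4-\beta_3\alpha_4>0,\quad \gamma=\alpha_5\beta_6-\beta_5\alpha_6>0,\quad \xi=\alpha_7\beta_8-\beta_7\alpha_8>0,\quad \rho=\beta_1'\beta_2-\beta_1\beta_2'>0,\quad |\alpha_1|+|\alpha_2|\neq 0.$$ Expressions. $\tau u=-(p u')'+qu$ on $I$; $\tau_1u=\alpha_1u(-1)+\alpha_2u'(-1)$; $\tau_3u=u(h_1+0)-\alpha_3u(h_1-0)-\beta_3u'(h_1-0)$, $\tau_4u=u'(h_1+0)-\alpha_4u(h_1-0)-\beta_4u'(h_1-0)$, $\tau_5u=u(h_2+0)-\alpha_5u(h_2-0)-\beta_5u'(h_2-0)$, $\tau_6u=u'(h_2+0)-\alpha_6u(h_2-0)-\beta_6u'(h_2-0)$, $\tau_7u=u(h_3+0)-\alpha_7u(h_3-0)-\beta_7u'(h_3-0)$,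 $\tau_8u=u'(h_3+0)-\alpha_8u(h_3-0)-\beta_8u'(h_3-0)$, where $\pm0$ denotes one-sided limits. Also $N(f)=\beta_1f(1)-\beta_2f'(1)$ and $N'(f)=\beta_1'f(1)-\beta_2'f'(1)$. Hilbert space. $H_1$ is the complex space $L^2(I)$ with inner product $$\langle f,g\rangle_1=\frac1{p_1^2}\int_{-1}^{h_1}f\overline g\,dx+\frac1{p_2^2\theta}\int_{h_1}^{h_2}f\overline g\,dx+\frac1{p_3^2\theta\gamma}\int_{h_2}^{h_3}f\overline g\,dx+\frac1{p_4^2\theta\gamma\xi}\int_{h_3}^{1}f\overline g\,dx,$$ and $H=H_1\oplus\mathbb{C}$ has inner product $\langle(f,h),(g,k)\rangle=\langle f,g\rangle_1+\frac1{\rho\theta\gamma\xi}h\overline k$. Operator. $D(A)$ is the set of $(f,h)\in H$ such that $f$ and $f'$ are locally absolutely continuous on each of $(-1,h_1)$, $(h_1,h_2)$, $(h_2,h_3)$, $(h_3,1)$, $\tau f\in H_1$, $\tau_1f=\tau_3f=\tau_4f=\tau_5f=\tau_6f=\tau_7f=\tau_8f=0$, and $h=N'(f)$. (For such $f$, the functions $f,f'$ extend continuously to the closure of each of the four intervals, which gives meaning to the boundary values and one-sided limits.) For $F=(f,N'(f))\in D(A)$, $AF=(\tau f,-N(f))$. *)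

theory Defs
  imports "HOL-Analysis.Analysis"
begin

section \<open>The space of square-integrable functions\<close>

text \<open>
  The transmission points form a null set, so \<open>L\<^sup>2(I)\<close> is the space of Lebesgue square-integrable
  complex functions on \<open>[-1, 1]\<close> modulo equality almost everywhere; as a vector space it
  depends on none of the data of the problem, only its inner product does.
\<close>

abbreviation leb_I :: "real measure" where
  "leb_I \<equiv> lebesgue_on {-1..1}"

definition square_integrable :: "(real \<Rightarrow> complex) \<Rightarrow> bool" where
  "square_integrable f \<longleftrightarrow>
     f \<in> borel_measurable leb_I \<and> integrable leb_I (\<lambda>x. (cmod (f x))\<^sup>2)"

definition L2_rel :: "(real \<Rightarrow> complex) \<Rightarrow> (real \<Rightarrow> complex) \<Rightarrow> bool" where
  "L2_rel f g \<longleftrightarrow>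
     square_integrable f \<and> square_integrable g \<and> (AE x in leb_I. f x = g x)"

lemma square_integrable_zero: "square_integrable (\<lambda>x. 0)"
  by (simp add: square_integrable_def)

lemma square_integrable_add:
  assumes "square_integrable f" "square_integrable g"
  shows "square_integrable (\<lambda>x. f x + g x)"
proof -
  have [measurable]: "f \<in> borel_measurable leb_I" "g \<in> borel_measurable leb_I"
    and i: "integrable leb_I (\<lambda>x. 2 * (cmod (f x))\<^sup>2 + 2 * (cmod (g x))\<^sup>2)"
    using assms by (auto simp: square_integrable_def)
  have b: "(cmod (a + b))\<^sup>2 \<le> 2 * (cmod a)\<^sup>2 + 2 * (cmod b)\<^sup>2" for a b
  proof -
    have "(cmod (a + b))\<^sup>2 \<le> (cmod a + cmod b)\<^sup>2"
      by (simp add: norm_triangle_ineq power_mono)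
    also have "\<dots> \<le> 2 * (cmod a)\<^sup>2 + 2 * (cmod b)\<^sup>2"
      using sum_squares_bound[of "cmod a" "cmod b"] by (simp add: power2_sum)
    finally show ?thesis .
  qed
  have "integrable leb_I (\<lambda>x. (cmod (f x + g x))\<^sup>2)"
    by (rule Bochner_Integration.integrable_bound[OF i]) (use b in auto)
  then show ?thesis by (simp add: square_integrable_def)
qed

lemma square_integrable_scale:
  "square_integrable f \<Longrightarrow> square_integrable (\<lambda>x. c * f x)"
  by (auto simp: square_integrable_def norm_mult power_mult_distrib)

lemma square_integrable_uminus:
  "square_integrable f \<Longrightarrow> square_integrable (\<lambda>x. - f x)"
  using square_integrable_scale[of f "-1"] by simp

lemma square_integrable_diff:
  "square_integrable f \<Longrightarrow> square_integrable g \<Longrightarrow> square_integrable (\<lambda>x. f x - g x)"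
  using square_integrable_add[of f "\<lambda>x. - g x"] square_integrable_uminus[of g] by simp

quotient_type L2 = "real \<Rightarrow> complex" / partial: L2_rel
proof (rule part_equivpI)
  show "\<exists>f. L2_rel f f"
    by (rule exI[of _ "\<lambda>x. 0"]) (simp add: L2_rel_def square_integrable_zero)
  show "symp L2_rel"
    by (auto simp: symp_def L2_rel_def elim: eventually_mono)
  show "transp L2_rel"
    by (auto simp: transp_def L2_rel_def)
qed

instantiation L2 :: ab_group_add
begin

lift_definition zero_L2 :: L2 is "\<lambda>x. 0"
  by (simp add: L2_rel_def square_integrable_zero)

lift_definition plus_L2 :: "L2 \<Rightarrow> L2 \<Rightarrow> L2" is "\<lambda>f g x. f x + g x"
  by (auto simp: L2_rel_def square_integrable_add)

lift_definition uminus_L2 :: "L2 \<Rightarrow> L2" is "\<lambda>f x. - f x"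
  by (auto simp: L2_rel_def square_integrable_uminus)

lift_definition minus_L2 :: "L2 \<Rightarrow> L2 \<Rightarrow> L2" is "\<lambda>f g x. f x - g x"
  by (auto simp: L2_rel_def square_integrable_diff)

instance
proof
  fix a b c :: L2
  show "a + b + c = a + (b + c)"
    by transfer
      (auto simp: L2_rel_def algebra_simps intro!: square_integrable_add)
  show "a + b = b + a"
    by transfer (auto simp: L2_rel_def algebra_simps intro!: square_integrable_add)
  show "0 + a = a"
    by transfer (auto simp: L2_rel_def)
  show "- a + a = 0"
    by transfer (auto simp: L2_rel_def square_integrable_zero)
  show "a - b = a + - b"
    by transfer (auto simp: L2_rel_def intro!: square_integrable_diff)
qed

end

lift_definition scale_L2 :: "complex \<Rightarrow> L2 \<Rightarrow> L2" is "\<lambda>c f x. c * f x"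
  by (auto simp: L2_rel_def square_integrable_scale)

lemma vector_space_L2: "vector_space scale_L2"
proof
  fix a b :: complex and x y :: L2
  show "scale_L2 a (x + y) = scale_L2 a x + scale_L2 a y"
    by transfer (auto simp: L2_rel_def algebra_simps
        intro!: square_integrable_add square_integrable_scale)
  show "scale_L2 (a + b) x = scale_L2 a x + scale_L2 b x"
    by transfer (auto simp: L2_rel_def algebra_simps
        intro!: square_integrable_add square_integrable_scale)
  show "scale_L2 a (scale_L2 b x) = scale_L2 (a * b) x"
    by transfer (auto simp: L2_rel_def mult.assoc
        intro!: square_integrable_scale)
  show "scale_L2 1 x = x"
    by transfer (auto simp: L2_rel_def)
qed

section \<open>The Hilbert spaces \<open>H\<^sub>1\<close> and \<open>H\<close>\<close>

text \<open>\<open>h i\<close> and \<open>p i\<close> (\<open>i\<close> starting at 1) are the transmission points and the constants \<open>p\<^sub>i\<close>.\<close>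

lift_definition inner_H1 ::
    "(nat \<Rightarrow> real) \<Rightarrow> (nat \<Rightarrow> real) \<Rightarrow> real \<Rightarrow> real \<Rightarrow> real \<Rightarrow> L2 \<Rightarrow> L2 \<Rightarrow> complex" is
  "\<lambda>h p \<theta> \<gamma> \<xi> f g.
     of_real (1 / (p 1)\<^sup>2) * (LINT x:{-1<..<h 1}|leb_I. f x * cnj (g x))
   + of_real (1 / ((p 2)\<^sup>2 * \<theta>)) * (LINT x:{h 1<..<h 2}|leb_I. f x * cnj (g x))
   + of_real (1 / ((p 3)\<^sup>2 * \<theta> * \<gamma>)) * (LINT x:{h 2<..<h 3}|leb_I. f x * cnj (g x))
   + of_real (1 / ((p 4)\<^sup>2 * \<theta> * \<gamma> * \<xi>)) * (LINT x:{h 3<..<1}|leb_I. f x * cnj (g x))"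
proof -
  fix h p :: "nat \<Rightarrow> real" and \<theta> \<gamma> \<xi> :: real and f f' g g' :: "real \<Rightarrow> complex"
  assume f: "L2_rel f f'" and g: "L2_rel g g'"
  have [measurable]: "f \<in> borel_measurable leb_I" "f' \<in> borel_measurable leb_I"
      "g \<in> borel_measurable leb_I" "g' \<in> borel_measurable leb_I"
    using f g by (auto simp: L2_rel_def square_integrable_def)
  have ind [measurable]: "(indicator {a<..<b} :: real \<Rightarrow> real) \<in> borel_measurable leb_I" for a b
    by (intro measurable_restrict_space1 borel_measurable_indicator) auto
  have cnj_m: "(\<lambda>x. cnj (k x)) \<in> borel_measurable leb_I"
    if "k \<in> borel_measurable leb_I" for k
    using borel_measurable_continuous_onI[OF continuous_on_cnj[OF continuous_on_id]] that
    by (rule measurable_compose_rev)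
  have eq: "(LINT x:{a<..<b}|leb_I. f x * cnj (g x)) = (LINT x:{a<..<b}|leb_I. f' x * cnj (g' x))"
    for a b
    unfolding set_lebesgue_integral_def
  proof (rule integral_cong_AE)
    show "AE x in leb_I. indicator {a<..<b} x *\<^sub>R (f x * cnj (g x))
        = indicator {a<..<b} x *\<^sub>R (f' x * cnj (g' x))"
      using f g by (auto simp: L2_rel_def)
  qed (intro borel_measurable_scaleR borel_measurable_times ind cnj_m; measurable)+
  show "of_real (1 / (p 1)\<^sup>2) * (LINT x:{-1<..<h 1}|leb_I. f x * cnj (g x))
   + of_real (1 / ((p 2)\<^sup>2 * \<theta>)) * (LINT x:{h 1<..<h 2}|leb_I. f x * cnj (g x))
   + of_real (1 / ((p 3)\<^sup>2 * \<theta> * \<gamma>)) * (LINT x:{h 2<..<h 3}|leb_I. f x * cnj (g x))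
   + of_real (1 / ((p 4)\<^sup>2 * \<theta> * \<gamma> * \<xi>)) * (LINT x:{h 3<..<1}|leb_I. f x * cnj (g x))
   = of_real (1 / (p 1)\<^sup>2) * (LINT x:{-1<..<h 1}|leb_I. f' x * cnj (g' x))
   + of_real (1 / ((p 2)\<^sup>2 * \<theta>)) * (LINT x:{h 1<..<h 2}|leb_I. f' x * cnj (g' x))
   + of_real (1 / ((p 3)\<^sup>2 * \<theta> * \<gamma>)) * (LINT x:{h 2<..<h 3}|leb_I. f' x * cnj (g' x))
   + of_real (1 / ((p 4)\<^sup>2 * \<theta> * \<gamma> * \<xi>)) * (LINT x:{h 3<..<1}|leb_I. f' x * cnj (g' x))"
    by (simp only: eq)
qed

definition scale_H :: "complex \<Rightarrow> L2 \<times> complex \<Rightarrow> L2 \<times> complex" where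
  "scale_H c F = (scale_L2 c (fst F), c * snd F)"

definition inner_H ::
    "(nat \<Rightarrow> real) \<Rightarrow> (nat \<Rightarrow> real) \<Rightarrow> real \<Rightarrow> real \<Rightarrow> real \<Rightarrow> real \<Rightarrow>
     L2 \<times> complex \<Rightarrow> L2 \<times> complex \<Rightarrow> complex" where
  "inner_H h p \<theta> \<gamma> \<xi> \<rho> F G =
     inner_H1 h p \<theta> \<gamma> \<xi> (fst F) (fst G)
     + of_real (1 / (\<rho> * \<theta> * \<gamma> * \<xi>)) * (snd F * cnj (snd G))"

lemma vector_space_H: "vector_space scale_H"
proof -
  interpret L: vector_space scale_L2 by (rule vector_space_L2)
  show ?thesis
    by unfold_locales (auto simp: scale_H_def algebra_simps prod_eq_iff)
qed

section \<open>Self-adjoint operators\<close>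

text \<open>
  An operator is given by its graph. \<open>smul\<close> is the scalar multiplication and \<open>ip\<close> the inner product
  (linear in the first argument) of the ambient space, which is the whole type.
\<close>

definition linear_operator ::
    "(complex \<Rightarrow> 'h \<Rightarrow> 'h) \<Rightarrow> ('h::ab_group_add \<times> 'h) set \<Rightarrow> bool" where
  "linear_operator smul A \<longleftrightarrow>
     single_valued A \<and> (0, 0) \<in> A \<and>
     (\<forall>(F, AF)\<in>A. \<forall>(G, AG)\<in>A. (F + G, AF + AG) \<in> A) \<and>
     (\<forall>c. \<forall>(F, AF)\<in>A. (smul c F, smul c AF) \<in> A)"

definition densely_defined ::
    "('h \<Rightarrow> 'h \<Rightarrow> complex) \<Rightarrow> ('h::ab_group_add \<times> 'h) set \<Rightarrow> bool" where
  "densely_defined ip A \<longleftrightarrow>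
     (\<forall>G. \<forall>\<epsilon>>0. \<exists>F\<in>Domain A. sqrt (Re (ip (G - F) (G - F))) < \<epsilon>)"

definition adjoint_graph ::
    "('h \<Rightarrow> 'h \<Rightarrow> complex) \<Rightarrow> ('h \<times> 'h) set \<Rightarrow> ('h \<times> 'h) set" where
  "adjoint_graph ip A = {(G, K). \<forall>(F, AF)\<in>A. ip AF G = ip F K}"

definition self_adjoint_operator ::
    "(complex \<Rightarrow> 'h \<Rightarrow> 'h) \<Rightarrow> ('h \<Rightarrow> 'h \<Rightarrow> complex) \<Rightarrow> ('h::ab_group_add \<times> 'h) set \<Rightarrow> bool" where
  "self_adjoint_operator smul ip A \<longleftrightarrow>
     linear_operator smul A \<and> densely_defined ip A \<and> adjoint_graph ip A = A"

section \<open>Absolute continuity\<close>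

definition abs_continuous_on :: "real set \<Rightarrow> (real \<Rightarrow> complex) \<Rightarrow> bool" where
  "abs_continuous_on S f \<longleftrightarrow>
     (\<forall>\<epsilon>>0. \<exists>\<delta>>0. \<forall>D :: (real \<times> real) set.
        finite D \<and> (\<forall>(s, t)\<in>D. s \<le> t \<and> {s..t} \<subseteq> S) \<and>
        pairwise (\<lambda>(s, t) (s', t'). disjnt {s<..<t} {s'<..<t'}) D \<and>
        (\<Sum>(s, t)\<in>D. t - s) < \<delta>
        \<longrightarrow> (\<Sum>(s, t)\<in>D. norm (f t - f s)) < \<epsilon>)"

definition locally_abs_continuous_on :: "real set \<Rightarrow> (real \<Rightarrow> complex) \<Rightarrow> bool" where
  "locally_abs_continuous_on J f \<longleftrightarrow>
     (\<forall>a b. {a..b} \<subseteq> J \<longrightarrow> abs_continuous_on {a..b} f)"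

section \<open>The boundary value problem\<close>

definition I_set :: "(nat \<Rightarrow> real) \<Rightarrow> real set" where
  "I_set h = {-1..<h 1} \<union> {h 1<..<h 2} \<union> {h 2<..<h 3} \<union> {h 3<..1}"

abbreviation D1 :: "(real \<Rightarrow> complex) \<Rightarrow> real \<Rightarrow> complex" where
  "D1 u \<equiv> (\<lambda>x. vector_derivative u (at x))"

text \<open>The values at the transmission points, which do not belong to \<open>I\<close>, are irrelevant.\<close>

definition p_fun :: "(nat \<Rightarrow> real) \<Rightarrow> (nat \<Rightarrow> real) \<Rightarrow> real \<Rightarrow> real" where
  "p_fun h p x =
     (if x < h 1 then (p 1)\<^sup>2 else if x < h 2 then (p 2)\<^sup>2
      else if x < h 3 then (p 3)\<^sup>2 else (p 4)\<^sup>2)"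

text \<open>
  For \<open>u\<close> in the domain of the operator, \<open>p u'\<close> is differentiable only almost everywhere; at the other
  points the value of \<open>\<tau> u\<close> is arbitrary.
\<close>

definition tau ::
    "(nat \<Rightarrow> real) \<Rightarrow> (nat \<Rightarrow> real) \<Rightarrow> (real \<Rightarrow> real) \<Rightarrow> (real \<Rightarrow> complex) \<Rightarrow> real \<Rightarrow> complex" where
  "tau h p q u = (\<lambda>x. - D1 (\<lambda>y. of_real (p_fun h p y) * D1 u y) x + of_real (q x) * u x)"

abbreviation Rlim :: "(real \<Rightarrow> complex) \<Rightarrow> real \<Rightarrow> complex" where
  "Rlim u c \<equiv> Lim (at_right c) u"

abbreviation Llim :: "(real \<Rightarrow> complex) \<Rightarrow> real \<Rightarrow> complex" where
  "Llim u c \<equiv> Lim (at_left c) u"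

text \<open>
  Values at \<open>-1\<close> and \<open>1\<close> are those of the continuous extensions of \<open>u\<close> and \<open>u'\<close> from the adjacent
  open intervals.
\<close>

definition tau1 :: "(nat \<Rightarrow> real) \<Rightarrow> (real \<Rightarrow> complex) \<Rightarrow> complex" where
  "tau1 \<alpha> u = of_real (\<alpha> 1) * Rlim u (-1) + of_real (\<alpha> 2) * Rlim (D1 u) (-1)"

definition jump0 :: "real \<Rightarrow> real \<Rightarrow> real \<Rightarrow> (real \<Rightarrow> complex) \<Rightarrow> complex" where
  "jump0 c a b u = Rlim u c - of_real a * Llim u c - of_real b * Llim (D1 u) c"

definition jump1 :: "real \<Rightarrow> real \<Rightarrow> real \<Rightarrow> (real \<Rightarrow> complex) \<Rightarrow> complex" where
  "jump1 c a b u = Rlim (D1 u) c - of_real a * Llim u c - of_real b * Llim (D1 u) c"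

text \<open>\<open>bN (\<beta> 1) (\<beta> 2)\<close> is \<open>N\<close> and \<open>bN (\<beta>' 1) (\<beta>' 2)\<close> is \<open>N'\<close>.\<close>

definition bN :: "real \<Rightarrow> real \<Rightarrow> (real \<Rightarrow> complex) \<Rightarrow> complex" where
  "bN b1 b2 u = of_real b1 * Llim u 1 - of_real b2 * Llim (D1 u) 1"

definition regular_on :: "real set \<Rightarrow> (real \<Rightarrow> complex) \<Rightarrow> bool" where
  "regular_on J f \<longleftrightarrow>
     (\<forall>x\<in>J. f differentiable (at x)) \<and>
     locally_abs_continuous_on J f \<and> locally_abs_continuous_on J (D1 f)"

definition dom_A ::
    "(nat \<Rightarrow> real) \<Rightarrow> (nat \<Rightarrow> real) \<Rightarrow> (real \<Rightarrow> real) \<Rightarrow> (nat \<Rightarrow> real) \<Rightarrow> (nat \<Rightarrow> real) \<Rightarrow>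
     (real \<Rightarrow> complex) set" where
  "dom_A h p q \<alpha> \<beta> =
     {f. square_integrable f \<and>
         regular_on {-1<..<h 1} f \<and> regular_on {h 1<..<h 2} f \<and>
         regular_on {h 2<..<h 3} f \<and> regular_on {h 3<..<1} f \<and>
         square_integrable (tau h p q f) \<and>
         tau1 \<alpha> f = 0 \<and>
         jump0 (h 1) (\<alpha> 3) (\<beta> 3) f = 0 \<and> jump1 (h 1) (\<alpha> 4) (\<beta> 4) f = 0 \<and>
         jump0 (h 2) (\<alpha> 5) (\<beta> 5) f = 0 \<and> jump1 (h 2) (\<alpha> 6) (\<beta> 6) f = 0 \<and>
         jump0 (h 3) (\<alpha> 7) (\<beta> 7) f = 0 \<and> jump1 (h 3) (\<alpha> 8) (\<beta> 8) f = 0}"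

definition op_A ::
    "(nat \<Rightarrow> real) \<Rightarrow> (nat \<Rightarrow> real) \<Rightarrow> (real \<Rightarrow> real) \<Rightarrow> (nat \<Rightarrow> real) \<Rightarrow> (nat \<Rightarrow> real) \<Rightarrow>
     (nat \<Rightarrow> real) \<Rightarrow> ((L2 \<times> complex) \<times> (L2 \<times> complex)) set" where
  "op_A h p q \<alpha> \<beta> \<beta>' =
     {((abs_L2 f, bN (\<beta>' 1) (\<beta>' 2) f), (abs_L2 (tau h p q f), - bN (\<beta> 1) (\<beta> 2) f)) | f.
        f \<in> dom_A h p q \<alpha> \<beta>}"

end

theory Submission
  imports Defs
begin

text \<open>
  Write \<open>A\<close> for the operator. A symmetric operator for which \<open>A - \<i>\<close> and \<open>A + \<i>\<close> are both onto is densely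
  defined and self-adjoint (\<open>complex_hilbert_space.self_adjointI\<close>), so it suffices to prove that \<open>A\<close> is
  symmetric and that \<open>A - z\<close> is onto for every non-real \<open>z\<close>. Deducing density from surjectivity matters
  here: as \<open>q\<close> is only integrable, smooth functions with compact support need not belong to the domain.
  The deduction uses the projection onto a closed subspace, hence the completeness of \<open>H\<close>, which is the
  Riesz-Fischer theorem (\<open>Riesz_Fischer\<close>).

  Symmetry. The factors \<open>1 / p\<^sub>i\<^sup>2\<close> of the inner product cancel the leading coefficient of \<open>\<tau>\<close>, so on
  each piece Lagrange's identity turns \<open>\<langle>A F, G\<rangle> - \<langle>F, A G\<rangle>\<close> into values of the Wronskian of \<open>f\<close> and the
  conjugate of \<open>g\<close> at the two ends. A transmission condition multiplies Wronskians by its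
  determinant \<open>\<theta>\<close>, \<open>\<gamma>\<close> or \<open>\<xi>\<close>, which is what the remaining factors of the inner product undo, so
  the contributions of the interior nodes cancel. The Wronskian vanishes at \<open>-1\<close>, and the value at \<open>1\<close> is
  compensated by the second component (\<open>symmetric_A\<close>).

  Surjectivity. The equation \<open>\<tau> f - z f = \<psi>\<close> is a linear initial value problem with integrable
  coefficients. It is solved by Picard iteration on each piece (\<open>Caratheodory_second_order\<close>), with
  initial data handed over by the transmission conditions. The condition in the second component is
  met by adding a multiple of the homogeneous solution that satisfies the condition at \<open>-1\<close>; this is
  possible because otherwise that solution would be an eigenfunction with the non-real
  eigenvalue \<open>z\<close> (\<open>surjective_A\<close>).

  Both parts need the functions of the domain in integrated form. The definition of the domain
  speaks of local absolute continuity and pointwise derivatives. The fundamental theorem of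
  calculus for absolutely continuous functions, proved with the total variation, Stieltjes
  measures and the Radon-Nikodym theorem (\<open>abs_continuous_on_imp_indefinite_integral\<close>), translates
  this into integral equations on compact subintervals, and an a priori bound shows that \<open>f\<close> and
  \<open>f'\<close> extend continuously to the end points of each piece (\<open>regular_solution_extends\<close>).
\<close>


section \<open>Total variation of absolutely continuous functions\<close>

text \<open>
  The families of intervals of \<open>abs_continuous_on\<close>, but without degenerate intervals. Distinct
  members then have distinct non-empty interiors, so unions and images of such families are indexed
  injectively and sums over them split without correction terms.
\<close>

definition nonoverlapping :: "real set \<Rightarrow> (real \<times> real) set \<Rightarrow> bool" where
  "nonoverlapping S D \<longleftrightarrow>
     finite D \<and> (\<forall>(s, t)\<in>D. s < t \<and> {s..t} \<subseteq> S) \<and>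
     pairwise (\<lambda>(s, t) (s', t'). disjnt {s<..<t} {s'<..<t'}) D"

lemma nonoverlapping_mono: "nonoverlapping S D \<Longrightarrow> S \<subseteq> T \<Longrightarrow> nonoverlapping T D"
  unfolding nonoverlapping_def by fast

lemma nonoverlappingD:
  assumes "nonoverlapping S D"
  shows "finite D" "\<And>s t. (s, t) \<in> D \<Longrightarrow> s < t" "\<And>s t. (s, t) \<in> D \<Longrightarrow> {s..t} \<subseteq> S"
    "\<And>s t s' t' x. (s, t) \<in> D \<Longrightarrow> (s', t') \<in> D \<Longrightarrow> s < x \<Longrightarrow> x < t \<Longrightarrow> s' < x \<Longrightarrow> x < t' \<Longrightarrow> (s, t) = (s', t')"
proof -
  show "finite D" "\<And>s t. (s, t) \<in> D \<Longrightarrow> s < t" "\<And>s t. (s, t) \<in> D \<Longrightarrow> {s..t} \<subseteq> S"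
    using assms by (auto simp: nonoverlapping_def)
  fix s t s' t' x assume "(s, t) \<in> D" "(s', t') \<in> D" "s < x" "x < t" "s' < x" "x < t'"
  with assms show "(s, t) = (s', t')"
    unfolding nonoverlapping_def pairwise_def disjnt_iff by fastforce
qed

lemma nonoverlappingI:
  assumes "finite D" "\<And>s t. (s, t) \<in> D \<Longrightarrow> s < t \<and> {s..t} \<subseteq> S"
    "\<And>s t s' t' x. (s, t) \<in> D \<Longrightarrow> (s', t') \<in> D \<Longrightarrow> s < x \<Longrightarrow> x < t \<Longrightarrow> s' < x \<Longrightarrow> x < t' \<Longrightarrow> (s, t) = (s', t')"
  shows "nonoverlapping S D"
  using assms unfolding nonoverlapping_def pairwise_def disjnt_iff
  by (auto; blast)

lemma abs_continuous_on_nonoverlapping: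
  "abs_continuous_on S f \<longleftrightarrow>
     (\<forall>\<epsilon>>0. \<exists>\<delta>>0. \<forall>D. nonoverlapping S D \<longrightarrow> (\<Sum>(s, t)\<in>D. t - s) < \<delta> \<longrightarrow>
        (\<Sum>(s, t)\<in>D. norm (f t - f s)) < \<epsilon>)" (is "?L \<longleftrightarrow> ?R")
proof
  assume L: ?L
  show ?R
  proof (intro allI impI)
    fix \<epsilon> :: real assume "\<epsilon> > 0"
    then obtain \<delta> where d: "\<delta> > 0" "\<And>D. finite D \<Longrightarrow> (\<forall>(s, t)\<in>D. s \<le> t \<and> {s..t} \<subseteq> S) \<Longrightarrow>
        pairwise (\<lambda>(s, t) (s', t'). disjnt {s<..<t} {s'<..<t'}) D \<Longrightarrow>
        (\<Sum>(s, t)\<in>D. t - s) < \<delta> \<Longrightarrow> (\<Sum>(s, t)\<in>D. norm (f t - f s)) < \<epsilon>"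
      using L unfolding abs_continuous_on_def by (auto 4 4)
    show "\<exists>\<delta>>0. \<forall>D. nonoverlapping S D \<longrightarrow> (\<Sum>(s, t)\<in>D. t - s) < \<delta> \<longrightarrow>
        (\<Sum>(s, t)\<in>D. norm (f t - f s)) < \<epsilon>"
    proof (intro exI[of _ \<delta>] conjI allI impI d)
      fix D assume *: "nonoverlapping S D"
      then show "finite D" "pairwise (\<lambda>(s, t) (s', t'). disjnt {s<..<t} {s'<..<t'}) D"
        by (auto simp: nonoverlapping_def)
      show "\<forall>(s, t)\<in>D. s \<le> t \<and> {s..t} \<subseteq> S"
        using nonoverlappingD(2,3)[OF *] by fastforce
    qed
  qed
next
  assume R: ?R
  show ?L unfolding abs_continuous_on_def
  proof (intro allI impI)
    fix \<epsilon> :: real assume "\<epsilon> > 0"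
    then obtain \<delta> where d: "\<delta> > 0" "\<And>D. nonoverlapping S D \<Longrightarrow> (\<Sum>(s, t)\<in>D. t - s) < \<delta> \<Longrightarrow>
        (\<Sum>(s, t)\<in>D. norm (f t - f s)) < \<epsilon>"
      using R by meson
    show "\<exists>\<delta>>0. \<forall>D. finite D \<and> (\<forall>(s, t)\<in>D. s \<le> t \<and> {s..t} \<subseteq> S) \<and>
        pairwise (\<lambda>(s, t) (s', t'). disjnt {s<..<t} {s'<..<t'}) D \<and>
        (\<Sum>(s, t)\<in>D. t - s) < \<delta> \<longrightarrow> (\<Sum>(s, t)\<in>D. norm (f t - f s)) < \<epsilon>"
    proof (intro exI[of _ \<delta>] conjI allI impI d(1), elim conjE)
      fix D assume *: "finite D" "\<forall>(s, t)\<in>D. s \<le> t \<and> {s..t} \<subseteq> S"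
        "pairwise (\<lambda>(s, t) (s', t'). disjnt {s<..<t} {s'<..<t'}) D" "(\<Sum>(s, t)\<in>D. t - s) < \<delta>"
      define E where "E = {(s, t)\<in>D. s < t}"
      have ED: "E \<subseteq> D" by (auto simp: E_def)
      have zero: "s = t" if "(s, t) \<in> D" "(s, t) \<notin> E" for s t
        using *(2) that by (force simp: E_def)
      have "nonoverlapping S E"
        unfolding nonoverlapping_def
      proof (intro conjI)
        show "finite E" "pairwise (\<lambda>(s, t) (s', t'). disjnt {s<..<t} {s'<..<t'}) E"
          using finite_subset[OF ED *(1)] pairwise_subset[OF *(3) ED] by blast+
        show "\<forall>(s, t)\<in>E. s < t \<and> {s..t} \<subseteq> S" using *(2) unfolding E_def by blast
      qed
      moreover have "(\<Sum>(s, t)\<in>E. t - s) = (\<Sum>(s, t)\<in>D. t - s)"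
        by (intro sum.mono_neutral_left *(1) ED) (auto dest: zero)
      moreover have "(\<Sum>(s, t)\<in>E. norm (f t - f s)) = (\<Sum>(s, t)\<in>D. norm (f t - f s))"
        by (intro sum.mono_neutral_left *(1) ED) (auto dest: zero)
      ultimately show "(\<Sum>(s, t)\<in>D. norm (f t - f s)) < \<epsilon>"
        using d(2)[of E] * by simp
    qed
  qed
qed

text \<open>
  Intersecting a family with \<open>[c, d]\<close> amounts to moving all end points with the retraction \<open>k\<close>.
  Intervals that do not meet \<open>(c, d)\<close> collapse; the condition \<open>g u u = 0\<close> lets them disappear from
  the sum.
\<close>

lemma nonoverlapping_clamp:
  assumes D: "nonoverlapping S D" and "c \<le> d"
  defines "k \<equiv> (\<lambda>x. max c (min d x))"
  obtains D' where "nonoverlapping {c..d} D'"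
    "\<And>g :: real \<Rightarrow> real \<Rightarrow> real. (\<And>u. g u u = 0) \<Longrightarrow> (\<Sum>(s, t)\<in>D'. g s t) = (\<Sum>(s, t)\<in>D. g (k s) (k t))"
proof
  define E where "E = {(s, t)\<in>D. k s < k t}"
  define D' where "D' = (\<lambda>(s, t). (k s, k t)) ` E"
  note nd = nonoverlappingD[OF D]
  have in_k: "s < x \<and> x < t" if "k s < x" "x < k t" for s t x
    using that \<open>c \<le> d\<close> by (auto simp: k_def)
  have [simp]: "finite E" using nd(1) by (auto simp: E_def intro: finite_subset)
  have u: "(s, t) = (s', t')" if "(s, t) \<in> E" "(s', t') \<in> E" "k s < x" "x < k t" "k s' < x" "x < k t'"
    for s t s' t' x
  proof (rule nd(4))
    show "(s, t) \<in> D" "(s', t') \<in> D" using that(1,2) by (auto simp: E_def)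
    show "s < x" "x < t" "s' < x" "x < t'" using in_k that(3-6) by blast+
  qed
  show "nonoverlapping {c..d} D'"
  proof (rule nonoverlappingI)
    show "finite D'" by (simp add: D'_def)
    show "s < t \<and> {s..t} \<subseteq> {c..d}" if "(s, t) \<in> D'" for s t
      using that \<open>c \<le> d\<close> by (auto simp: D'_def E_def k_def)
    show "(s, t) = (s', t')" if "(s, t) \<in> D'" "(s', t') \<in> D'" "s < x" "x < t" "s' < x" "x < t'"
      for s t s' t' x
      using that u unfolding D'_def by fastforce
  qed
  have inj: "inj_on (\<lambda>(s, t). (k s, k t)) E"
  proof (rule inj_onI, clarsimp)
    fix s t s' t' assume *: "(s, t) \<in> E" "(s', t') \<in> E" "k s = k s'" "k t = k t'"
    then have "k s < k t" by (auto simp: E_def)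
    then obtain x where "k s < x" "x < k t" using dense by blast
    then show "s = s' \<and> t = t'" using u[of s t s' t' x] * by auto
  qed
  fix g :: "real \<Rightarrow> real \<Rightarrow> real" assume g: "\<And>u. g u u = 0"
  have "(\<Sum>(s, t)\<in>D'. g s t) = (\<Sum>(s, t)\<in>E. g (k s) (k t))"
    unfolding D'_def by (subst sum.reindex[OF inj]) (auto intro!: sum.cong)
  also have "\<dots> = (\<Sum>(s, t)\<in>D. g (k s) (k t))"
  proof (rule sum.mono_neutral_left)
    show "\<forall>i\<in>D - E. (case i of (s, t) \<Rightarrow> g (k s) (k t)) = 0"
    proof clarify
      fix s t assume *: "(s, t) \<in> D" "(s, t) \<notin> E"
      then have "s < t" "\<not> k s < k t" using nd(2) by (auto simp: E_def)
      then have "k s = k t" by (auto simp: k_def split: if_splits)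
      then show "g (k s) (k t) = 0" using g by simp
    qed
  qed (use nd in \<open>auto simp: E_def\<close>)
  finally show "(\<Sum>(s, t)\<in>D'. g s t) = (\<Sum>(s, t)\<in>D. g (k s) (k t))" .
qed

text \<open>Refinement: each interval of \<open>D\<close> is replaced by a family of subintervals.\<close>

lemma nonoverlapping_UN:
  assumes D: "nonoverlapping S D" and E: "\<And>s t. (s, t) \<in> D \<Longrightarrow> nonoverlapping {s..t} (E (s, t))"
  shows "nonoverlapping S (\<Union>i\<in>D. E i)"
    and "(\<Sum>i\<in>(\<Union>i\<in>D. E i). g i) = (\<Sum>i\<in>D. \<Sum>j\<in>E i. (g j::real))"
proof -
  note nd = nonoverlappingD[OF D] and ne = nonoverlappingD[OF E]
  have sub: "s \<le> u \<and> u < v \<and> v \<le> t" if "(s, t) \<in> D" "(u, v) \<in> E (s, t)" for s t u v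
    using ne(2)[OF that] ne(3)[OF that] by auto
  show "nonoverlapping S (\<Union>i\<in>D. E i)"
  proof (rule nonoverlappingI)
    show "finite (\<Union>i\<in>D. E i)" using nd(1) ne(1) by auto
    show "s < t \<and> {s..t} \<subseteq> S" if "(s, t) \<in> (\<Union>i\<in>D. E i)" for s t
      using that sub nd(3) by fastforce
    fix s t s' t' x assume *: "(s, t) \<in> (\<Union>i\<in>D. E i)" "(s', t') \<in> (\<Union>i\<in>D. E i)"
      "s < x" "x < t" "s' < x" "x < t'"
    then obtain a b a' b' where 1: "(a, b) \<in> D" "(s, t) \<in> E (a, b)" "(a', b') \<in> D" "(s', t') \<in> E (a', b')"
      by auto
    have "(a, b) = (a', b')"
      using nd(4)[of a b a' b' x] 1 sub[of a b s t] sub[of a' b' s' t'] * by auto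
    then show "(s, t) = (s', t')" using ne(4) 1 * by blast
  qed
  show "(\<Sum>i\<in>(\<Union>i\<in>D. E i). g i) = (\<Sum>i\<in>D. \<Sum>j\<in>E i. g j)"
  proof (rule sum.UNION_disjoint)
    show "\<forall>i\<in>D. \<forall>j\<in>D. i \<noteq> j \<longrightarrow> E i \<inter> E j = {}"
    proof (intro ballI impI)
      fix i j assume *: "i \<in> D" "j \<in> D" "i \<noteq> j"
      obtain s t s' t' where ij: "i = (s, t)" "j = (s', t')" by fastforce
      have False if 1: "(u, v) \<in> E (s, t)" "(u, v) \<in> E (s', t')" for u v
      proof -
        obtain x where "u < x" "x < v" using sub[of s t u v] * ij 1 dense by blast
        then show False
          using nd(4)[of s t s' t' x] sub[of s t u v] sub[of s' t' u v] * ij 1 by auto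
      qed
      then show "E i \<inter> E j = {}" using ij by auto
    qed
  qed (use nd(1) ne(1) in auto)
qed

lemma nonoverlapping_length_le:
  assumes D: "nonoverlapping {a..b} D" and "a \<le> b"
  shows "(\<Sum>(s, t)\<in>D. t - s) \<le> b - a"
proof -
  note nd = nonoverlappingD[OF D]
  have "(\<Sum>(s, t)\<in>D. t - s) = (\<Sum>i\<in>D. measure lborel {fst i<..<snd i})"
    using nd(2) by (auto intro!: sum.cong simp: less_imp_le)
  also have "\<dots> = measure lborel (\<Union>i\<in>D. {fst i<..<snd i})"
  proof (intro measure_UNION'[symmetric] nd(1))
    show "pairwise (\<lambda>i j. disjnt {fst i<..<snd i} {fst j<..<snd j}) D"
      unfolding pairwise_def disjnt_iff using nd(4) by (metis greaterThanLessThan_iff prod.collapse)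
    show "{fst i<..<snd i} \<in> fmeasurable lborel" if "i \<in> D" for i
      using nd(2)[of "fst i" "snd i"] that by (auto simp: fmeasurable_def)
  qed
  also have "\<dots> \<le> measure lborel {a..b}"
  proof (rule measure_mono_fmeasurable)
    show "(\<Union>i\<in>D. {fst i<..<snd i}) \<subseteq> {a..b}"
    proof
      fix x assume "x \<in> (\<Union>i\<in>D. {fst i<..<snd i})"
      then obtain s t where "(s, t) \<in> D" "x \<in> {s<..<t}" by auto
      then show "x \<in> {a..b}" using nd(3)[of s t] by (auto simp: subset_iff)
    qed
    show "(\<Union>i\<in>D. {fst i<..<snd i}) \<in> sets lborel" using nd(1) by auto
  qed (use \<open>a \<le> b\<close> in \<open>auto simp: fmeasurable_def\<close>)
  also have "\<dots> = b - a" using \<open>a \<le> b\<close> by simp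
  finally show ?thesis .
qed

definition varsum :: "(real \<Rightarrow> complex) \<Rightarrow> (real \<times> real) set \<Rightarrow> real" where
  "varsum f D = (\<Sum>(s, t)\<in>D. norm (f t - f s))"

definition variation :: "(real \<Rightarrow> complex) \<Rightarrow> real \<Rightarrow> real \<Rightarrow> real" where
  "variation f a b = Sup (varsum f ` {D. nonoverlapping {a..b} D})"

lemma nonoverlapping_empty [simp]: "nonoverlapping S {}"
  by (simp add: nonoverlapping_def)

lemma varsum_split:
  assumes D: "nonoverlapping {a..b} D" and "a \<le> c" "c \<le> b"
  obtains D1 D2 where "nonoverlapping {a..c} D1" "nonoverlapping {c..b} D2"
    "varsum f D \<le> varsum f D1 + varsum f D2"
proof -
  obtain D1 where D1: "nonoverlapping {a..c} D1"
    "\<And>g :: real \<Rightarrow> real \<Rightarrow> real. (\<And>u. g u u = 0) \<Longrightarrow>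
       (\<Sum>(s, t)\<in>D1. g s t) = (\<Sum>(s, t)\<in>D. g (max a (min c s)) (max a (min c t)))"
    using nonoverlapping_clamp[OF D \<open>a \<le> c\<close>] by metis
  obtain D2 where D2: "nonoverlapping {c..b} D2"
    "\<And>g :: real \<Rightarrow> real \<Rightarrow> real. (\<And>u. g u u = 0) \<Longrightarrow>
       (\<Sum>(s, t)\<in>D2. g s t) = (\<Sum>(s, t)\<in>D. g (max c (min b s)) (max c (min b t)))"
    using nonoverlapping_clamp[OF D \<open>c \<le> b\<close>] by metis
  note nd = nonoverlappingD[OF D]
  have "varsum f D \<le> (\<Sum>(s, t)\<in>D. norm (f (max a (min c t)) - f (max a (min c s)))) +
      (\<Sum>(s, t)\<in>D. norm (f (max c (min b t)) - f (max c (min b s))))"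
    unfolding varsum_def sum.distrib[symmetric]
  proof (rule sum_mono, clarify)
    fix s t assume st: "(s, t) \<in> D"
    then have *: "a \<le> s" "s < t" "t \<le> b" using nd(2)[OF st] nd(3)[OF st] by auto
    consider "t \<le> c" | "c \<le> s" | "s < c" "c < t" by linarith
    then show "norm (f t - f s) \<le> norm (f (max a (min c t)) - f (max a (min c s))) +
        norm (f (max c (min b t)) - f (max c (min b s)))"
    proof cases
      case 3
      then have "f (max a (min c t)) = f c" "f (max a (min c s)) = f s"
        "f (max c (min b t)) = f t" "f (max c (min b s)) = f c"
        using * assms by (auto simp: max_def min_def)
      then show ?thesis using norm_triangle_ineq[of "f c - f s" "f t - f c"] by simp
    qed (use * in \<open>auto simp: max_def min_def\<close>)
  qed
  also have "\<dots> = varsum f D1 + varsum f D2"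
    unfolding varsum_def by (subst D1(2), simp, subst D2(2)) auto
  finally show ?thesis using that D1(1) D2(1) by blast
qed

text \<open>
  On an interval shorter than the \<open>\<delta>\<close> that belongs to \<open>\<epsilon> = 1\<close> every variation sum is below 1;
  cutting \<open>[a, b]\<close> into pieces of length \<open>\<delta>/2\<close> bounds the variation by the number of pieces.
\<close>

lemma varsum_bounded:
  assumes f: "abs_continuous_on {a..b} f"
  shows "bdd_above (varsum f ` {D. nonoverlapping {a..b} D})"
proof (cases "a \<le> b")
  case False
  then have emp: "D = {}" if "nonoverlapping {a..b} D" for D
    using nonoverlappingD(2,3)[OF that] by (auto simp: subset_iff) fastforce
  have "varsum f D = 0" if "nonoverlapping {a..b} D" for D
    using emp[OF that] by (simp add: varsum_def)
  then show ?thesis by (auto intro!: bdd_aboveI[of _ 0])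
next
  case True
  obtain \<delta> where d: "\<delta> > 0" "\<And>D. nonoverlapping {a..b} D \<Longrightarrow> (\<Sum>(s, t)\<in>D. t - s) < \<delta> \<Longrightarrow> varsum f D < 1"
    using f unfolding abs_continuous_on_nonoverlapping varsum_def by (meson zero_less_one)
  have "varsum f D \<le> n" if "nonoverlapping {a..c} D" "a \<le> c" "c \<le> b" "c \<le> a + n * (\<delta>/2)" for n :: nat and c D
    using that
  proof (induction n arbitrary: c D)
    case 0
    have "i \<notin> D" for i
    proof
      assume "i \<in> D"
      then have "fst i < snd i" "{fst i..snd i} \<subseteq> {a..c}"
        using nonoverlappingD(2,3)[OF 0(1), of "fst i" "snd i"] by auto
      then show False using 0 by simp
    qed
    then have "D = {}" by blast
    then show ?case by (simp add: varsum_def)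
  next
    case (Suc n)
    define e where "e = max a (c - \<delta>/2)"
    have e: "a \<le> e" "e \<le> c" "e \<le> a + n * (\<delta>/2)" "c - e < \<delta>"
      using Suc.prems d by (auto simp: e_def algebra_simps add_divide_distrib)
    obtain D1 D2 where 12: "nonoverlapping {a..e} D1" "nonoverlapping {e..c} D2"
      "varsum f D \<le> varsum f D1 + varsum f D2"
      using varsum_split[OF Suc.prems(1) e(1,2)] by metis
    have "varsum f D1 \<le> n" using Suc.IH[of e D1] 12 e Suc.prems by auto
    moreover have "varsum f D2 < 1"
    proof (rule d(2))
      show "nonoverlapping {a..b} D2" using 12(2) e Suc.prems by (auto intro: nonoverlapping_mono)
      show "(\<Sum>(s, t)\<in>D2. t - s) < \<delta>" using nonoverlapping_length_le[OF 12(2)] e by simp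
    qed
    ultimately show ?case using 12(3) by simp
  qed
  moreover obtain n :: nat where "(b - a) / (\<delta>/2) \<le> n" using real_arch_simple by blast
  ultimately show ?thesis
    using True d(1) by (intro bdd_aboveI[of _ "real n"]) (auto simp: field_simps)
qed

lemma abs_continuous_on_subset: "abs_continuous_on S f \<Longrightarrow> T \<subseteq> S \<Longrightarrow> abs_continuous_on T f"
  unfolding abs_continuous_on_nonoverlapping by (meson nonoverlapping_mono)

lemma varsum_le_variation:
  assumes "abs_continuous_on {a..b} f" "nonoverlapping {a..b} D"
  shows "varsum f D \<le> variation f a b"
  unfolding variation_def using varsum_bounded[OF assms(1)] assms(2) by (intro cSup_upper) auto

lemma variation_approx:
  assumes "abs_continuous_on {a..b} f" "e > 0"
  obtains D where "nonoverlapping {a..b} D" "variation f a b - e < varsum f D"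
proof -
  have "\<exists>y\<in>varsum f ` {D. nonoverlapping {a..b} D}. variation f a b - e < y"
    unfolding variation_def
    by (rule less_cSupD) (use assms in \<open>auto intro!: exI[of _ "{}"]\<close>)
  then show ?thesis using that by auto
qed

lemma variation_add_le:
  assumes f: "abs_continuous_on {a..b} f" and "a \<le> c" "c \<le> b"
  shows "variation f a b \<le> variation f a c + variation f c b"
  unfolding variation_def[of f a b]
proof (rule cSup_least)
  show "varsum f ` {D. nonoverlapping {a..b} D} \<noteq> {}" by (auto intro!: exI[of _ "{}"])
  have f': "abs_continuous_on {a..c} f" "abs_continuous_on {c..b} f"
    using f assms by (auto elim!: abs_continuous_on_subset)
  fix x assume "x \<in> varsum f ` {D. nonoverlapping {a..b} D}"
  then obtain D where D: "x = varsum f D" "nonoverlapping {a..b} D" by auto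
  then show "x \<le> variation f a c + variation f c b"
    using varsum_split[OF D(2) assms(2,3), of f] varsum_le_variation f' by (smt (verit))
qed

lemma variation_ge_increment:
  assumes f: "abs_continuous_on {a..y} f" and "a \<le> x" "x \<le> y"
  shows "norm (f y - f x) \<le> variation f a y - variation f a x"
proof (cases "x = y")
  case False
  then have "x < y" using assms by simp
  have "variation f a x \<le> variation f a y - norm (f y - f x)"
    unfolding variation_def[of f a x]
  proof (rule cSup_least)
    show "varsum f ` {D. nonoverlapping {a..x} D} \<noteq> {}" by (auto intro!: exI[of _ "{}"])
    fix z assume "z \<in> varsum f ` {D. nonoverlapping {a..x} D}"
    then obtain D where D: "z = varsum f D" "nonoverlapping {a..x} D" by auto
    note nd = nonoverlappingD[OF D(2)]
    have lex: "s < t \<and> a \<le> s \<and> t \<le> x" if "(s, t) \<in> D" for s t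
      using nd(2,3)[OF that] by auto
    have "nonoverlapping {a..y} (insert (x, y) D)"
    proof (rule nonoverlappingI)
      show "s < t \<and> {s..t} \<subseteq> {a..y}" if "(s, t) \<in> insert (x, y) D" for s t
        using that lex[of s t] assms \<open>x < y\<close> by auto
      show "(s, t) = (s', t')" if "(s, t) \<in> insert (x, y) D" "(s', t') \<in> insert (x, y) D"
        "s < z" "z < t" "s' < z" "z < t'" for s t s' t' z
        using that lex[of s t] lex[of s' t'] nd(4)[of s t s' t' z] by auto
    qed (use nd in simp)
    then have "varsum f (insert (x, y) D) \<le> variation f a y" by (rule varsum_le_variation[OF f])
    moreover have "(x, y) \<notin> D" using lex[of x y] \<open>x < y\<close> by auto
    ultimately show "z \<le> variation f a y - norm (f y - f x)"
      using nd(1) D by (simp add: varsum_def)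
  qed
  then show ?thesis by simp
qed simp

text \<open>
  A disjoint family \<open>D\<close> of small total length is refined, inside each of its intervals, by a family that
  almost realises the variation there. The refinement has no larger total length, so the
  absolute continuity of \<open>f\<close> bounds its variation sum, which exceeds the increments of the variation
  over \<open>D\<close> up to an error \<open>e\<close> per interval.
\<close>

lemma abs_continuous_on_variation:
  assumes f: "abs_continuous_on {a..b} f"
  shows "abs_continuous_on {a..b} (\<lambda>x. of_real (variation f a x))"
  unfolding abs_continuous_on_nonoverlapping
proof (intro allI impI)
  fix \<epsilon> :: real assume \<epsilon>: "\<epsilon> > 0"
  then obtain \<delta> where d: "\<delta> > 0" "\<And>D. nonoverlapping {a..b} D \<Longrightarrow> (\<Sum>(s, t)\<in>D. t - s) < \<delta> \<Longrightarrow> varsum f D < \<epsilon>/2"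
    using f half_gt_zero[OF \<epsilon>] unfolding abs_continuous_on_nonoverlapping varsum_def by metis
  show "\<exists>\<delta>>0. \<forall>D. nonoverlapping {a..b} D \<longrightarrow> (\<Sum>(s, t)\<in>D. t - s) < \<delta> \<longrightarrow>
        (\<Sum>(s, t)\<in>D. cmod (of_real (variation f a t) - of_real (variation f a s))) < \<epsilon>"
  proof (intro exI[of _ \<delta>] conjI allI impI d(1))
    fix D assume D: "nonoverlapping {a..b} D" "(\<Sum>(s, t)\<in>D. t - s) < \<delta>"
    note nd = nonoverlappingD[OF D(1)]
    have ab: "a \<le> s \<and> s < t \<and> t \<le> b" if "(s, t) \<in> D" for s t
      using nd(2,3)[OF that] by auto
    define e where "e = \<epsilon> / (2 * (card D + 1))"
    have e: "e > 0" using \<epsilon> by (simp add: e_def)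
    have ac: "abs_continuous_on {u..v} f" if "a \<le> u" "v \<le> b" for u v
      using f that by (auto elim!: abs_continuous_on_subset)
    have "\<exists>E. nonoverlapping {fst i..snd i} E \<and> variation f (fst i) (snd i) - e < varsum f E"
      if "i \<in> D" for i
      using variation_approx[OF ac e, of "fst i" "snd i"] ab[of "fst i" "snd i"] that by auto
    then obtain E where E: "\<And>i. i \<in> D \<Longrightarrow> nonoverlapping {fst i..snd i} (E i)"
      "\<And>i. i \<in> D \<Longrightarrow> variation f (fst i) (snd i) - e < varsum f (E i)" by metis
    have E1: "nonoverlapping {s..t} (E (s, t))" if "(s, t) \<in> D" for s t
      using E(1)[OF that] by simp
    note U = nonoverlapping_UN[OF D(1) E1]
    have "(\<Sum>(s, t)\<in>(\<Union>i\<in>D. E i). t - s) = (\<Sum>i\<in>D. \<Sum>(s, t)\<in>E i. t - s)"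
      by (rule U(2))
    also have "\<dots> \<le> (\<Sum>(s, t)\<in>D. t - s)"
    proof (rule sum_mono, clarify)
      fix s t assume "(s, t) \<in> D"
      then show "(\<Sum>(s, t)\<in>E (s, t). t - s) \<le> t - s"
        using nonoverlapping_length_le[OF E1] ab[of s t] by auto
    qed
    finally have "varsum f (\<Union>i\<in>D. E i) < \<epsilon>/2" using d(2)[OF U(1)] D(2) by simp
    moreover have "varsum f (\<Union>i\<in>D. E i) = (\<Sum>i\<in>D. varsum f (E i))"
      unfolding varsum_def by (rule U(2))
    moreover have "(\<Sum>(s, t)\<in>D. cmod (of_real (variation f a t) - of_real (variation f a s))) \<le>
        (\<Sum>i\<in>D. varsum f (E i) + e)"
    proof (rule sum_mono, clarify)
      fix s t assume st: "(s, t) \<in> D"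
      note ab' = ab[OF st]
      have "variation f a t \<le> variation f a s + variation f s t"
        using ab' by (intro variation_add_le ac) auto
      moreover have "0 \<le> variation f a t - variation f a s"
        using variation_ge_increment[OF ac, of a t s] norm_ge_zero[of "f t - f s"] ab' by linarith
      ultimately show "cmod (of_real (variation f a t) - of_real (variation f a s)) \<le> varsum f (E (s, t)) + e"
        using E(2)[OF st] by (simp add: of_real_diff[symmetric] del: of_real_diff)
    qed
    moreover have "real (card D) * e \<le> \<epsilon>/2" using \<epsilon> by (simp add: e_def field_simps)
    ultimately show "(\<Sum>(s, t)\<in>D. cmod (of_real (variation f a t) - of_real (variation f a s))) < \<epsilon>"
      by (simp add: sum.distrib)
  qed
qed

section \<open>Absolutely continuous functions are indefinite integrals\<close>

lemma abs_continuous_imp_continuous_on: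
  assumes f: "abs_continuous_on {a..b} f"
  shows "continuous_on {a..b} f"
  unfolding continuous_on_iff
proof (intro ballI allI impI)
  fix x and e :: real assume x: "x \<in> {a..b}" and "e > 0"
  then obtain \<delta> where d: "\<delta> > 0" "\<And>D. nonoverlapping {a..b} D \<Longrightarrow> (\<Sum>(s, t)\<in>D. t - s) < \<delta> \<Longrightarrow>
      (\<Sum>(s, t)\<in>D. norm (f t - f s)) < e"
    using f unfolding abs_continuous_on_nonoverlapping by meson
  have *: "norm (f t - f s) < e" if "s \<in> {a..b}" "t \<in> {a..b}" "s < t" "t - s < \<delta>" for s t
  proof -
    have "nonoverlapping {a..b} {(s, t)}" using that by (intro nonoverlappingI) auto
    from d(2)[OF this] show ?thesis using that by simp
  qed
  show "\<exists>d>0. \<forall>x'\<in>{a..b}. dist x' x < d \<longrightarrow> dist (f x') (f x) < e"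
  proof (intro exI[of _ \<delta>] conjI ballI impI d(1))
    fix y assume y: "y \<in> {a..b}" "dist y x < \<delta>"
    consider "y < x" | "x < y" | "x = y" by linarith
    then show "dist (f y) (f x) < e"
    proof cases
      case 1 then show ?thesis using *[of y x] x y by (simp add: dist_norm norm_minus_commute)
    next
      case 2 then show ?thesis using *[of x y] x y by (simp add: dist_norm)
    qed (use \<open>e > 0\<close> in simp)
  qed
qed

text \<open>
  An open set is an increasing union of finite unions of closed intervals, and a finite union of
  intervals can be cut into non-overlapping ones, to which the assumption on families applies.
\<close>

lemma interval_measure_open_less:
  fixes F :: "real \<Rightarrow> real"
  assumes mono: "\<And>x y. x \<le> y \<Longrightarrow> F x \<le> F y" and cont: "continuous_on UNIV F"
    and d: "\<And>D. nonoverlapping UNIV D \<Longrightarrow> (\<Sum>(s, t)\<in>D. t - s) < \<delta> \<Longrightarrow> (\<Sum>(s, t)\<in>D. F t - F s) \<le> \<epsilon>"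
    and U: "open U" "emeasure lborel U < ennreal \<delta>" and "\<delta> > 0" "\<epsilon> \<ge> 0"
  shows "emeasure (interval_measure F) U \<le> ennreal \<epsilon>"
proof -
  let ?M = "interval_measure F"
  have Icc: "emeasure ?M {s..t} = ennreal (F t - F s)" if "s \<le> t" for s t
    using emeasure_interval_measure_Icc[OF that mono cont] .
  obtain C where C: "countable C" "\<And>X. X \<in> C \<Longrightarrow> X \<subseteq> U" "\<And>X. X \<in> C \<Longrightarrow> \<exists>a b. X = cbox a b" "\<Union>C = U"
    using open_countable_Union_open_cbox[OF U(1)] by (metis Pow_iff subsetD)
  define X where "X = (\<lambda>n. \<Union> (from_nat_into (insert {} C) ` {..n::nat}))"
  have Xb [measurable]: "X n \<in> sets borel" for n
  proof -
    have "from_nat_into (insert {} C) i \<in> sets borel" for i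
      using from_nat_into[of "insert {} C" i] C(3)
      by (metis borel_closed closed_cbox empty_iff insertE sets.empty_sets insert_not_empty)
    then show ?thesis unfolding X_def by (auto intro!: sets.finite_UN)
  qed
  have fin: "emeasure ?M (X n) \<le> ennreal \<epsilon>" for n
  proof -
    let ?F = "from_nat_into (insert {} C) ` {..n::nat}"
    have sub: "?F \<subseteq> insert {} C" using from_nat_into[of "insert {} C"] by auto
    have "\<exists>a b. s = cbox a b" if "s \<in> ?F" for s
    proof (cases "s = {}")
      case True then show ?thesis by (intro exI[of _ 1] exI[of _ 0]) simp
    qed (use that sub C(3) in blast)
    then obtain p where p: "p division_of X n"
      using elementary_unions_intervals[of ?F] unfolding X_def by auto
    define D where "D = {(s, t). s < t \<and> cbox s t \<in> p}"
    note pd = division_ofD[OF p]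
    have inj: "inj_on (\<lambda>(s, t). cbox s t) D"
      by (auto simp: D_def inj_on_def Icc_eq_Icc)
    have "(\<lambda>(s, t). cbox s t) ` D \<subseteq> p" by (auto simp: D_def)
    then have finD: "finite D" using inj pd(1) by (meson finite_imageD finite_subset)
    have D: "nonoverlapping UNIV D"
    proof (rule nonoverlappingI[OF finD])
      show "s < t \<and> {s..t} \<subseteq> UNIV" if "(s, t) \<in> D" for s t using that by (auto simp: D_def)
      fix s t s' t' x assume *: "(s, t) \<in> D" "(s', t') \<in> D" "s < x" "x < t" "s' < x" "x < t'"
      then have "x \<in> interior (cbox s t) \<inter> interior (cbox s' t')" by (auto simp: interior_cbox)
      moreover have "cbox s t \<in> p" "cbox s' t' \<in> p" using * by (auto simp: D_def)
      ultimately have "cbox s t = cbox s' t'" using pd(5) by blast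
      then show "(s, t) = (s', t')" using * by (auto simp: Icc_eq_Icc)
    qed
    have "X n \<subseteq> U" using sub C unfolding X_def by blast
    have "(\<Sum>(s, t)\<in>D. t - s) = (\<Sum>i\<in>D. measure lborel ((\<lambda>(s, t). cbox s t) i))"
      by (intro sum.cong) (auto simp: D_def)
    also have "\<dots> = (\<Sum>k\<in>(\<lambda>(s, t). cbox s t) ` D. measure lborel k)"
      by (rule sum.reindex[OF inj, unfolded o_def, symmetric])
    also have "\<dots> \<le> (\<Sum>k\<in>p. measure lborel k)"
      by (rule sum_mono2) (use pd(1) in \<open>auto simp: D_def\<close>)
    also have "\<dots> = measure lebesgue (X n)"
    proof -
      have "sum (measure lborel) p = sum (measure lebesgue) p"
        by (intro sum.cong) (auto simp: measure_completion dest!: pd(4))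
      then show ?thesis using content_division[OF p] by simp
    qed
    also have "\<dots> < \<delta>"
    proof -
      have "emeasure lborel (X n) < ennreal \<delta>"
        using emeasure_mono[OF \<open>X n \<subseteq> U\<close>, of lborel] U by (auto intro: le_less_trans)
      then have "enn2real (emeasure lborel (X n)) < \<delta>"
        using enn2real_less_iff[of "emeasure lborel (X n)" \<delta>] \<open>\<delta> > 0\<close>
        by (cases "emeasure lborel (X n)") (auto simp: ennreal_less_iff)
      then show ?thesis using Xb[of n] by (simp add: measure_completion measure_def)
    qed
    finally have le: "(\<Sum>(s, t)\<in>D. F t - F s) \<le> \<epsilon>" by (rule d[OF D])
    have "emeasure ?M (X n) = emeasure ?M (\<Union>p)" using pd(6) by simp
    also have "\<dots> \<le> (\<Sum>k\<in>p. emeasure ?M k)"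
    proof -
      have "p \<subseteq> sets borel" by (auto dest!: pd(4))
      then show ?thesis using emeasure_subadditive_finite[of p "\<lambda>x. x" ?M] pd(1) by auto
    qed
    also have "\<dots> = (\<Sum>k\<in>(\<lambda>(s, t). cbox s t) ` D. emeasure ?M k)"
    proof (rule sum.mono_neutral_right[OF pd(1)], force simp: D_def, clarify)
      fix k assume k: "k \<in> p" "k \<notin> (\<lambda>(s, t). cbox s t) ` D"
      obtain s t where st: "k = cbox s t" using pd(4) k by blast
      have "s \<le> t" using pd(3) k st by fastforce
      moreover have "\<not> s < t" using k st by (auto simp: D_def)
      ultimately show "emeasure ?M k = 0" using Icc[of s t] st by simp
    qed
    also have "\<dots> = (\<Sum>(s, t)\<in>D. emeasure ?M (cbox s t))"
      by (subst sum.reindex[OF inj]) (auto intro!: sum.cong)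
    also have "\<dots> = (\<Sum>(s, t)\<in>D. ennreal (F t - F s))"
      by (intro sum.cong) (auto simp: D_def Icc)
    also have "\<dots> = ennreal (\<Sum>(s, t)\<in>D. F t - F s)"
      by (subst sum_ennreal[symmetric]) (auto simp: D_def mono intro!: sum.cong)
    also have "\<dots> \<le> ennreal \<epsilon>" using le by (rule ennreal_leI)
    finally show ?thesis .
  qed
  have "range (from_nat_into (insert {} C)) = insert {} C"
    using C(1) by (intro range_from_nat_into) auto
  moreover have "(\<Union>n. X n) = \<Union> (range (from_nat_into (insert {} C)))"
    unfolding X_def by auto
  ultimately have "(\<Union>n. X n) = U" using C(4) by simp
  moreover have "emeasure ?M (\<Union>n. X n) = (SUP n. emeasure ?M (X n))"
  proof (rule SUP_emeasure_incseq[symmetric])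
    show "range X \<subseteq> sets ?M" using Xb by auto
    show "incseq X" unfolding X_def by (intro monoI Union_mono image_mono) auto
  qed
  ultimately show ?thesis using fin by (auto intro: SUP_least)
qed

text \<open>
  Absolute continuity of \<open>F\<close> says that its Stieltjes measure is small on open sets of small Lebesgue
  measure. By outer regularity the Stieltjes measure vanishes on Lebesgue null sets, so
  the Radon-Nikodym theorem provides a density.
\<close>

lemma monotone_abs_continuous_density:
  fixes F :: "real \<Rightarrow> real"
  assumes mono: "\<And>x y. a \<le> x \<Longrightarrow> x \<le> y \<Longrightarrow> y \<le> b \<Longrightarrow> F x \<le> F y" and "a \<le> b"
    and ac: "abs_continuous_on {a..b} (\<lambda>x. of_real (F x))"
  obtains g where "g absolutely_integrable_on {a..b}" "\<And>x. x \<in> {a..b} \<Longrightarrow> F x = F a + integral {a..x} g"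
proof -
  (* Stieltjes measures need monotone functions on the whole line: F is continued by constants. *)
  define K where "K = (\<lambda>x. max a (min b x))"
  define G where "G = (\<lambda>x. F (K x))"
  have K: "K x \<in> {a..b}" for x using \<open>a \<le> b\<close> by (auto simp: K_def)
  have Kmono: "K x \<le> K y" if "x \<le> y" for x y using that by (auto simp: K_def)
  have Gmono: "G x \<le> G y" if "x \<le> y" for x y
    using mono[of "K x" "K y"] K[of x] K[of y] Kmono[OF that] by (auto simp: G_def)
  have "continuous_on {a..b} F"
    using continuous_on_Re[OF abs_continuous_imp_continuous_on[OF ac]] by simp
  moreover have "continuous_on UNIV K" unfolding K_def by (intro continuous_intros)
  ultimately have Gcont: "continuous_on UNIV G" unfolding G_def
    by (rule continuous_on_compose2) (use K in auto)
  let ?M = "interval_measure G"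
  have "absolutely_continuous (lborel :: real measure) ?M"
    unfolding absolutely_continuous_def
  proof
    fix N :: "real set" assume N: "N \<in> null_sets lborel"
    then have Nb: "N \<in> sets borel" by auto
    have "emeasure ?M N \<le> ennreal \<epsilon>" if "\<epsilon> > 0" for \<epsilon>
    proof -
      obtain \<delta> where d: "\<delta> > 0" "\<And>D. nonoverlapping {a..b} D \<Longrightarrow> (\<Sum>(s, t)\<in>D. t - s) < \<delta> \<Longrightarrow>
          (\<Sum>(s, t)\<in>D. cmod (of_real (F t) - of_real (F s))) < \<epsilon>"
        using ac \<open>\<epsilon> > 0\<close> unfolding abs_continuous_on_nonoverlapping by meson
      obtain U where U: "open U" "N \<subseteq> U" "emeasure lborel (U - N) < ennreal \<delta>"
        using outer_regular_lborel[OF Nb d(1)] by metis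
      have "emeasure lborel U = emeasure lborel (U - N)"
        using U(1) by (intro emeasure_Diff_null_set[OF N, symmetric]) auto
      then have lU: "emeasure lborel U < ennreal \<delta>" using U by simp
      have "emeasure ?M U \<le> ennreal \<epsilon>"
      proof (rule interval_measure_open_less[OF Gmono Gcont _ U(1) lU d(1)])
        fix D assume D: "nonoverlapping UNIV D" "(\<Sum>(s, t)\<in>D. t - s) < \<delta>"
        obtain D' where D': "nonoverlapping {a..b} D'"
          "\<And>g :: real \<Rightarrow> real \<Rightarrow> real. (\<And>u. g u u = 0) \<Longrightarrow> (\<Sum>(s, t)\<in>D'. g s t) = (\<Sum>(s, t)\<in>D. g (K s) (K t))"
          using nonoverlapping_clamp[OF D(1) \<open>a \<le> b\<close>] unfolding K_def by metis
        note nd = nonoverlappingD[OF D(1)]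
        have "(\<Sum>(s, t)\<in>D'. t - s) = (\<Sum>(s, t)\<in>D. K t - K s)" by (subst D'(2)) auto
        also have "\<dots> \<le> (\<Sum>(s, t)\<in>D. t - s)"
        proof (rule sum_mono, clarify)
          fix s t assume "(s, t) \<in> D"
          then show "K t - K s \<le> t - s" using nd(2)[of s t] \<open>a \<le> b\<close> by (auto simp: K_def)
        qed
        finally have "(\<Sum>(s, t)\<in>D'. cmod (of_real (F t) - of_real (F s))) < \<epsilon>" using d(2)[OF D'(1)] D by simp
        also have "(\<Sum>(s, t)\<in>D'. cmod (of_real (F t) - of_real (F s))) =
            (\<Sum>(s, t)\<in>D. cmod (of_real (F (K t)) - of_real (F (K s))))"
          by (subst D'(2)) auto
        also have "\<dots> = (\<Sum>(s, t)\<in>D. G t - G s)"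
        proof (rule sum.cong[OF refl], clarify)
          fix s t assume "(s, t) \<in> D"
          then have "G s \<le> G t" using nd(2) by (intro Gmono) (auto intro: less_imp_le)
          then show "cmod (of_real (F (K t)) - of_real (F (K s))) = G t - G s"
            by (simp add: G_def of_real_diff[symmetric] del: of_real_diff)
        qed
        finally show "(\<Sum>(s, t)\<in>D. G t - G s) \<le> \<epsilon>" by simp
      qed (use that in auto)
      then show ?thesis using emeasure_mono[OF U(2), of ?M] U(1) by (auto intro: order_trans)
    qed
    then have "emeasure ?M N = 0"
      by (metis ennreal_le_epsilon ennreal_zero_less_top add.left_neutral le_zero_eq)
    then show "N \<in> null_sets ?M" using Nb by auto
  qed
  from sigma_finite_measure.Radon_Nikodym[OF sigma_finite_lborel this] obtain r where r: "r \<in> borel_measurable lborel" "density lborel r = ?M"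
    by auto
  have M: "emeasure ?M {s..t} = ennreal (G t - G s)" if "s \<le> t" for s t
    using emeasure_interval_measure_Icc[OF that Gmono Gcont] .
  define g where "g = (\<lambda>x. enn2real (r x * indicator {a..b} x))"
  have gm [measurable]: "g \<in> borel_measurable borel" using r(1) unfolding g_def by simp
  have int: "(\<integral>\<^sup>+ x. r x * indicator {a..x'} x \<partial>lborel) = ennreal (F x' - F a)" if "x' \<in> {a..b}" for x'
    using M[of a x'] r that by (simp add: emeasure_density[symmetric] G_def K_def)
  have "AE x in lborel. r x * indicator {a..b} x \<noteq> \<infinity>"
    by (rule nn_integral_PInf_AE) (use int[of b] r(1) \<open>a \<le> b\<close> in auto)
  then have eq: "AE x in lborel. ennreal (g x) = r x * indicator {a..b} x"
    by eventually_elim (auto simp: g_def less_top)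
  have has: "((\<lambda>x. indicator {a..x'} x * g x) has_integral (F x' - F a)) UNIV" if "x' \<in> {a..b}" for x'
  proof (rule nn_integral_has_integral)
    show "(\<integral>\<^sup>+x. ennreal (indicator {a..x'} x * g x) \<partial>lborel) = ennreal (F x' - F a)"
      unfolding int[OF that, symmetric]
      by (rule nn_integral_cong_AE, use eq in eventually_elim)
        (use that in \<open>auto simp: indicator_def split: if_splits\<close>)
    show "0 \<le> F x' - F a" using mono[of a x'] that by auto
    show "(\<lambda>x. indicator {a..x'} x * g x) \<in> borel_measurable borel" by measurable
  qed (auto simp: g_def)
  have has': "(g has_integral (F x' - F a)) {a..x'}" if "x' \<in> {a..b}" for x'
    proof -
    have "(\<lambda>x. indicator {a..x'} x * g x) = (\<lambda>x. if x \<in> {a..x'} then g x else 0)"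
      by (auto simp: indicator_def)
    then show ?thesis using has[OF that] has_integral_restrict_UNIV[of "{a..x'}" g] by simp
  qed
  show ?thesis
  proof
    have "g integrable_on {a..b}" using has'[of b] \<open>a \<le> b\<close> by auto
    then show "g absolutely_integrable_on {a..b}"
      by (rule nonnegative_absolutely_integrable_1) (simp add: g_def)
    show "F x = F a + integral {a..x} g" if "x \<in> {a..b}" for x
      using has'[OF that] by (simp add: integral_unique)
  qed
qed

lemma abs_continuous_on_dominated:
  assumes g: "abs_continuous_on S g" and h: "abs_continuous_on S h" and "B \<ge> 0"
    and le: "\<And>s t. s \<in> S \<Longrightarrow> t \<in> S \<Longrightarrow> norm (f t - f s) \<le> B * (norm (g t - g s) + norm (h t - h s))"
  shows "abs_continuous_on S f"
  unfolding abs_continuous_on_nonoverlapping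
proof (intro allI impI)
  fix \<epsilon> :: real assume "\<epsilon> > 0"
  define e where "e = \<epsilon> / (2 * (B + 1))"
  have e: "e > 0" "2 * (B + 1) * e = \<epsilon>" using \<open>B \<ge> 0\<close> \<open>\<epsilon> > 0\<close> by (auto simp: e_def)
  obtain \<delta>1 where 1: "\<delta>1 > 0" "\<And>D. nonoverlapping S D \<Longrightarrow> (\<Sum>(s, t)\<in>D. t - s) < \<delta>1 \<Longrightarrow>
      (\<Sum>(s, t)\<in>D. norm (g t - g s)) < e"
    using g e unfolding abs_continuous_on_nonoverlapping by meson
  obtain \<delta>2 where 2: "\<delta>2 > 0" "\<And>D. nonoverlapping S D \<Longrightarrow> (\<Sum>(s, t)\<in>D. t - s) < \<delta>2 \<Longrightarrow>
      (\<Sum>(s, t)\<in>D. norm (h t - h s)) < e"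
    using h e unfolding abs_continuous_on_nonoverlapping by meson
  show "\<exists>\<delta>>0. \<forall>D. nonoverlapping S D \<longrightarrow> (\<Sum>(s, t)\<in>D. t - s) < \<delta> \<longrightarrow>
      (\<Sum>(s, t)\<in>D. norm (f t - f s)) < \<epsilon>"
  proof (intro exI[of _ "min \<delta>1 \<delta>2"] conjI allI impI)
    fix D assume D: "nonoverlapping S D" "(\<Sum>(s, t)\<in>D. t - s) < min \<delta>1 \<delta>2"
    have "(\<Sum>(s, t)\<in>D. norm (f t - f s)) \<le> (\<Sum>i\<in>D. B * (norm (g (snd i) - g (fst i)) + norm (h (snd i) - h (fst i))))"
    proof (rule sum_mono, clarify)
      fix s t assume "(s, t) \<in> D"
      then have "s \<in> S" "t \<in> S" using nonoverlappingD(2,3)[OF D(1), of s t] by auto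
      then show "cmod (f t - f s) \<le> B * (cmod (g (snd (s, t)) - g (fst (s, t))) + cmod (h (snd (s, t)) - h (fst (s, t))))"
        using le by simp
    qed
    also have "\<dots> = B * ((\<Sum>(s, t)\<in>D. norm (g t - g s)) + (\<Sum>(s, t)\<in>D. norm (h t - h s)))"
      by (simp add: sum_distrib_left sum.distrib case_prod_beta distrib_left)
    also have "\<dots> \<le> B * (e + e)"
      using 1(2)[OF D(1)] 2(2)[OF D(1)] D \<open>B \<ge> 0\<close> by (intro mult_left_mono) auto
    also have "\<dots> < \<epsilon>" using e by (simp add: algebra_simps)
    finally show "(\<Sum>(s, t)\<in>D. norm (f t - f s)) < \<epsilon>" .
  qed (use 1 2 in auto)
qed

lemma abs_continuous_on_diff:
  assumes "abs_continuous_on S f" "abs_continuous_on S g"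
  shows "abs_continuous_on S (\<lambda>x. f x - g x)"
proof (rule abs_continuous_on_dominated[OF assms, of 1])
  fix s t
  have "norm ((f t - f s) - (g t - g s)) \<le> norm (f t - f s) + norm (g t - g s)"
    by (rule norm_triangle_ineq4)
  then show "norm (f t - g t - (f s - g s)) \<le> 1 * (norm (f t - f s) + norm (g t - g s))"
    by (simp add: algebra_simps)
qed simp

lemma abs_continuous_on_mult:
  assumes "abs_continuous_on {a..b} f" "abs_continuous_on {a..b} g"
  shows "abs_continuous_on {a..b} (\<lambda>x. f x * g x)"
proof -
  have "bounded (f ` {a..b})" "bounded (g ` {a..b})"
    using assms by (auto intro!: compact_imp_bounded compact_continuous_image abs_continuous_imp_continuous_on)
  then obtain B1 B2 where B1: "\<forall>x\<in>{a..b}. norm (f x) \<le> B1" and B2: "\<forall>x\<in>{a..b}. norm (g x) \<le> B2"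
    unfolding bounded_iff by auto
  define B where "B = max 0 (max B1 B2)"
  have B: "norm (f x) \<le> B" "norm (g x) \<le> B" if "x \<in> {a..b}" for x
    using B1 B2 that by (auto simp: B_def le_max_iff_disj)
  show ?thesis
  proof (rule abs_continuous_on_dominated[OF assms, of B])
    fix s t assume st: "s \<in> {a..b}" "t \<in> {a..b}"
    have "f t * g t - f s * g s = (f t - f s) * g t + f s * (g t - g s)" by (simp add: algebra_simps)
    also have "norm \<dots> \<le> norm (f t - f s) * norm (g t) + norm (f s) * norm (g t - g s)"
      by (metis norm_mult norm_triangle_ineq)
    also have "\<dots> \<le> norm (f t - f s) * B + B * norm (g t - g s)"
      by (intro add_mono mult_left_mono mult_right_mono B st) auto
    finally show "norm (f t * g t - f s * g s) \<le> B * (norm (f t - f s) + norm (g t - g s))"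
      by (simp add: algebra_simps)
  qed (simp add: B_def)
qed

lemma nonoverlapping_integral_le:
  fixes \<phi> :: "real \<Rightarrow> real"
  assumes D: "nonoverlapping {a..b} D" and \<phi>: "\<phi> integrable_on {a..b}" "\<And>x. 0 \<le> \<phi> x"
  shows "(\<Sum>(s, t)\<in>D. integral {s..t} \<phi>) \<le> integral {a..b} \<phi>"
proof -
  note nd = nonoverlappingD[OF D]
  let ?p = "(\<lambda>(s, t). {s..t}) ` D"
  have inj: "inj_on (\<lambda>(s, t). {s..t}) D"
    using nd(2) by (fastforce simp: inj_on_def Icc_eq_Icc)
  have p: "?p division_of \<Union>?p"
    unfolding division_of_def
  proof (intro conjI ballI impI)
    fix K assume "K \<in> ?p"
    then obtain s t where st: "K = {s..t}" "(s, t) \<in> D" by auto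
    then show "K \<subseteq> \<Union>?p" "K \<noteq> {}" "\<exists>a b. K = cbox a b" using nd(2)[of s t] by (auto simp: box_real)
    fix K' assume "K' \<in> ?p" "K \<noteq> K'"
    then obtain s' t' where st': "K' = {s'..t'}" "(s', t') \<in> D" by auto
    have "False" if "x \<in> {s<..<t}" "x \<in> {s'<..<t'}" for x
      using nd(4)[OF st(2) st'(2), of x] that \<open>K \<noteq> K'\<close> st st' by auto
    then show "interior K \<inter> interior K' = {}"
      unfolding st(1) st'(1) interior_atLeastAtMost_real by blast
  qed (use nd(1) in auto)
  have sub: "\<Union>?p \<subseteq> {a..b}" using nd(3) by blast
  have int: "\<phi> integrable_on \<Union>?p"
    by (rule integrable_on_subdivision[OF p \<phi>(1) sub])
  have "(\<Sum>(s, t)\<in>D. integral {s..t} \<phi>) = (\<Sum>k\<in>?p. integral k \<phi>)"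
    by (subst sum.reindex[OF inj]) (auto intro!: sum.cong)
  also have "\<dots> = integral (\<Union>?p) \<phi>"
    using integral_combine_division_topdown[OF int p] by simp
  also have "\<dots> \<le> integral {a..b} \<phi>"
    using sub int \<phi> by (intro integral_subset_le) auto
  finally show ?thesis .
qed

lemma integral_initial_diff:
  fixes g :: "real \<Rightarrow> 'a::banach"
  assumes "g integrable_on {a..b}" "a \<le> s" "s \<le> t" "t \<le> b"
  shows "integral {a..t} g - integral {a..s} g = integral {s..t} g"
proof -
  have "g integrable_on {a..t}"
    using assms(1) by (rule integrable_subinterval_real) (use assms in auto)
  then have "integral {a..s} g + integral {s..t} g = integral {a..t} g"
    using assms by (intro Henstock_Kurzweil_Integration.integral_combine) auto
  then show ?thesis by (simp add: algebra_simps)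
qed

text \<open>
  Truncation: up to a part \<open>\<phi>\<close> of small integral, \<open>|g|\<close> is bounded by some \<open>n\<close>, and the bounded part
  contributes at most \<open>n\<close> times the total length of the intervals.
\<close>

lemma abs_continuous_on_indefinite_integral:
  fixes g :: "real \<Rightarrow> complex"
  assumes g: "g absolutely_integrable_on {a..b}"
    and f: "\<And>x. x \<in> {a..b} \<Longrightarrow> f x = c + integral {a..x} g"
  shows "abs_continuous_on {a..b} f"
  unfolding abs_continuous_on_nonoverlapping
proof (intro allI impI)
  fix \<epsilon> :: real assume \<epsilon>: "\<epsilon> > 0"
  have gi: "g integrable_on {a..b}" and gn: "(\<lambda>x. norm (g x)) integrable_on {a..b}"
    using g unfolding absolutely_integrable_on_def by auto
  have gna: "(\<lambda>x. norm (g x)) absolutely_integrable_on {a..b}"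
    using gn by (intro nonnegative_absolutely_integrable_1) auto
  have ca: "(\<lambda>x::real. c) absolutely_integrable_on {a..b}" for c :: real
    by (intro absolutely_integrable_continuous_real continuous_intros)
  have mi: "(\<lambda>x. min (norm (g x)) (real n)) integrable_on {a..b}" for n
    using absolutely_integrable_min_1[OF gna ca] set_lebesgue_integral_eq_integral(1) by blast
  have "(\<lambda>n. integral {a..b} (\<lambda>x. min (norm (g x)) (real n))) \<longlonglongrightarrow> integral {a..b} (\<lambda>x. norm (g x))"
  proof (rule dominated_convergence(2)[OF mi gn])
    fix x assume "x \<in> {a..b}"
    obtain N :: nat where N: "norm (g x) \<le> N" using real_arch_simple by blast
    have "eventually (\<lambda>n. min (norm (g x)) (real n) = norm (g x)) sequentially"
      using eventually_ge_at_top[of N] by eventually_elim (use N in auto)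
    then show "(\<lambda>n. min (norm (g x)) (real n)) \<longlonglongrightarrow> norm (g x)" by (rule tendsto_eventually)
  qed auto
  then obtain n where n: "\<bar>integral {a..b} (\<lambda>x. min (norm (g x)) (real n)) - integral {a..b} (\<lambda>x. norm (g x))\<bar> < \<epsilon>/2"
    using \<epsilon> unfolding lim_sequentially dist_real_def by (meson half_gt_zero le_refl)
  define \<phi> where "\<phi> = (\<lambda>x. norm (g x) - min (norm (g x)) (real n))"
  have \<phi>: "\<phi> integrable_on {a..b}" "\<And>x. 0 \<le> \<phi> x"
    unfolding \<phi>_def using gn mi[of n] by (auto intro!: integrable_diff)
  have \<phi>i: "integral {a..b} \<phi> < \<epsilon>/2"
    using n unfolding \<phi>_def integral_diff[OF gn mi] by linarith
  show "\<exists>\<delta>>0. \<forall>D. nonoverlapping {a..b} D \<longrightarrow> (\<Sum>(s, t)\<in>D. t - s) < \<delta> \<longrightarrow>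
      (\<Sum>(s, t)\<in>D. norm (f t - f s)) < \<epsilon>"
  proof (intro exI[of _ "\<epsilon> / (2 * (real n + 1))"] conjI allI impI)
    show "\<epsilon> / (2 * (real n + 1)) > 0" using \<epsilon> by simp
    fix D assume D: "nonoverlapping {a..b} D" "(\<Sum>(s, t)\<in>D. t - s) < \<epsilon> / (2 * (real n + 1))"
    note nd = nonoverlappingD[OF D(1)]
    have "(\<Sum>(s, t)\<in>D. norm (f t - f s)) \<le> (\<Sum>i\<in>D. integral {fst i..snd i} \<phi> + n * (snd i - fst i))"
    proof (rule sum_mono, clarify)
      fix s t assume st: "(s, t) \<in> D"
      then have ab: "a \<le> s" "s < t" "t \<le> b" using nd(2)[OF st] nd(3)[OF st] by auto
      have sub: "{s..t} \<subseteq> {a..b}" using nd(3)[OF st] .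
      have I: "h integrable_on {s..t}" if "h integrable_on {a..b}" for h :: "real \<Rightarrow> 'z::banach"
        using integrable_subinterval_real[OF that sub] .
      have "f t - f s = integral {s..t} g"
        using integral_initial_diff[OF gi, of s t] f[of s] f[of t] ab by simp
      also have "norm \<dots> \<le> integral {s..t} (\<lambda>x. norm (g x))"
        by (intro integral_norm_bound_integral I gi gn) auto
      also have "\<dots> \<le> integral {s..t} (\<lambda>x. \<phi> x + real n)"
        by (intro integral_le I gn integrable_add \<phi>(1) integrable_const_ivl) (auto simp: \<phi>_def)
      also have "\<dots> = integral {s..t} \<phi> + n * (t - s)"
        by (subst integral_add) (use I[OF \<phi>(1)] ab in \<open>auto simp: mult.commute\<close>)
      finally show "cmod (f t - f s) \<le> integral {fst (s, t)..snd (s, t)} \<phi> + n * (snd (s, t) - fst (s, t))"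
        by simp
    qed
    also have "\<dots> = (\<Sum>(s, t)\<in>D. integral {s..t} \<phi>) + n * (\<Sum>(s, t)\<in>D. t - s)"
      by (simp add: sum.distrib sum_distrib_left case_prod_beta)
    also have "\<dots> \<le> integral {a..b} \<phi> + n * (\<epsilon> / (2 * (real n + 1)))"
      using nonoverlapping_integral_le[OF D(1) \<phi>] D(2) by (intro add_mono mult_left_mono) auto
    also have "\<dots> < \<epsilon>/2 + \<epsilon>/2"
    proof (rule add_less_le_mono[OF \<phi>i])
      show "n * (\<epsilon> / (2 * (real n + 1))) \<le> \<epsilon>/2" using \<epsilon> by (simp add: field_simps)
    qed
    finally show "(\<Sum>(s, t)\<in>D. norm (f t - f s)) < \<epsilon>" by simp
  qed
qed

text \<open>
  With the variation \<open>V\<close> of \<open>f\<close>, the functions \<open>V\<close>, \<open>V + Re f\<close> and \<open>V + Im f\<close> are absolutely continuous and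
  nondecreasing, so they are integrals, and \<open>f\<close> is a linear combination of them.
\<close>

theorem abs_continuous_on_imp_indefinite_integral:
  assumes f: "abs_continuous_on {a..b} f" and "a \<le> b"
  obtains g where "g absolutely_integrable_on {a..b}" "\<And>x. x \<in> {a..b} \<Longrightarrow> f x = f a + integral {a..x} g"
proof -
  let ?V = "variation f a"
  have acs: "abs_continuous_on {a..x} f" if "x \<le> b" for x
    using f that by (auto elim!: abs_continuous_on_subset)
  have inc: "norm (f y - f x) \<le> ?V y - ?V x" if "a \<le> x" "x \<le> y" "y \<le> b" for x y
    using variation_ge_increment[OF acs] that by auto
  (* Used with r = Re, Im and 0. *)
  have part: "\<exists>g. g absolutely_integrable_on {a..b} \<and> (\<forall>x\<in>{a..b}. ?V x + r (f x) = ?V a + r (f a) + integral {a..x} g)"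
    if r: "\<And>z w. r z - r w = r (z - w)" "\<And>z. \<bar>r z\<bar> \<le> norm z" for r :: "complex \<Rightarrow> real"
  proof -
    have 1: "\<bar>r (f y) - r (f x)\<bar> \<le> ?V y - ?V x" if "a \<le> x" "x \<le> y" "y \<le> b" for x y
      using inc[OF that] r(2)[of "f y - f x"] by (simp add: r(1))
    have "abs_continuous_on {a..b} (\<lambda>x. complex_of_real (?V x + r (f x)))"
    proof (rule abs_continuous_on_dominated[OF abs_continuous_on_variation[OF f] f, of 1])
      fix s t
      have "\<bar>(?V t - ?V s) + r (f t - f s)\<bar> \<le> \<bar>?V t - ?V s\<bar> + norm (f t - f s)"
        using r(2)[of "f t - f s"] by linarith
      then show "cmod (complex_of_real (?V t + r (f t)) - complex_of_real (?V s + r (f s)))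
           \<le> 1 * (cmod (complex_of_real (?V t) - complex_of_real (?V s)) + cmod (f t - f s))"
        by (simp add: r(1)[symmetric] of_real_diff[symmetric] algebra_simps del: of_real_diff of_real_add)
    qed simp
    note ac = this
    have mono: "?V x + r (f x) \<le> ?V y + r (f y)" if "a \<le> x" "x \<le> y" "y \<le> b" for x y
      using 1[OF that] by linarith
    show ?thesis
    proof (rule monotone_abs_continuous_density[where F = "\<lambda>x. ?V x + r (f x)", OF mono \<open>a \<le> b\<close> ac])
      fix g assume "g absolutely_integrable_on {a..b}"
        "\<And>x. x \<in> {a..b} \<Longrightarrow> ?V x + r (f x) = ?V a + r (f a) + integral {a..x} g"
      then show ?thesis by blast
    qed
  qed
  obtain gr where gr: "gr absolutely_integrable_on {a..b}"
    "\<And>x. x \<in> {a..b} \<Longrightarrow> ?V x + Re (f x) = ?V a + Re (f a) + integral {a..x} gr"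
    using part[of Re, OF minus_complex.sel(1)[symmetric] abs_Re_le_cmod] by blast
  obtain gi where gi: "gi absolutely_integrable_on {a..b}"
    "\<And>x. x \<in> {a..b} \<Longrightarrow> ?V x + Im (f x) = ?V a + Im (f a) + integral {a..x} gi"
    using part[of Im, OF minus_complex.sel(2)[symmetric] abs_Im_le_cmod] by blast
  obtain g0 where g0: "g0 absolutely_integrable_on {a..b}"
    "\<And>x. x \<in> {a..b} \<Longrightarrow> ?V x = ?V a + integral {a..x} g0"
  proof -
    have "\<exists>g. g absolutely_integrable_on {a..b} \<and> (\<forall>x\<in>{a..b}. ?V x + 0 = ?V a + 0 + integral {a..x} g)"
      by (rule part) simp_all
    then show ?thesis using that unfolding add_0_right by blast
  qed
  define g where "g = (\<lambda>x. complex_of_real (gr x - g0 x) + \<i> * complex_of_real (gi x - g0 x))"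
  have lin: "bounded_linear (\<lambda>x. \<i> * complex_of_real x)"
    by (intro bounded_linear_mult_right[THEN bounded_linear_compose] bounded_linear_of_real)
  have d: "(\<lambda>x. gr x - g0 x) absolutely_integrable_on {a..b}" "(\<lambda>x. gi x - g0 x) absolutely_integrable_on {a..b}"
    using gr(1) gi(1) g0(1) by (auto intro!: set_integral_diff)
  have "g absolutely_integrable_on {a..b}"
    unfolding g_def
    using absolutely_integrable_linear[OF d(1) bounded_linear_of_real] absolutely_integrable_linear[OF d(2) lin]
    by (intro set_integral_add) (auto simp: o_def)
  moreover have "f x = f a + integral {a..x} g" if x: "x \<in> {a..b}" for x
  proof -
    have I: "(h has_integral integral {a..x} h) {a..x}" if "h absolutely_integrable_on {a..b}" for h :: "real \<Rightarrow> real"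
    proof -
      have "h integrable_on {a..b}" using that by (rule set_lebesgue_integral_eq_integral(1))
      then have "h integrable_on {a..x}" by (rule integrable_subinterval_real) (use x in auto)
      then show ?thesis by (rule integrable_integral)
    qed
    note h1 = has_integral_diff[OF I[OF gr(1)] I[OF g0(1)]]
    note h2 = has_integral_diff[OF I[OF gi(1)] I[OF g0(1)]]
    have "(g has_integral (complex_of_real (integral {a..x} gr - integral {a..x} g0) +
        \<i> * complex_of_real (integral {a..x} gi - integral {a..x} g0))) {a..x}"
      unfolding g_def
      using has_integral_linear[OF h1 bounded_linear_of_real] has_integral_linear[OF h2 lin]
      by (intro has_integral_add) (auto simp: o_def)
    then have "integral {a..x} g = complex_of_real (integral {a..x} gr - integral {a..x} g0) +
        \<i> * complex_of_real (integral {a..x} gi - integral {a..x} g0)" by (rule integral_unique)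
    also have "integral {a..x} gr - integral {a..x} g0 = Re (f x) - Re (f a)"
      using gr(2)[OF x] g0(2)[OF x] by linarith
    also have "integral {a..x} gi - integral {a..x} g0 = Im (f x) - Im (f a)"
      using gi(2)[OF x] g0(2)[OF x] by linarith
    also have "complex_of_real (Re (f x) - Re (f a)) + \<i> * complex_of_real (Im (f x) - Im (f a)) = f x - f a"
      by (simp add: complex_eq_iff)
    finally show ?thesis by simp
  qed
  ultimately show ?thesis using that by blast
qed

section \<open>Differentiation of indefinite integrals\<close>

lemma Lebesgue_differentiation_right:
  fixes g :: "real \<Rightarrow> complex"
  assumes g: "g absolutely_integrable_on {a..b}"
  obtains N where "negligible N"
    "\<And>x e. x \<in> {a<..<b} - N \<Longrightarrow> e > 0 \<Longrightarrow>
       \<exists>d>0. \<forall>y. x < y \<and> y < x + d \<longrightarrow> norm (integral {x..y} g - (y - x) *\<^sub>R g x) \<le> e * (y - x)"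
proof -
  (* The differentiation theorem integrable_ccontinuous_explicit is about functions that are
     integrable on all intervals. *)
  define G where "G = (\<lambda>x. if x \<in> {a..b} then g x else 0)"
  have "G absolutely_integrable_on UNIV"
    unfolding G_def using g absolutely_integrable_restrict_UNIV by blast
  then have "G integrable_on UNIV" by (rule set_lebesgue_integral_eq_integral(1))
  then have "\<And>u v. G integrable_on cbox u v" by (rule integrable_on_subcbox) auto
  then obtain N where N: "negligible N" "\<And>x e. x \<notin> N \<Longrightarrow> 0 < e \<Longrightarrow> \<exists>d>0. \<forall>h. 0 < h \<and> h < d \<longrightarrow>
      norm (integral (cbox x (x + h *\<^sub>R One)) G /\<^sub>R h ^ DIM(real) - G x) < e"
    using integrable_ccontinuous_explicit by metis
  show ?thesis
  proof (rule that[OF N(1)])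
    fix x e :: real assume x: "x \<in> {a<..<b} - N" and "e > 0"
    then obtain d where d: "d > 0" "\<And>h. 0 < h \<and> h < d \<Longrightarrow>
        norm (integral (cbox x (x + h *\<^sub>R One)) G /\<^sub>R h ^ DIM(real) - G x) < e" using N(2)[of x e] by auto
    show "\<exists>d>0. \<forall>y. x < y \<and> y < x + d \<longrightarrow> norm (integral {x..y} g - (y - x) *\<^sub>R g x) \<le> e * (y - x)"
    proof (intro exI[of _ "min d (b - x)"] conjI allI impI)
      show "min d (b - x) > 0" using d x by auto
      fix y assume y: "x < y \<and> y < x + min d (b - x)"
      have 1: "norm (integral {x..y} G /\<^sub>R (y - x) - G x) < e"
      proof -
        have "0 < y - x \<and> y - x < d" using y by linarith
        from d(2)[OF this] show ?thesis by simp
      qed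
      have "integral {x..y} G = integral {x..y} g"
        using x y by (intro integral_cong) (auto simp: G_def)
      moreover have "G x = g x" using x by (auto simp: G_def)
      moreover have "integral {x..y} g - (y - x) *\<^sub>R g x = (y - x) *\<^sub>R (integral {x..y} g /\<^sub>R (y - x) - g x)"
        using y by (simp add: scaleR_diff_right)
      ultimately have "norm (integral {x..y} g - (y - x) *\<^sub>R g x) = (y - x) * norm (integral {x..y} G /\<^sub>R (y - x) - G x)"
        using y by simp
      also have "\<dots> \<le> (y - x) * e" using 1 y by (intro mult_left_mono) auto
      finally show "norm (integral {x..y} g - (y - x) *\<^sub>R g x) \<le> e * (y - x)" by (simp add: mult.commute)
    qed
  qed
qed

text \<open>
  The derivative from the left is the derivative from the right of the reflected function.
\<close>

theorem indefinite_integral_has_vector_derivative_AE: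
  fixes g :: "real \<Rightarrow> complex"
  assumes g: "g absolutely_integrable_on {a..b}"
    and f: "\<And>x. x \<in> {a..b} \<Longrightarrow> f x = c + integral {a..x} g"
  obtains N where "negligible N" "\<And>x. x \<in> {a<..<b} - N \<Longrightarrow> (f has_vector_derivative g x) (at x)"
proof -
  obtain N1 where N1: "negligible N1"
    "\<And>x e. x \<in> {a<..<b} - N1 \<Longrightarrow> e > 0 \<Longrightarrow>
       \<exists>d>0. \<forall>y. x < y \<and> y < x + d \<longrightarrow> norm (integral {x..y} g - (y - x) *\<^sub>R g x) \<le> e * (y - x)"
    using Lebesgue_differentiation_right[OF g] by metis
  have "(\<lambda>x. g (- x)) absolutely_integrable_on {- b..- a}"
    using g absolutely_integrable_reflect_real by blast
  then obtain N2 where N2: "negligible N2"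
    "\<And>x e. x \<in> {-b<..<-a} - N2 \<Longrightarrow> e > 0 \<Longrightarrow>
       \<exists>d>0. \<forall>y. x < y \<and> y < x + d \<longrightarrow> norm (integral {x..y} (\<lambda>x. g (- x)) - (y - x) *\<^sub>R g (- x)) \<le> e * (y - x)"
    using Lebesgue_differentiation_right by metis
  have gi: "g integrable_on {a..b}" using g by (rule set_lebesgue_integral_eq_integral(1))
  have diff: "f y - f x = integral {x..y} g" if "a \<le> x" "x \<le> y" "y \<le> b" for x y
    using integral_initial_diff[OF gi that] f[of x] f[of y] that by simp
  show ?thesis
  proof
    show "negligible (N1 \<union> uminus ` N2)"
      using N1(1) N2(1)
      by (intro negligible_Un negligible_differentiable_image_negligible) (auto intro: derivative_intros)
    fix x assume x: "x \<in> {a<..<b} - (N1 \<union> uminus ` N2)"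
    then have x2: "- x \<in> {-b<..<-a} - N2" by force
    show "(f has_vector_derivative g x) (at x)"
      unfolding has_vector_derivative_def has_derivative_at_alt
    proof (intro conjI allI impI bounded_linear_scaleR_left)
      fix e :: real assume "e > 0"
      obtain d1 where d1: "d1 > 0" "\<And>y. x < y \<and> y < x + d1 \<Longrightarrow> norm (integral {x..y} g - (y - x) *\<^sub>R g x) \<le> e * (y - x)"
        using N1(2)[of x e] x \<open>e > 0\<close> by auto
      obtain d2 where d2: "d2 > 0" "\<And>y. -x < y \<and> y < -x + d2 \<Longrightarrow>
          norm (integral {-x..y} (\<lambda>x. g (- x)) - (y - (- x)) *\<^sub>R g (- (- x))) \<le> e * (y - (- x))"
        using N2(2)[OF x2 \<open>e > 0\<close>] by auto
      show "\<exists>d>0. \<forall>y. norm (y - x) < d \<longrightarrow> norm (f y - f x - (y - x) *\<^sub>R g x) \<le> e * norm (y - x)"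
      proof (intro exI[of _ "min (min d1 d2) (min (b - x) (x - a))"] conjI allI impI)
        show "min (min d1 d2) (min (b - x) (x - a)) > 0" using d1 d2 x by auto
        fix y assume y: "norm (y - x) < min (min d1 d2) (min (b - x) (x - a))"
        consider "y = x" | "x < y" | "y < x" by linarith
        then show "norm (f y - f x - (y - x) *\<^sub>R g x) \<le> e * norm (y - x)"
        proof cases
          case 2
          then show ?thesis using d1(2)[of y] diff[of x y] x y by auto
        next
          case 3
          have "integral {-x..-y} (\<lambda>x. g (- x)) = integral {y..x} g"
            using integral_reflect_real[of x y g] by simp
          then have "norm (f x - f y - (x - y) *\<^sub>R g x) \<le> e * (x - y)"
            using d2(2)[of "-y"] diff[of y x] x y 3 by auto
          moreover have "f y - f x - (y - x) *\<^sub>R g x = - (f x - f y - (x - y) *\<^sub>R g x)"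
            by (simp add: algebra_simps)
          ultimately show ?thesis using 3 by (metis abs_minus_commute abs_of_pos diff_gt_0_iff_gt norm_minus_cancel real_norm_def)
        qed simp
      qed
    qed
  qed
qed

section \<open>The Sobolev space \<open>W\<^sup>2\<^sup>,\<^sup>1\<close> and Lagrange's identity\<close>

text \<open>
  \<open>W21 a b u u1 u2\<close> says that \<open>u\<close> lies in the Sobolev space \<open>W\<^sup>2\<^sup>,\<^sup>1(a, b)\<close>, that \<open>u\<close> and \<open>u1\<close> are the
  representatives of \<open>u\<close> and \<open>u'\<close> that are continuous up to the end points, and that \<open>u2\<close> is
  a representative of \<open>u''\<close>.
\<close>

definition W21 :: "real \<Rightarrow> real \<Rightarrow> (real \<Rightarrow> complex) \<Rightarrow> (real \<Rightarrow> complex) \<Rightarrow> (real \<Rightarrow> complex) \<Rightarrow> bool" where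
  "W21 a b u u1 u2 \<longleftrightarrow> u2 absolutely_integrable_on {a..b} \<and>
     (\<forall>x\<in>{a..b}. u1 x = u1 a + integral {a..x} u2 \<and> u x = u a + integral {a..x} u1)"

lemma W21D:
  assumes "W21 a b u u1 u2"
  shows "u2 absolutely_integrable_on {a..b}"
    "\<And>x. x \<in> {a..b} \<Longrightarrow> u1 x = u1 a + integral {a..x} u2"
    "\<And>x. x \<in> {a..b} \<Longrightarrow> u x = u a + integral {a..x} u1"
  using assms unfolding W21_def by blast+

lemma W21_absolutely_continuous:
  assumes "W21 a b u u1 u2"
  shows "abs_continuous_on {a..b} u1" "abs_continuous_on {a..b} u"
    "continuous_on {a..b} u1" "continuous_on {a..b} u"
proof -
  show ac1: "abs_continuous_on {a..b} u1"
    by (rule abs_continuous_on_indefinite_integral[OF W21D(1,2)[OF assms]])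
  then show c1: "continuous_on {a..b} u1" by (rule abs_continuous_imp_continuous_on)
  then have "u1 absolutely_integrable_on {a..b}" by (rule absolutely_integrable_continuous_real)
  then show ac: "abs_continuous_on {a..b} u"
    by (rule abs_continuous_on_indefinite_integral[OF _ W21D(3)[OF assms]])
  then show "continuous_on {a..b} u" by (rule abs_continuous_imp_continuous_on)
qed

lemma W21_has_derivative:
  assumes "W21 a b u u1 u2" "x \<in> {a<..<b}"
  shows "(u has_vector_derivative u1 x) (at x)"
proof -
  have "((\<lambda>x. u a + integral {a..x} u1) has_vector_derivative 0 + u1 x) (at x within {a..b})"
    using assms W21_absolutely_continuous[OF assms(1)]
    by (intro has_vector_derivative_add has_vector_derivative_const integral_has_vector_derivative) auto
  then have "((\<lambda>x. u a + integral {a..x} u1) has_vector_derivative 0 + u1 x) (at x within {a<..<b})"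
    by (rule has_vector_derivative_within_subset) auto
  then have "((\<lambda>x. u a + integral {a..x} u1) has_vector_derivative u1 x) (at x within {a<..<b})"
    by (simp only: add_0)
  then have "(u has_vector_derivative u1 x) (at x within {a<..<b})"
  proof (rule has_vector_derivative_transform[rotated 2])
    show "u y = u a + integral {a..y} u1" if "y \<in> {a<..<b}" for y
      by (rule W21D(3)[OF assms(1)]) (use that in auto)
  qed (rule assms(2))
  then show ?thesis using at_within_open[OF assms(2)] by simp
qed

lemma W21_has_second_derivative_AE:
  assumes "W21 a b u u1 u2"
  obtains N where "negligible N" "\<And>x. x \<in> {a<..<b} - N \<Longrightarrow> (u1 has_vector_derivative u2 x) (at x)"
  using indefinite_integral_has_vector_derivative_AE[OF W21D(1,2)[OF assms]] by blast

text \<open>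
  The Wronskian \<open>u' v - u v'\<close> is absolutely continuous, hence the integral of its derivative, which
  is \<open>u'' v - u v''\<close> almost everywhere.
\<close>

lemma Lagrange_identity:
  assumes u: "W21 a b u u1 u2" and v: "W21 a b v v1 v2" and "a \<le> b"
  shows "((\<lambda>x. u2 x * v x - u x * v2 x) has_integral
    (u1 b * v b - u b * v1 b) - (u1 a * v a - u a * v1 a)) {a..b}"
proof -
  define w where "w = (\<lambda>x. u1 x * v x - u x * v1 x)"
  have "abs_continuous_on {a..b} w"
    unfolding w_def by (intro abs_continuous_on_diff abs_continuous_on_mult W21_absolutely_continuous[OF u] W21_absolutely_continuous[OF v])
  then obtain g where g: "g absolutely_integrable_on {a..b}" "\<And>x. x \<in> {a..b} \<Longrightarrow> w x = w a + integral {a..x} g"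
    using abs_continuous_on_imp_indefinite_integral \<open>a \<le> b\<close> by blast
  obtain N where N: "negligible N" "\<And>x. x \<in> {a<..<b} - N \<Longrightarrow> (w has_vector_derivative g x) (at x)"
    using indefinite_integral_has_vector_derivative_AE[OF g] by metis
  obtain Nu where Nu: "negligible Nu" "\<And>x. x \<in> {a<..<b} - Nu \<Longrightarrow> (u1 has_vector_derivative u2 x) (at x)"
    using W21_has_second_derivative_AE[OF u] by metis
  obtain Nv where Nv: "negligible Nv" "\<And>x. x \<in> {a<..<b} - Nv \<Longrightarrow> (v1 has_vector_derivative v2 x) (at x)"
    using W21_has_second_derivative_AE[OF v] by metis
  have eq: "g x = u2 x * v x - u x * v2 x" if x: "x \<in> {a<..<b} - (N \<union> Nu \<union> Nv)" for x
  proof (rule vector_derivative_unique_at)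
    show "(w has_vector_derivative g x) (at x)" using N x by auto
    have "(w has_vector_derivative (u1 x * v1 x + u2 x * v x) - (u x * v2 x + u1 x * v1 x)) (at x)"
      unfolding w_def using Nu(2)[of x] Nv(2)[of x] W21_has_derivative[OF u, of x] W21_has_derivative[OF v, of x] x
      by (intro has_vector_derivative_diff has_vector_derivative_mult) auto
    then show "(w has_vector_derivative u2 x * v x - u x * v2 x) (at x)" by (simp add: algebra_simps)
  qed
  have "g integrable_on {a..b}" using g(1) by (rule set_lebesgue_integral_eq_integral(1))
  then have "(g has_integral integral {a..b} g) {a..b}" by (rule integrable_integral)
  then have "(g has_integral w b - w a) {a..b}" using g(2)[of b] \<open>a \<le> b\<close> by (simp add: algebra_simps)
  then have "((\<lambda>x. u2 x * v x - u x * v2 x) has_integral w b - w a) {a..b}"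
  proof (rule has_integral_spike[rotated 2])
    show "negligible (N \<union> Nu \<union> Nv \<union> {a, b})" using N Nu Nv by (auto intro!: negligible_Un)
    show "u2 x * v x - u x * v2 x = g x" if "x \<in> {a..b} - (N \<union> Nu \<union> Nv \<union> {a, b})" for x
      using eq[of x] that by auto
  qed
  then show ?thesis by (simp add: w_def)
qed

section \<open>Initial value problems with integrable coefficients\<close>

lemma absolutely_integrable_mult_bounded:
  fixes r f :: "real \<Rightarrow> complex"
  assumes "r absolutely_integrable_on {a..b}" "f \<in> borel_measurable (lebesgue_on {a..b})" "bounded (f ` {a..b})"
  shows "(\<lambda>x. r x * f x) absolutely_integrable_on {a..b}"
proof -
  have "bilinear ((*) :: complex \<Rightarrow> complex \<Rightarrow> complex)"
    by (simp add: bilinear_conv_bounded_bilinear bounded_bilinear_mult)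
  then have "(\<lambda>x. f x * r x) absolutely_integrable_on {a..b}"
    using absolutely_integrable_bounded_measurable_product[of "(*)" f "{a..b}" r] assms by auto
  then show ?thesis by (simp add: mult.commute)
qed

lemma absolutely_integrable_mult_continuous:
  fixes r f :: "real \<Rightarrow> complex"
  assumes "r absolutely_integrable_on {a..b}" "continuous_on {a..b} f"
  shows "(\<lambda>x. r x * f x) absolutely_integrable_on {a..b}"
proof (rule absolutely_integrable_mult_bounded[OF assms(1)])
  show "f \<in> borel_measurable (lebesgue_on {a..b})"
    using assms(2) by (rule continuous_imp_measurable_on_sets_lebesgue) simp
  show "bounded (f ` {a..b})"
    using assms(2) by (intro compact_imp_bounded compact_continuous_image) auto
qed

text \<open>
  Picard iteration for \<open>u'' = r u + g\<close>, written as the fixed point equation \<open>u = \<Psi> u\<close> for the twice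
  integrated equation. One integration costs the factor \<open>M = \<integral>|r|\<close>, which need not be small, but the
  second one gains a factor \<open>1 / L\<close> in the norm \<open>sup |u x| exp (- L (x - a))\<close>; for \<open>L > M\<close> the map \<open>\<Psi>\<close>
  is a contraction on all of \<open>[a, b]\<close> at once.
\<close>

lemma Caratheodory_second_order:
  fixes r g :: "real \<Rightarrow> complex"
  assumes r: "r absolutely_integrable_on {a..b}" and g: "g absolutely_integrable_on {a..b}" and "a \<le> b"
  obtains u u1 where "W21 a b u u1 (\<lambda>x. r x * u x + g x)" "u a = y0" "u1 a = y1"
proof -
  define K where "K = (\<lambda>x. max a (min b x))"
  have K: "K x \<in> {a..b}" "x \<in> {a..b} \<Longrightarrow> K x = x" for x using \<open>a \<le> b\<close> by (auto simp: K_def)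
  have Kc: "continuous_on UNIV K" unfolding K_def by (intro continuous_intros)
  define M where "M = integral {a..b} (\<lambda>x. norm (r x))"
  have ri: "(\<lambda>x. norm (r x)) integrable_on {a..b}" using r unfolding absolutely_integrable_on_def by blast
  have M: "0 \<le> M" unfolding M_def by (intro integral_nonneg ri) auto
  define L where "L = M + 1"
  have L: "L > 0" using M by (simp add: L_def)
  define \<Phi> where "\<Phi> = (\<lambda>h s. y1 + integral {a..s} (\<lambda>t. r t * h t + g t))"
  define \<Psi> where "\<Psi> = (\<lambda>h x. y0 + integral {a..x} (\<Phi> h))"
  have int: "(\<lambda>t. r t * h t + g t) absolutely_integrable_on {a..b}" if "continuous_on {a..b} h" for h
    using absolutely_integrable_mult_continuous[OF r that] g by (rule set_integral_add(1))
  have \<Phi>c: "continuous_on {a..b} (\<Phi> h)" if "continuous_on {a..b} h" for h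
    unfolding \<Phi>_def
    by (intro continuous_intros indefinite_integral_continuous_1 set_lebesgue_integral_eq_integral(1) int that)
  have \<Psi>c: "continuous_on {a..b} (\<Psi> h)" if "continuous_on {a..b} h" for h
    unfolding \<Psi>_def
    by (intro continuous_intros indefinite_integral_continuous_1 integrable_continuous_real \<Phi>c that)
  have est: "norm (\<Psi> h x - \<Psi> h' x) \<le> M / L * D * exp (L * (x - a))"
    if h: "continuous_on {a..b} h" "continuous_on {a..b} h'" and x: "x \<in> {a..b}" and "D \<ge> 0"
      and D: "\<And>t. t \<in> {a..b} \<Longrightarrow> norm (h t - h' t) \<le> D * exp (L * (t - a))" for h h' x D
  proof -
    have 1: "norm (\<Phi> h s - \<Phi> h' s) \<le> M * (D * exp (L * (s - a)))" if s: "s \<in> {a..b}" for s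
    proof -
      have sub: "{a..s} \<subseteq> {a..b}" using s by auto
      have I: "(\<lambda>t. r t * k t + g t) integrable_on {a..s}" if "continuous_on {a..b} k" for k
        using set_lebesgue_integral_eq_integral(1)[OF int[OF that]] sub by (rule integrable_subinterval_real)
      have rs: "(\<lambda>x. norm (r x)) integrable_on {a..s}" using ri sub by (rule integrable_subinterval_real)
      have "\<Phi> h s - \<Phi> h' s = integral {a..s} (\<lambda>t. (r t * h t + g t) - (r t * h' t + g t))"
        unfolding \<Phi>_def by (subst integral_diff[OF I I]) (use h in auto)
      also have "norm \<dots> \<le> integral {a..s} (\<lambda>t. norm (r t) * (D * exp (L * (s - a))))"
      proof (rule integral_norm_bound_integral)
        show "(\<lambda>t. norm (r t) * (D * exp (L * (s - a)))) integrable_on {a..s}"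
          using rs by (rule integrable_on_mult_left)
        fix t assume t: "t \<in> {a..s}"
        have "norm (r t * h t + g t - (r t * h' t + g t)) = norm (r t) * norm (h t - h' t)"
          by (simp add: norm_mult[symmetric] algebra_simps)
        also have "\<dots> \<le> norm (r t) * (D * exp (L * (t - a)))"
          using t s by (intro mult_left_mono D) auto
        also have "\<dots> \<le> norm (r t) * (D * exp (L * (s - a)))"
          using t L \<open>D \<ge> 0\<close> by (intro mult_left_mono) auto
        finally show "norm (r t * h t + g t - (r t * h' t + g t)) \<le> norm (r t) * (D * exp (L * (s - a)))" .
      qed (intro integrable_diff I h)
      also have "\<dots> = integral {a..s} (\<lambda>t. norm (r t)) * (D * exp (L * (s - a)))"
        by (rule integral_mult_left)
      also have "\<dots> \<le> M * (D * exp (L * (s - a)))"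
        unfolding M_def using \<open>D \<ge> 0\<close> by (intro mult_right_mono integral_subset_le sub rs ri) auto
      finally show ?thesis .
    qed
    have sub: "{a..x} \<subseteq> {a..b}" using x by auto
    have I: "\<Phi> k integrable_on {a..x}" if "continuous_on {a..b} k" for k
      using integrable_continuous_real[OF \<Phi>c[OF that]] sub by (rule integrable_subinterval_real)
    have E: "((\<lambda>s. M * (D * exp (L * (s - a)))) has_integral
        M * (D * exp (L * (x - a)) / L) - M * (D * exp (L * (a - a)) / L)) {a..x}"
      using x L by (intro fundamental_theorem_of_calculus)
        (auto intro!: derivative_eq_intros simp flip: has_real_derivative_iff_has_vector_derivative)
    have "\<Psi> h x - \<Psi> h' x = integral {a..x} (\<lambda>s. \<Phi> h s - \<Phi> h' s)"
      unfolding \<Psi>_def by (subst integral_diff[OF I I]) (use h in auto)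
    also have "norm \<dots> \<le> integral {a..x} (\<lambda>s. M * (D * exp (L * (s - a))))"
      using x by (intro integral_norm_bound_integral integrable_diff I h 1) (use E in auto)
    also have "\<dots> \<le> M * (D * exp (L * (x - a)) / L)"
      using integral_unique[OF E] M L \<open>D \<ge> 0\<close> by simp
    finally show ?thesis by simp
  qed
  (* Bounded continuous functions on the line carry the unweighted norm, so the weight is moved into
     the map: w corresponds to the function \<E> w, and values outside [a, b] are those at K. *)
  define \<E> where "\<E> = (\<lambda>(w :: real \<Rightarrow>\<^sub>C complex) t. exp (L * (t - a)) *\<^sub>R apply_bcontfun w t)"
  have \<E>c: "continuous_on {a..b} (\<E> w)" for w unfolding \<E>_def by (intro continuous_intros) auto
  define S where "S = (\<lambda>w. Bcontfun (\<lambda>x. exp (- L * (K x - a)) *\<^sub>R \<Psi> (\<E> w) (K x)))"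
  have S: "apply_bcontfun (S w) x = exp (- L * (K x - a)) *\<^sub>R \<Psi> (\<E> w) (K x)" for w x
  proof -
    let ?h = "\<lambda>x. exp (- L * (x - a)) *\<^sub>R \<Psi> (\<E> w) x"
    have c: "continuous_on {a..b} ?h" by (intro continuous_intros \<Psi>c \<E>c)
    then have "bounded (?h ` {a..b})" by (intro compact_imp_bounded compact_continuous_image) auto
    then obtain B where B: "\<And>x. x \<in> {a..b} \<Longrightarrow> norm (?h x) \<le> B" unfolding bounded_iff by blast
    have "(\<lambda>x. ?h (K x)) \<in> bcontfun"
    proof (rule bcontfun_normI)
      show "continuous_on UNIV (\<lambda>x. ?h (K x))" by (rule continuous_on_compose2[OF c Kc]) (use K in auto)
    qed (rule B[OF K(1)])
    then show ?thesis unfolding S_def by (simp add: Bcontfun_inverse)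
  qed
  have "\<forall>w z. dist (S w) (S z) \<le> M / L * dist w z"
  proof (intro allI dist_bound)
    fix w z x
    have "norm (\<Psi> (\<E> w) (K x) - \<Psi> (\<E> z) (K x)) \<le> M / L * dist w z * exp (L * (K x - a))"
    proof (rule est[OF \<E>c \<E>c K(1) zero_le_dist])
      fix t
      have "norm (\<E> w t - \<E> z t) = exp (L * (t - a)) * dist (apply_bcontfun w t) (apply_bcontfun z t)"
        by (simp add: \<E>_def dist_norm scaleR_diff_right[symmetric])
      also have "\<dots> \<le> exp (L * (t - a)) * dist w z"
        by (intro mult_left_mono dist_bounded) auto
      finally show "norm (\<E> w t - \<E> z t) \<le> dist w z * exp (L * (t - a))" by (simp add: mult.commute)
    qed
    then have "exp (- L * (K x - a)) * norm (\<Psi> (\<E> w) (K x) - \<Psi> (\<E> z) (K x)) \<le>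
        exp (- L * (K x - a)) * (M / L * dist w z * exp (L * (K x - a)))"
      by (intro mult_left_mono) auto
    also have "\<dots> = M / L * dist w z * (exp (- L * (K x - a)) * exp (L * (K x - a)))" by (simp only: ac_simps)
    also have "exp (- L * (K x - a)) * exp (L * (K x - a)) = 1" by (simp add: exp_add[symmetric])
    finally show "dist (apply_bcontfun (S w) x) (apply_bcontfun (S z) x) \<le> M / L * dist w z"
      by (simp add: S dist_norm scaleR_diff_right[symmetric])
  qed
  then obtain w where w: "S w = w"
    using banach_fix_type[of "M / L" S] M L by (auto simp: L_def)
  define u where "u = \<E> w"
  have u: "u x = \<Psi> u x" if x: "x \<in> {a..b}" for x
  proof -
    have "apply_bcontfun w x = exp (- L * (x - a)) *\<^sub>R \<Psi> u x"
      using S[of w x] w K(2)[OF x] by (simp add: u_def)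
    then have "u x = (exp (L * (x - a)) * exp (- L * (x - a))) *\<^sub>R \<Psi> u x"
      unfolding u_def[THEN fun_cong] \<E>_def by (simp add: u_def)
    then show ?thesis by (simp add: exp_add[symmetric])
  qed
  have uc: "continuous_on {a..b} u" unfolding u_def by (rule \<E>c)
  have ua: "u a = y0" using u[of a] \<open>a \<le> b\<close> by (simp add: \<Psi>_def)
  have \<Phi>a: "\<Phi> u a = y1" by (simp add: \<Phi>_def)
  have "W21 a b u (\<Phi> u) (\<lambda>x. r x * u x + g x)"
    unfolding W21_def
  proof (intro conjI ballI)
      show "(\<lambda>x. r x * u x + g x) absolutely_integrable_on {a..b}" by (rule int[OF uc])
      fix x assume x: "x \<in> {a..b}"
      show "\<Phi> u x = \<Phi> u a + integral {a..x} (\<lambda>x. r x * u x + g x)" unfolding \<Phi>a by (simp only: \<Phi>_def)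
      show "u x = u a + integral {a..x} (\<Phi> u)" using u[OF x] unfolding ua by (simp only: \<Psi>_def)
  qed
  from this ua \<Phi>a show ?thesis by (rule that)
qed

section \<open>Regularity up to the end points\<close>

lemma W21_cong:
  assumes "W21 a b u u1 u2" "negligible N" "\<And>x. x \<in> {a..b} - N \<Longrightarrow> v2 x = u2 x"
  shows "W21 a b u u1 v2"
  unfolding W21_def
proof (intro conjI ballI)
  show "v2 absolutely_integrable_on {a..b}"
    by (rule absolutely_integrable_spike[OF W21D(1)[OF assms(1)] assms(2)]) (use assms(3) in auto)
  fix x assume x: "x \<in> {a..b}"
  have "integral {a..x} u2 = integral {a..x} v2"
    by (rule integral_spike[OF assms(2)]) (use assms(3) x in auto)
  then show "u1 x = u1 a + integral {a..x} v2" using W21D(2)[OF assms(1) x] by (rule back_subst[of "\<lambda>z. u1 x = u1 a + z", rotated])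
  show "u x = u a + integral {a..x} u1" by (rule W21D(3)[OF assms(1) x])
qed

text \<open>
  The classical derivative of \<open>f'\<close> is only controlled where it exists. Since \<open>f'\<close> is locally
  absolutely continuous this is the case almost everywhere, and \<open>f'\<close> is the integral of \<open>G\<close>.
\<close>

lemma regular_solution_increments:
  assumes reg: "regular_on {a<..<b} f"
    and ode: "\<forall>x\<in>{a<..<b}. D1 f differentiable (at x) \<longrightarrow> D1 (D1 f) x = G x"
    and st: "a < s" "s \<le> t" "t < b"
  shows "(G has_integral (D1 f t - D1 f s)) {s..t}" "(D1 f has_integral (f t - f s)) {s..t}"
    and "continuous_on {s..t} (D1 f)" "continuous_on {s..t} f"
proof -
  have sub: "{s..t} \<subseteq> {a<..<b}" using st by auto
  have d: "(f has_vector_derivative D1 f x) (at x)" if "x \<in> {a<..<b}" for x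
    using reg that unfolding regular_on_def by (simp add: vector_derivative_works)
  have ac: "abs_continuous_on {s..t} (D1 f)" "abs_continuous_on {s..t} f"
    using reg sub unfolding regular_on_def locally_abs_continuous_on_def by auto
  then show "continuous_on {s..t} (D1 f)" "continuous_on {s..t} f"
    by (auto intro: abs_continuous_imp_continuous_on)
  show "(D1 f has_integral (f t - f s)) {s..t}"
  proof (rule fundamental_theorem_of_calculus[OF st(2)])
    fix x assume "x \<in> {s..t}"
    then have "x \<in> {a<..<b}" using sub by blast
    then show "(f has_vector_derivative D1 f x) (at x within {s..t})"
      by (rule has_vector_derivative_at_within[OF d])
  qed
  obtain g where g: "g absolutely_integrable_on {s..t}" "\<And>x. x \<in> {s..t} \<Longrightarrow> D1 f x = D1 f s + integral {s..x} g"
    using abs_continuous_on_imp_indefinite_integral[OF ac(1) st(2)] by blast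
  obtain N where N: "negligible N" "\<And>x. x \<in> {s<..<t} - N \<Longrightarrow> (D1 f has_vector_derivative g x) (at x)"
    using indefinite_integral_has_vector_derivative_AE[OF g] by blast
  have "(g has_integral integral {s..t} g) {s..t}"
    using g(1) by (intro integrable_integral set_lebesgue_integral_eq_integral(1))
  moreover have "integral {s..t} g = D1 f t - D1 f s" using g(2)[of t] st by simp
  ultimately have "(g has_integral D1 f t - D1 f s) {s..t}" by simp
  then show "(G has_integral D1 f t - D1 f s) {s..t}"
  proof (rule has_integral_spike[rotated 2])
    show "negligible (N \<union> {s, t})" using N by (auto intro!: negligible_Un)
    fix x assume x: "x \<in> {s..t} - (N \<union> {s, t})"
    then have "(D1 f has_vector_derivative g x) (at x)" using N(2)[of x] by auto
    then have "D1 f differentiable (at x)" "D1 (D1 f) x = g x"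
      by (auto simp: differentiableI_vector vector_derivative_at)
    then show "G x = g x" using ode x sub by force
  qed
qed

text \<open>
  Let \<open>m\<close> be the maximum of \<open>|f|\<close> on \<open>[l, u]\<close>. Integrating the equation twice from \<open>e\<close> gives
  \<open>m \<le> C + (u - l) M m\<close> with \<open>M = \<integral>|r|\<close>, and the assumption \<open>(u - l) M \<le> 1/2\<close> absorbs the last term.
  The bound depends on the point \<open>e\<close> but not on the distance of \<open>l\<close> and \<open>u\<close> to \<open>a\<close> and \<open>b\<close>.
\<close>

lemma regular_solution_bounded_locally:
  fixes r g :: "real \<Rightarrow> complex"
  assumes r: "r absolutely_integrable_on {a..b}" and g: "g absolutely_integrable_on {a..b}"
    and reg: "regular_on {a<..<b} f"
    and ode: "\<forall>x\<in>{a<..<b}. D1 f differentiable (at x) \<longrightarrow> D1 (D1 f) x = r x * f x + g x"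
    and lu: "a < l" "l \<le> u" "u < b" and small: "(u - l) * integral {a..b} (\<lambda>x. norm (r x)) \<le> 1/2"
    and e: "e \<in> {l..u}" and z: "z \<in> {l..u}"
  shows "norm (f z) \<le> 2 * (norm (f e) + (b - a) * (norm (D1 f e) + integral {a..b} (\<lambda>x. norm (g x))))"
proof -
  define M where "M = integral {a..b} (\<lambda>x. norm (r x))"
  define L where "L = integral {a..b} (\<lambda>x. norm (g x))"
  have rn: "(\<lambda>x. norm (r x)) integrable_on {a..b}" and gn: "(\<lambda>x. norm (g x)) integrable_on {a..b}"
    using r g unfolding absolutely_integrable_on_def by auto
  have L: "0 \<le> L" "0 \<le> M" unfolding L_def M_def by (intro integral_nonneg rn gn; simp)+
  note inc = regular_solution_increments[OF reg ode]
  have "continuous_on {l..u} (\<lambda>x. norm (f x))" by (intro continuous_intros inc(4) lu)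
  then obtain w where w: "w \<in> {l..u}" "\<And>x. x \<in> {l..u} \<Longrightarrow> norm (f x) \<le> norm (f w)"
    using continuous_attains_sup[of "{l..u}" "\<lambda>x. norm (f x)"] lu by auto
  define m where "m = norm (f w)"
  have m: "0 \<le> m" by (simp add: m_def)
  have 1: "norm (D1 f t - D1 f s) \<le> M * m + L" if "l \<le> s" "s \<le> t" "t \<le> u" for s t
  proof -
    have sub: "{s..t} \<subseteq> {a..b}" using that lu by auto
    have i: "((\<lambda>x. r x * f x + g x) has_integral (D1 f t - D1 f s)) {s..t}"
      by (rule inc(1)) (use that lu in auto)
    have rs: "(\<lambda>x. norm (r x)) integrable_on {s..t}" and gs: "(\<lambda>x. norm (g x)) integrable_on {s..t}"
      using rn gn sub by (auto intro: integrable_subinterval_real)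
    have "norm (D1 f t - D1 f s) = norm (integral {s..t} (\<lambda>x. r x * f x + g x))"
      using integral_unique[OF i] by simp
    also have "\<dots> \<le> integral {s..t} (\<lambda>x. norm (r x) * m + norm (g x))"
    proof (rule integral_norm_bound_integral)
      show "(\<lambda>x. norm (r x) * m + norm (g x)) integrable_on {s..t}"
        by (intro integrable_add integrable_on_mult_left rs gs)
      fix x assume "x \<in> {s..t}"
      then have "norm (f x) \<le> m" using w(2)[of x] that by (auto simp: m_def)
      then have "norm (r x) * norm (f x) \<le> norm (r x) * m" by (intro mult_left_mono) auto
      then show "norm (r x * f x + g x) \<le> norm (r x) * m + norm (g x)"
        using norm_triangle_ineq[of "r x * f x" "g x"] by (simp add: norm_mult)
    qed (use i in auto)
    also have "\<dots> = integral {s..t} (\<lambda>x. norm (r x)) * m + integral {s..t} (\<lambda>x. norm (g x))"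
      by (subst integral_add) (auto intro!: integrable_on_mult_left rs gs)
    also have "\<dots> \<le> M * m + L"
      unfolding M_def L_def by (intro add_mono mult_right_mono m integral_subset_le sub rs gs rn gn) auto
    finally show ?thesis .
  qed
  have 2: "norm (D1 f s) \<le> norm (D1 f e) + (M * m + L)" if "s \<in> {l..u}" for s
  proof -
    have "norm (D1 f s - D1 f e) \<le> M * m + L"
      using 1[of s e] 1[of e s] that e by (cases "s \<le> e") (auto simp: norm_minus_commute)
    then show ?thesis using norm_triangle_sub[of "D1 f s" "D1 f e"] by linarith
  qed
  let ?B = "norm (D1 f e) + (M * m + L)"
  have B: "0 \<le> ?B" using L m by auto
  have 3: "norm (f t - f s) \<le> ?B * (u - l)" if "l \<le> s" "s \<le> t" "t \<le> u" for s t
  proof -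
    have i: "(D1 f has_integral (f t - f s)) (cbox s t)" using inc(2)[of s t] that lu by auto
    have "norm (f t - f s) \<le> ?B * measure lborel (cbox s t)"
      by (rule has_integral_bound[OF B i]) (use 2 that in auto)
    also have "\<dots> \<le> ?B * (u - l)" using that by (intro mult_left_mono B) auto
    finally show ?thesis .
  qed
  have "norm (f w - f e) \<le> ?B * (u - l)"
    using 3[of w e] 3[of e w] w(1) e by (cases "w \<le> e") (auto simp: norm_minus_commute)
  then have "m \<le> norm (f e) + ?B * (u - l)"
    using norm_triangle_sub[of "f w" "f e"] by (simp add: m_def)
  also have "\<dots> = norm (f e) + (norm (D1 f e) + L) * (u - l) + ((u - l) * M) * m"
    by (simp add: algebra_simps)
  also have "\<dots> \<le> norm (f e) + (norm (D1 f e) + L) * (b - a) + 1/2 * m"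
    using small lu L m unfolding M_def[symmetric] by (intro add_mono mult_left_mono mult_right_mono) auto
  finally have "m \<le> 2 * (norm (f e) + (b - a) * (norm (D1 f e) + L))" by (simp add: algebra_simps)
  then show ?thesis using w(2)[OF z] by (simp add: m_def L_def)
qed

text \<open>
  Near each end point the previous bound applies, with \<open>e = c\<close> or \<open>e = d\<close> at distance \<open>\<eta>/2\<close> from it;
  in between, \<open>f\<close> is continuous on a compact interval.
\<close>

lemma regular_solution_bounded:
  fixes r g :: "real \<Rightarrow> complex"
  assumes r: "r absolutely_integrable_on {a..b}" and g: "g absolutely_integrable_on {a..b}" and "a < b"
    and reg: "regular_on {a<..<b} f"
    and ode: "\<forall>x\<in>{a<..<b}. D1 f differentiable (at x) \<longrightarrow> D1 (D1 f) x = r x * f x + g x"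
  shows "bounded (f ` {a<..<b})"
proof -
  define M where "M = integral {a..b} (\<lambda>x. norm (r x))"
  have rn: "(\<lambda>x. norm (r x)) integrable_on {a..b}"
    using r unfolding absolutely_integrable_on_def by auto
  have M: "0 \<le> M" unfolding M_def by (intro integral_nonneg rn) auto
  define \<eta> where "\<eta> = min ((b - a) / 2) (1 / (2 * (M + 1)))"
  have \<eta>: "\<eta> > 0" "\<eta> \<le> (b - a) / 2" using \<open>a < b\<close> M unfolding \<eta>_def by (simp, linarith)
  have \<eta>M: "\<delta> * M \<le> 1/2" if "0 \<le> \<delta>" "\<delta> \<le> \<eta>" for \<delta>
  proof -
    have "\<delta> * M \<le> 1 / (2 * (M + 1)) * M" using that M by (intro mult_right_mono) (auto simp: \<eta>_def)
    also have "\<dots> \<le> 1/2" using M by (simp add: field_simps)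
    finally show ?thesis .
  qed
  have loc: "\<exists>B. \<forall>z\<in>{l..u}. norm (f z) \<le> B" if "a < l" "l \<le> u" "u < b" for l u
  proof -
    have "continuous_on {l..u} f" using regular_solution_increments(4)[OF reg ode that] .
    then have "bounded (f ` {l..u})" by (intro compact_imp_bounded compact_continuous_image) auto
    then show ?thesis unfolding bounded_iff by auto
  qed
  define c d where "c = a + \<eta> / 2" and "d = b - \<eta> / 2"
  have cd: "a < c" "c \<le> d" "d < b" using \<eta> \<open>a < b\<close> by (auto simp: c_def d_def)
  obtain B where B: "\<And>z. z \<in> {c..d} \<Longrightarrow> norm (f z) \<le> B" using loc[OF cd] by blast
  let ?C = "\<lambda>e. 2 * (norm (f e) + (b - a) * (norm (D1 f e) + integral {a..b} (\<lambda>x. norm (g x))))"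
  have "norm (f z) \<le> max B (max (?C c) (?C d))" if z: "z \<in> {a<..<b}" for z
  proof -
    note bd = regular_solution_bounded_locally[OF r g reg ode, folded M_def]
    consider "z \<in> {c..d}" | "z < c" | "d < z" by fastforce
    then show ?thesis
    proof cases
      case 1 then show ?thesis using B by (simp add: le_max_iff_disj)
    next
      case 2
      have "norm (f z) \<le> ?C c"
      proof (rule bd[of z c])
        show "(c - z) * M \<le> 1/2" by (rule \<eta>M) (use 2 z \<eta>(1) in \<open>auto simp: c_def\<close>)
      qed (use 2 z cd in auto)
      then show ?thesis by (simp add: le_max_iff_disj)
    next
      case 3
      have "norm (f z) \<le> ?C d"
      proof (rule bd[of d z])
        show "(z - d) * M \<le> 1/2" by (rule \<eta>M) (use 3 z \<eta>(1) in \<open>auto simp: d_def\<close>)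
      qed (use 3 z cd in auto)
      then show ?thesis by (simp add: le_max_iff_disj)
    qed
  qed
  then show ?thesis unfolding bounded_iff by blast
qed

text \<open>
  As \<open>f\<close> is bounded, \<open>r f + g\<close> is integrable up to the end points, and integrating it from the
  midpoint \<open>e\<close> continues first \<open>f'\<close> and then \<open>f\<close> to \<open>[a, b]\<close>.
\<close>

theorem regular_solution_extends:
  fixes r g :: "real \<Rightarrow> complex"
  assumes r: "r absolutely_integrable_on {a..b}" and g: "g absolutely_integrable_on {a..b}" and "a < b"
    and reg: "regular_on {a<..<b} f"
    and ode: "\<forall>x\<in>{a<..<b}. D1 f differentiable (at x) \<longrightarrow> D1 (D1 f) x = r x * f x + g x"
  obtains u u1 where "W21 a b u u1 (\<lambda>x. r x * u x + g x)" "\<And>x. x \<in> {a<..<b} \<Longrightarrow> f x = u x"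
proof -
  define F where "F = (\<lambda>x. if x \<in> {a<..<b} then f x else 0)"
  note inc = regular_solution_increments[OF reg ode]
  have fc: "continuous_on {a<..<b} f"
  proof (rule continuous_at_imp_continuous_on, rule ballI)
    fix x assume "x \<in> {a<..<b}"
    then show "isCont f x" using reg unfolding regular_on_def
      by (meson differentiable_imp_continuous_within)
  qed
  have "F \<in> borel_measurable (lebesgue_on {a..b})"
  proof -
    have "f \<in> borel_measurable (lebesgue_on {a<..<b})"
      using fc by (rule continuous_imp_measurable_on_sets_lebesgue) simp
    then have "F \<in> borel_measurable lebesgue"
      unfolding F_def by (subst borel_measurable_if) auto
    then show ?thesis by (rule measurable_restrict_space1)
  qed
  moreover have "bounded (F ` {a..b})"
  proof -
    have "F ` {a..b} \<subseteq> insert 0 (f ` {a<..<b})" by (auto simp: F_def)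
    then show ?thesis using regular_solution_bounded[OF assms] by (meson bounded_insert bounded_subset)
  qed
  ultimately have "(\<lambda>x. r x * F x) absolutely_integrable_on {a..b}"
    by (rule absolutely_integrable_mult_bounded[OF r])
  then have Ga: "(\<lambda>x. r x * F x + g x) absolutely_integrable_on {a..b}"
    using g by (rule set_integral_add(1))
  define G where "G = (\<lambda>x. r x * F x + g x)"
  have Gi: "G integrable_on {a..b}" using Ga unfolding G_def by (rule set_lebesgue_integral_eq_integral(1))
  define e where "e = (a + b) / 2"
  have e: "a < e" "e < b" using \<open>a < b\<close> by (auto simp: e_def)
  define u1 where "u1 = (\<lambda>x. D1 f e + (integral {a..x} G - integral {a..e} G))"
  have u1c: "continuous_on {a..b} u1"
    unfolding u1_def by (intro continuous_intros indefinite_integral_continuous_1 Gi)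
  then have u1i: "u1 integrable_on {a..b}" by (rule integrable_continuous_real)
  define u where "u = (\<lambda>x. f e + (integral {a..x} u1 - integral {a..e} u1))"
  have comb: "integral {a..t} k - integral {a..s} k = integral {s..t} k"
    if "a \<le> s" "s \<le> t" "t \<le> b" "k integrable_on {a..b}" for s t and k :: "real \<Rightarrow> complex"
    by (rule integral_initial_diff[OF that(4,1-3)])
  have G1: "D1 f t - D1 f s = integral {s..t} G" if "a < s" "s \<le> t" "t < b" for s t
  proof -
    have "(G has_integral D1 f t - D1 f s) {s..t}"
      by (rule has_integral_eq[OF _ inc(1)[OF that]]) (use that in \<open>auto simp: G_def F_def\<close>)
    then show ?thesis by (simp add: integral_unique)
  qed
  have u1: "u1 x = D1 f x" if x: "x \<in> {a<..<b}" for x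
  proof (cases "e \<le> x")
    case True
    then have "u1 x - D1 f e = D1 f x - D1 f e"
      using comb[of e x G] G1[of e x] x e Gi by (simp add: u1_def)
    then show ?thesis by simp
  next
    case False
    then have "D1 f e - u1 x = D1 f e - D1 f x"
      using comb[of x e G] G1[of x e] x e Gi by (simp add: u1_def)
    then show ?thesis by simp
  qed
  have G2: "f t - f s = integral {s..t} u1" if "a < s" "s \<le> t" "t < b" for s t
  proof -
    have "(u1 has_integral f t - f s) {s..t}"
      by (rule has_integral_eq[OF _ inc(2)[OF that]]) (use that in \<open>auto simp: u1\<close>)
    then show ?thesis by (simp add: integral_unique)
  qed
  have u: "f x = u x" if x: "x \<in> {a<..<b}" for x
  proof (cases "e \<le> x")
    case True
    then have "u x - f e = f x - f e"
      using comb[of e x u1] G2[of e x] x e u1i by (simp add: u_def)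
    then show ?thesis by simp
  next
    case False
    then have "f e - u x = f e - f x"
      using comb[of x e u1] G2[of x e] x e u1i by (simp add: u_def)
    then show ?thesis by simp
  qed
  have "W21 a b u u1 G"
    unfolding W21_def
  proof (intro conjI ballI)
    show "G absolutely_integrable_on {a..b}" using Ga unfolding G_def .
    fix x
    have "u1 a = D1 f e - integral {a..e} G" "u a = f e - integral {a..e} u1"
      unfolding u1_def u_def by simp_all
    then show "u1 x = u1 a + integral {a..x} G" "u x = u a + integral {a..x} u1"
      unfolding u1_def[THEN fun_cong, of x] u_def[THEN fun_cong, of x] by simp_all
  qed
  then have "W21 a b u u1 (\<lambda>x. r x * u x + g x)"
    by (rule W21_cong[where N = "{a, b}"]) (use u in \<open>auto simp: G_def F_def\<close>)
  then show ?thesis using u by (rule that)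
qed

lemma D1_cong_open:
  assumes "open S" "x \<in> S" "\<And>y. y \<in> S \<Longrightarrow> f y = u y" "(u has_vector_derivative d) (at x)"
  shows "(f has_vector_derivative d) (at x)" "D1 f x = d"
proof -
  show "(f has_vector_derivative d) (at x)"
    using has_vector_derivative_transform_within_open[OF assms(4,1,2)] assms(3) by metis
  then show "D1 f x = d" by (rule vector_derivative_at)
qed

lemma one_sided_limits_eq:
  fixes u f :: "real \<Rightarrow> complex"
  assumes "a < b" "continuous_on {a..b} u" "\<And>x. x \<in> {a<..<b} \<Longrightarrow> f x = u x"
  shows "(f \<longlongrightarrow> u a) (at_right a)" "(f \<longlongrightarrow> u b) (at_left b)" "Rlim f a = u a" "Llim f b = u b"
proof -
  have "(u \<longlongrightarrow> u a) (at_right a)" "(u \<longlongrightarrow> u b) (at_left b)"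
  proof -
    have "(u \<longlongrightarrow> u a) (at a within {a..b})" "(u \<longlongrightarrow> u b) (at b within {a..b})"
      using assms(1,2) by (auto simp: continuous_on_def)
    then show "(u \<longlongrightarrow> u a) (at_right a)" "(u \<longlongrightarrow> u b) (at_left b)"
      by (simp_all only: at_within_Icc_at_right[OF assms(1)] at_within_Icc_at_left[OF assms(1)])
  qed
  moreover have "eventually (\<lambda>x. f x = u x) (at_right a)"
    using assms(1,3) by (auto simp: eventually_at_right[OF assms(1)] intro!: exI[of _ b])
  moreover have "eventually (\<lambda>x. f x = u x) (at_left b)"
    using assms(1,3) by (auto simp: eventually_at_left[OF assms(1)] intro!: exI[of _ a])
  ultimately show 1: "(f \<longlongrightarrow> u a) (at_right a)" "(f \<longlongrightarrow> u b) (at_left b)"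
    by (auto simp: tendsto_cong)
  then show "Rlim f a = u a" "Llim f b = u b" by (auto intro!: tendsto_Lim)
qed

text \<open>
  Conversely, a function that agrees on the open interval with a member of \<open>W\<^sup>2\<^sup>,\<^sup>1\<close> is regular
  there, and its one-sided limits are the boundary values of that member.
\<close>

lemma W21_regular:
  assumes W: "W21 a b u u1 u2" and "a < b" and f: "\<And>x. x \<in> {a<..<b} \<Longrightarrow> f x = u x"
  shows "regular_on {a<..<b} f" "\<And>x. x \<in> {a<..<b} \<Longrightarrow> D1 f x = u1 x"
    "Rlim f a = u a" "Llim f b = u b" "Rlim (D1 f) a = u1 a" "Llim (D1 f) b = u1 b"
proof -
  have d: "(f has_vector_derivative u1 x) (at x)" if "x \<in> {a<..<b}" for x
    using D1_cong_open(1)[OF open_greaterThanLessThan that f W21_has_derivative[OF W that]] by auto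
  then show D: "D1 f x = u1 x" if "x \<in> {a<..<b}" for x using that by (auto simp: vector_derivative_at)
  note ac = W21_absolutely_continuous[OF W]
  show "Rlim f a = u a" "Llim f b = u b" "Rlim (D1 f) a = u1 a" "Llim (D1 f) b = u1 b"
    using one_sided_limits_eq[OF \<open>a < b\<close> ac(4) f] one_sided_limits_eq[OF \<open>a < b\<close> ac(3) D] by auto
  have cong: "abs_continuous_on S v \<Longrightarrow> (\<And>x. x \<in> S \<Longrightarrow> w x = v x) \<Longrightarrow> abs_continuous_on S w" for S v w
    by (rule abs_continuous_on_dominated[of S v v 1]) auto
  have loc: "locally_abs_continuous_on {a<..<b} w"
    if "abs_continuous_on {a..b} v" "\<And>x. x \<in> {a<..<b} \<Longrightarrow> w x = v x" for v w
    unfolding locally_abs_continuous_on_def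
  proof (intro allI impI)
    fix s t assume st: "{s..t} \<subseteq> {a<..<b}"
    then have "{s..t} \<subseteq> {a..b}" by force
    then have "abs_continuous_on {s..t} v" by (rule abs_continuous_on_subset[OF that(1)])
    then show "abs_continuous_on {s..t} w" by (rule cong) (use st that(2) in blast)
  qed
  show "regular_on {a<..<b} f"
    unfolding regular_on_def using loc[OF ac(2) f] loc[OF ac(1) D] d differentiableI_vector[OF d] by blast
qed

section \<open>Symmetric operators in a complex Hilbert space\<close>

text \<open>
  The Hilbert space is the whole type \<open>'h\<close>, with its scalar multiplication and inner product given
  as functions because the type carries no topology.
\<close>

locale complex_hilbert_space =
  fixes smul :: "complex \<Rightarrow> 'h \<Rightarrow> 'h::ab_group_add" and ip :: "'h \<Rightarrow> 'h \<Rightarrow> complex"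
  assumes smul_vector_space: "vector_space smul"
    and ip_add_left: "ip (x + y) z = ip x z + ip y z"
    and ip_smul_left: "ip (smul c x) y = c * ip x y"
    and ip_cnj: "cnj (ip x y) = ip y x"
    and ip_nonneg: "0 \<le> Re (ip x x)"
    and ip_definite: "Re (ip x x) = 0 \<Longrightarrow> x = 0"
    and complete: "(\<And>e. e > 0 \<Longrightarrow> \<exists>N. \<forall>m\<ge>N. \<forall>n\<ge>N. Re (ip (X m - X n) (X m - X n)) < e) \<Longrightarrow>
      \<exists>x. (\<lambda>n. Re (ip (X n - x) (X n - x))) \<longlonglongrightarrow> 0"
begin

interpretation V: vector_space smul by (rule smul_vector_space)

definition nsq :: "'h \<Rightarrow> real" where "nsq x = Re (ip x x)"

lemma ip_add_right: "ip x (y + z) = ip x y + ip x z"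
  by (metis complex_cnj_add ip_add_left ip_cnj)

lemma ip_smul_right: "ip x (smul c y) = cnj c * ip x y"
  by (metis complex_cnj_mult ip_smul_left ip_cnj)

lemma ip_minus_left: "ip (- x) y = - ip x y"
  using ip_smul_left[of "-1" x y] by simp

lemma ip_minus_right: "ip x (- y) = - ip x y"
  using ip_smul_right[of x "-1" y] by simp

lemma ip_diff_left: "ip (x - y) z = ip x z - ip y z"
  using ip_add_left[of x "- y" z] by (simp add: ip_minus_left)

lemma ip_diff_right: "ip x (y - z) = ip x y - ip x z"
  using ip_add_right[of x y "- z"] by (simp add: ip_minus_right)

lemma ip_zero: "ip 0 x = 0" "ip x 0 = 0"
  using ip_diff_left[of x x x] ip_diff_right[of x x x] by simp_all

lemmas ip_simps = ip_add_left ip_add_right ip_diff_left ip_diff_right ip_smul_left ip_smul_right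
  ip_minus_left ip_minus_right ip_zero

lemma ip_self: "ip x x = of_real (nsq x)"
  using ip_cnj[of x x] by (auto simp: nsq_def complex_eq_iff)

lemma nsq_nonneg: "0 \<le> nsq x" and nsq_eq_0: "nsq x = 0 \<Longrightarrow> x = 0"
  by (simp_all add: nsq_def ip_nonneg ip_definite)

text \<open>Subtracting the orthogonal projection onto the line through \<open>d\<close>.\<close>

lemma nsq_diff_smul:
  assumes "nsq d \<noteq> 0"
  shows "nsq (x - smul (ip x d / of_real (nsq d)) d) = nsq x - (cmod (ip x d))\<^sup>2 / nsq d"
proof -
  let ?t = "ip x d / of_real (nsq d)"
  have "ip (x - smul ?t d) (x - smul ?t d) = ip x x - cnj ?t * ip x d - ?t * ip d x + ?t * cnj ?t * ip d d"
    by (simp add: ip_simps algebra_simps)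
  also have "ip d x = cnj (ip x d)" by (simp add: ip_cnj)
  also have "?t * cnj ?t * ip d d = ip x d * cnj (ip x d) / of_real (nsq d)"
    using assms by (simp add: ip_self[of d])
  also have "ip x x - cnj ?t * ip x d - ?t * cnj (ip x d) + ip x d * cnj (ip x d) / of_real (nsq d) =
      of_real (nsq x) - ip x d * cnj (ip x d) / of_real (nsq d)"
    by (simp add: ip_self[of x] mult.commute)
  also have "ip x d * cnj (ip x d) = of_real ((cmod (ip x d))\<^sup>2)"
    by (rule complex_norm_square[symmetric])
  finally show ?thesis by (simp add: nsq_def)
qed

lemma Cauchy_Schwarz: "(cmod (ip x y))\<^sup>2 \<le> nsq x * nsq y"
proof (cases "nsq y = 0")
  case True
  then have "y = 0" by (rule nsq_eq_0)
  then show ?thesis by (simp add: ip_zero nsq_def)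
next
  case False
  have "0 \<le> nsq x - (cmod (ip x y))\<^sup>2 / nsq y"
    using nsq_diff_smul[OF False, of x] nsq_nonneg by metis
  then show ?thesis using False nsq_nonneg[of y] by (simp add: field_simps)
qed

lemma parallelogram: "nsq (x + y) + nsq (x - y) = 2 * nsq x + 2 * nsq y"
  by (simp add: nsq_def ip_simps algebra_simps)

lemma nsq_minus: "nsq (- x) = nsq x"
  by (simp add: nsq_def ip_simps)

lemma nsq_smul: "nsq (smul c x) = (cmod c)\<^sup>2 * nsq x"
proof -
  have "ip (smul c x) (smul c x) = c * cnj c * of_real (nsq x)"
    by (simp add: ip_simps ip_self[of x])
  also have "c * cnj c = of_real ((cmod c)\<^sup>2)" by (rule complex_norm_square[symmetric])
  finally have "ip (smul c x) (smul c x) = of_real ((cmod c)\<^sup>2 * nsq x)" by simp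
  then show ?thesis unfolding nsq_def[of "smul c x"] by (simp only: Re_complex_of_real)
qed

text \<open>
  A minimising sequence \<open>F n\<close> for the distance \<open>\<delta>\<close> (squared) from \<open>G\<close> to the subspace \<open>D\<close> is Cauchy by
  the parallelogram law. Minimality makes \<open>G - F n\<close> almost orthogonal to \<open>D\<close>, so \<open>G\<close> minus the
  limit \<open>P\<close> is orthogonal to \<open>D\<close> and therefore 0.
\<close>

lemma dense_if_trivial_complement:
  assumes D: "0 \<in> D" "\<And>x y. x \<in> D \<Longrightarrow> y \<in> D \<Longrightarrow> x + y \<in> D" "\<And>c x. x \<in> D \<Longrightarrow> smul c x \<in> D"
    and triv: "\<And>z. (\<And>d. d \<in> D \<Longrightarrow> ip z d = 0) \<Longrightarrow> z = 0" and "\<epsilon> > 0"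
  shows "\<exists>F\<in>D. nsq (G - F) < \<epsilon>"
proof -
  define \<delta> where "\<delta> = (INF F\<in>D. nsq (G - F))"
  have bdd: "bdd_below ((\<lambda>F. nsq (G - F)) ` D)" by (intro bdd_belowI2[of _ 0] nsq_nonneg)
  have \<delta>: "\<delta> \<le> nsq (G - F)" if "F \<in> D" for F
    unfolding \<delta>_def using bdd that by (rule cINF_lower)
  have "\<exists>F\<in>D. nsq (G - F) < \<delta> + 1 / (real n + 1)" for n
  proof (rule ccontr)
    assume "\<not> ?thesis"
    then have "\<delta> + 1 / (real n + 1) \<le> \<delta>"
      unfolding \<delta>_def[symmetric] using D(1) by (subst (2) \<delta>_def) (auto intro!: cINF_greatest simp: not_less)
    then show False by simp
  qed
  then obtain F where F: "\<And>n. F n \<in> D" "\<And>n. nsq (G - F n) < \<delta> + 1 / (real n + 1)" by metis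
  have FF: "nsq (F m - F n) \<le> 2 / (real m + 1) + 2 / (real n + 1)" for m n
  proof -
    have "F m - F n = (G - F n) - (G - F m)" by simp
    then have 1: "nsq ((G - F n) + (G - F m)) + nsq (F m - F n) = 2 * nsq (G - F n) + 2 * nsq (G - F m)"
      using parallelogram[of "G - F n" "G - F m"] by simp
    have "(G - F n) + (G - F m) = smul 2 (G - smul (1/2) (F n + F m))"
      using V.scale_left_distrib[of 1 1 G] by (simp add: V.scale_right_diff_distrib)
    then have "nsq ((G - F n) + (G - F m)) = 4 * nsq (G - smul (1/2) (F n + F m))"
      by (simp add: nsq_smul)
    moreover have "\<delta> \<le> nsq (G - smul (1/2) (F n + F m))" by (intro \<delta> D F)
    ultimately show ?thesis using 1 F(2)[of n] F(2)[of m] by simp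
  qed
  have small: "\<exists>N. \<forall>n\<ge>N. 1 / (real n + 1) < e" if "e > 0" for e :: real
  proof -
    obtain N :: nat where N: "1 / e < N" using reals_Archimedean2 by blast
    have "1 / (real n + 1) < e" if "n \<ge> N" for n
    proof -
      have "1 / e < real n + 1" using N that by linarith
      then show ?thesis using \<open>e > 0\<close> by (simp add: field_simps)
    qed
    then show ?thesis by blast
  qed
  have "\<exists>P. (\<lambda>n. Re (ip (F n - P) (F n - P))) \<longlonglongrightarrow> 0"
  proof (rule complete)
    fix e :: real assume "e > 0"
    then obtain N where N: "\<And>n. n \<ge> N \<Longrightarrow> 1 / (real n + 1) < e / 4" using small[of "e/4"] by auto
    have "nsq (F m - F n) < e" if "m \<ge> N" "n \<ge> N" for m n
      using FF[of m n] N[OF that(1)] N[OF that(2)] by simp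
    then show "\<exists>N. \<forall>m\<ge>N. \<forall>n\<ge>N. Re (ip (F m - F n) (F m - F n)) < e" unfolding nsq_def by blast
  qed
  then obtain P where P: "(\<lambda>n. nsq (F n - P)) \<longlonglongrightarrow> 0" unfolding nsq_def by blast
  have inv0: "(\<lambda>n. 1 / (real n + 1)) \<longlonglongrightarrow> 0"
    using LIMSEQ_inverse_real_of_nat by (simp add: inverse_eq_divide add.commute)
  have "G - P = 0"
  proof (rule triv)
    fix d assume d: "d \<in> D"
    have 1: "(cmod (ip (G - F n) d))\<^sup>2 \<le> 1 / (real n + 1) * nsq d" for n
    proof (cases "nsq d = 0")
      case True
      then show ?thesis using nsq_eq_0[OF True] by (simp add: ip_zero)
    next
      case False
      let ?t = "ip (G - F n) d / of_real (nsq d)"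
      have "\<delta> \<le> nsq (G - (F n + smul ?t d))" by (intro \<delta> D F d)
      also have "G - (F n + smul ?t d) = (G - F n) - smul ?t d" by simp
      also have "nsq \<dots> = nsq (G - F n) - (cmod (ip (G - F n) d))\<^sup>2 / nsq d" by (rule nsq_diff_smul[OF False])
      finally have "(cmod (ip (G - F n) d))\<^sup>2 / nsq d \<le> 1 / (real n + 1)" using F(2)[of n] by simp
      then show ?thesis using False nsq_nonneg[of d] by (subst (asm) pos_divide_le_eq) auto
    qed
    have "(\<lambda>n. 2 * (1 / (real n + 1) * nsq d + nsq (F n - P) * nsq d)) \<longlonglongrightarrow> 2 * (0 * nsq d + 0 * nsq d)"
      by (intro tendsto_intros inv0 P)
    moreover have "(cmod (ip (G - P) d))\<^sup>2 \<le> 2 * (1 / (real n + 1) * nsq d + nsq (F n - P) * nsq d)" for n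
    proof -
      have "ip (G - P) d = ip (G - F n) d + ip (F n - P) d" by (simp add: ip_simps)
      then have "(cmod (ip (G - P) d))\<^sup>2 \<le> (cmod (ip (G - F n) d) + cmod (ip (F n - P) d))\<^sup>2"
        by (simp add: norm_triangle_ineq power_mono)
      also have "\<dots> \<le> 2 * ((cmod (ip (G - F n) d))\<^sup>2 + (cmod (ip (F n - P) d))\<^sup>2)"
        using sum_squares_bound[of "cmod (ip (G - F n) d)" "cmod (ip (F n - P) d)"] by (simp add: power2_sum)
      also have "\<dots> \<le> 2 * (1 / (real n + 1) * nsq d + nsq (F n - P) * nsq d)"
        by (intro mult_left_mono add_mono 1 Cauchy_Schwarz) auto
      finally show ?thesis .
    qed
    ultimately have "(cmod (ip (G - P) d))\<^sup>2 \<le> 2 * (0 * nsq d + 0 * nsq d)"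
      by (intro LIMSEQ_le_const[of _ _ "(cmod (ip (G - P) d))\<^sup>2"]) blast+
    then show "ip (G - P) d = 0" by simp
  qed
  then have "G = P" by simp
  then have "eventually (\<lambda>n. nsq (F n - G) < \<epsilon>) sequentially"
    using order_tendstoD(2)[OF P \<open>\<epsilon> > 0\<close>] by simp
  then obtain n where "nsq (F n - G) < \<epsilon>" unfolding eventually_sequentially by blast
  then show ?thesis using F(1)[of n] nsq_minus[of "F n - G"] by (intro bexI[of _ "F n"]) simp_all
qed

lemma symmetric_eigenvalue_real:
  assumes sym: "\<And>F AF G AG. (F, AF) \<in> A \<Longrightarrow> (G, AG) \<in> A \<Longrightarrow> ip AF G = ip F AG"
    and F: "(F, smul c F) \<in> A" "Im c \<noteq> 0"
  shows "F = 0"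
proof -
  have "c * ip F F = cnj c * ip F F" using sym[OF F(1) F(1)] by (simp add: ip_simps)
  moreover have "c \<noteq> cnj c" using F(2) by (simp add: complex_eq_iff)
  ultimately have "ip F F = 0" by simp
  then show ?thesis using ip_definite[of F] by simp
qed

text \<open>
  Density of the domain is part of the conclusion. For \<open>z\<close> orthogonal to the domain write
  \<open>z = (A - \<i>) U\<close>; then \<open>(A + \<i>) F\<close> is orthogonal to \<open>U\<close> for all \<open>F\<close>, so \<open>U = 0\<close> and \<open>z = 0\<close>. For \<open>(G, K)\<close> in the adjoint
  write \<open>K - \<i> G = (A - \<i>) U\<close>; in the same way \<open>G - U\<close> is orthogonal to the range of \<open>A + \<i>\<close>, so
  \<open>(G, K) = (U, A U)\<close>.
\<close>

theorem self_adjointI: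
  assumes lin: "linear_operator smul A"
    and sym: "\<And>F AF G AG. (F, AF) \<in> A \<Longrightarrow> (G, AG) \<in> A \<Longrightarrow> ip AF G = ip F AG"
    and surj: "\<And>c K. c \<in> {\<i>, - \<i>} \<Longrightarrow> \<exists>F AF. (F, AF) \<in> A \<and> AF - smul c F = K"
  shows "self_adjoint_operator smul ip A"
proof -
  have shift: "ip AF U - cnj c * ip F U = ip (AF - smul (cnj c) F) U" for AF U F c
    by (simp add: ip_simps)
  have "densely_defined ip A"
    unfolding densely_defined_def
  proof (intro allI impI)
    fix G and \<epsilon> :: real assume "\<epsilon> > 0"
    have "\<exists>F\<in>Domain A. nsq (G - F) < \<epsilon>\<^sup>2"
    proof (rule dense_if_trivial_complement)
      show "0 \<in> Domain A" "\<And>x y. x \<in> Domain A \<Longrightarrow> y \<in> Domain A \<Longrightarrow> x + y \<in> Domain A"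
        "\<And>c x. x \<in> Domain A \<Longrightarrow> smul c x \<in> Domain A"
        using lin unfolding linear_operator_def by fast+
      fix z assume z: "\<And>d. d \<in> Domain A \<Longrightarrow> ip z d = 0"
      obtain U AU where U: "(U, AU) \<in> A" "AU - smul \<i> U = z" using surj[of \<i> z] by auto
      obtain F AF where F: "(F, AF) \<in> A" "AF - smul (cnj \<i>) F = U" using surj[of "-\<i>" U] by auto
      have "0 = cnj (ip z F)" using z[of F] F(1) by auto
      also have "\<dots> = ip F AU - cnj \<i> * ip F U" unfolding ip_cnj U(2)[symmetric] by (simp add: ip_simps)
      also have "ip F AU = ip AF U" using sym[OF F(1) U(1)] by simp
      finally have "ip U U = 0" using shift[of AF U \<i> F] F(2) by simp
      then have "U = 0" using ip_definite[of U] by simp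
      moreover have "(0, 0) \<in> A" "single_valued A" using lin by (auto simp: linear_operator_def)
      ultimately have "AU = 0" using U(1) by (auto dest: single_valuedD)
      then show "z = 0" using U(2) \<open>U = 0\<close> by simp
    qed (use \<open>\<epsilon> > 0\<close> in simp)
    then obtain F where "F \<in> Domain A" "nsq (G - F) < \<epsilon>\<^sup>2" by blast
    then show "\<exists>F\<in>Domain A. sqrt (Re (ip (G - F) (G - F))) < \<epsilon>"
      using \<open>\<epsilon> > 0\<close> by (intro bexI[of _ F] real_less_lsqrt) (auto simp: nsq_def ip_nonneg)
  qed
  moreover have "adjoint_graph ip A = A"
  proof
    show "A \<subseteq> adjoint_graph ip A" unfolding adjoint_graph_def using sym by auto
    show "adjoint_graph ip A \<subseteq> A"
    proof
      fix x assume x: "x \<in> adjoint_graph ip A"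
      obtain G K where GK: "x = (G, K)" by fastforce
      have adj: "ip AF G = ip F K" if "(F, AF) \<in> A" for F AF
        using x that unfolding GK adjoint_graph_def by auto
      obtain U AU where U: "(U, AU) \<in> A" "AU - smul \<i> U = K - smul \<i> G"
        using surj[of \<i> "K - smul \<i> G"] by auto
      obtain F AF where F: "(F, AF) \<in> A" "AF - smul (cnj \<i>) F = G - U"
        using surj[of "-\<i>" "G - U"] by auto
      have "ip (AF - smul (cnj \<i>) F) G = ip AF G - cnj \<i> * ip F G" by (rule shift[symmetric])
      also have "\<dots> = ip F (K - smul \<i> G)" using adj[OF F(1)] by (simp add: ip_simps)
      also have "\<dots> = ip F AU - cnj \<i> * ip F U" unfolding U(2)[symmetric] by (simp add: ip_simps)
      also have "\<dots> = ip (AF - smul (cnj \<i>) F) U" using sym[OF F(1) U(1)] shift[of AF U \<i> F] by simp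
      finally have "ip (G - U) (G - U) = 0" unfolding F(2) by (simp add: ip_diff_right)
      then have "G = U" using ip_definite[of "G - U"] by simp
      then show "x \<in> A" using U GK by simp
    qed
  qed
  ultimately show ?thesis using lin by (simp add: self_adjoint_operator_def)
qed

end

section \<open>Completeness of \<open>L\<^sup>2\<close>\<close>

text \<open>
  Along a subsequence \<open>k\<close> the squared distances of consecutive terms are below \<open>(1/4)^j\<close>. Since
  \<open>2 d \<le> 1/2^j + 2^j d\<^sup>2\<close> and \<open>[-1, 1]\<close> has finite measure, the distances themselves are summable in
  \<open>L\<^sup>1\<close>; so the subsequence converges almost everywhere, and Fatou's lemma turns this into
  convergence in \<open>L\<^sup>2\<close>.
\<close>

lemma Riesz_Fischer:
  fixes F :: "nat \<Rightarrow> real \<Rightarrow> complex"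
  assumes sq: "\<And>n. square_integrable (F n)"
    and Cauchy: "\<And>e. e > 0 \<Longrightarrow> \<exists>N. \<forall>m\<ge>N. \<forall>n\<ge>N. (LINT x|leb_I. (cmod (F m x - F n x))\<^sup>2) < e"
  obtains f where "square_integrable f" "(\<lambda>n. LINT x|leb_I. (cmod (F n x - f x))\<^sup>2) \<longlonglongrightarrow> 0"
proof -
  have [measurable]: "F n \<in> borel_measurable leb_I" for n using sq by (simp add: square_integrable_def)
  have int: "integrable leb_I (\<lambda>x. (cmod (F m x - F n x))\<^sup>2)" for m n
    using square_integrable_diff[OF sq sq] by (simp add: square_integrable_def)
  have "\<exists>N. \<forall>m\<ge>N. \<forall>n\<ge>N. (LINT x|leb_I. (cmod (F m x - F n x))\<^sup>2) < (1/4)^j" for j :: nat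
    by (rule Cauchy) simp
  then obtain N where N: "\<And>j m n. m \<ge> N j \<Longrightarrow> n \<ge> N j \<Longrightarrow> (LINT x|leb_I. (cmod (F m x - F n x))\<^sup>2) < (1/4)^j"
    by metis
  define k where "k = (\<lambda>j. \<Sum>i\<le>j. N i)"
  have kmono: "k i \<le> k j" if "i \<le> j" for i j unfolding k_def using that by (intro sum_mono2) auto
  have kN: "N i \<le> k j" if "i \<le> j" for i j
    using kmono[OF that] member_le_sum[of i "{..i}" N] by (simp add: k_def)
  have knn: "(\<integral>\<^sup>+x. ennreal ((cmod (F m x - F (k j) x))\<^sup>2) \<partial>leb_I) \<le> ennreal ((1/4)^i)"
    if "m \<ge> k i" "j \<ge> i" for m i j
    using N[of i m "k j"] kN[of i i] kN[of i j] that
    by (subst nn_integral_eq_integral[OF int]) (auto intro!: ennreal_leI)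
  define d where "d = (\<lambda>j x. cmod (F (k (Suc j)) x - F (k j) x))"
  have [measurable]: "d j \<in> borel_measurable leb_I" for j unfolding d_def by measurable
  have dint: "(\<integral>\<^sup>+x. ennreal (d j x) \<partial>leb_I) \<le> ennreal (3 * (1/2)^j)" for j
  proof -
    have "(\<integral>\<^sup>+x. ennreal (d j x) \<partial>leb_I) \<le> (\<integral>\<^sup>+x. ennreal ((1/2)^j) + ennreal (2^j) * ennreal ((d j x)\<^sup>2) \<partial>leb_I)"
    proof (rule nn_integral_mono)
      fix x
      have "2 * (d j x * (2::real)^j) \<le> 1 + (d j x * 2^j)\<^sup>2"
        using sum_squares_bound[of 1 "d j x * 2^j"] by (simp add: power2_eq_square)
      then have "2 * d j x \<le> (1/2)^j + 2^j * (d j x)\<^sup>2"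
        by (simp add: power2_eq_square field_simps power_divide)
      moreover have "0 \<le> d j x" by (simp add: d_def)
      ultimately have "d j x \<le> (1/2)^j + 2^j * (d j x)\<^sup>2" by linarith
      then show "ennreal (d j x) \<le> ennreal ((1/2)^j) + ennreal (2^j) * ennreal ((d j x)\<^sup>2)"
        by (simp add: ennreal_plus[symmetric] ennreal_mult[symmetric] ennreal_leI del: ennreal_plus)
    qed
    also have "\<dots> = ennreal ((1/2)^j) * emeasure leb_I (space leb_I) + ennreal (2^j) * (\<integral>\<^sup>+x. ennreal ((d j x)\<^sup>2) \<partial>leb_I)"
      by (subst nn_integral_add) (auto simp: nn_integral_cmult)
    also have "emeasure leb_I (space leb_I) = ennreal 2"
      by (simp add: emeasure_restrict_space)
    also have "(\<integral>\<^sup>+x. ennreal ((d j x)\<^sup>2) \<partial>leb_I) \<le> ennreal ((1/4)^j)"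
      unfolding d_def using kmono[of j "Suc j"] by (intro knn) auto
    also have "ennreal ((1/2)^j) * ennreal 2 + ennreal (2^j) * ennreal ((1/4)^j) = ennreal (3 * (1/2)^j)"
      by (simp add: ennreal_mult[symmetric] ennreal_plus[symmetric] power_mult_distrib[symmetric] del: ennreal_plus ennreal_numeral)
    finally show ?thesis by (simp add: add_left_mono mult_left_mono)
  qed
  have "(\<integral>\<^sup>+x. (\<Sum>j. ennreal (d j x)) \<partial>leb_I) = (\<Sum>j. \<integral>\<^sup>+x. ennreal (d j x) \<partial>leb_I)"
    by (rule nn_integral_suminf) measurable
  also have "\<dots> \<le> (\<Sum>j. ennreal (3 * (1/2)^j))" by (intro suminf_le dint) auto
  also have "\<dots> < \<infinity>"
  proof -
    have "summable (\<lambda>j. 3 * (1/2)^j :: real)" by (intro summable_mult summable_geometric) simp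
    then show ?thesis by (simp add: suminf_ennreal_eq[OF _ summable_sums] less_top[symmetric])
  qed
  finally have "AE x in leb_I. (\<Sum>j. ennreal (d j x)) \<noteq> \<infinity>"
    by (intro nn_integral_PInf_AE) auto
  then have conv: "AE x in leb_I. convergent (\<lambda>j. F (k j) x)"
  proof eventually_elim
    case (elim x)
    then have "summable (\<lambda>j. d j x)" by (intro summable_suminf_not_top) (auto simp: d_def)
    then have "summable (\<lambda>j. F (k (Suc j)) x - F (k j) x)" unfolding d_def by (rule summable_norm_cancel)
    then have "convergent (\<lambda>n. \<Sum>j<n. F (k (Suc j)) x - F (k j) x)" by (simp add: summable_iff_convergent)
    then have "convergent (\<lambda>n. (F (k n) x - F (k 0) x) + F (k 0) x)"
      unfolding sum_lessThan_telescope[of "\<lambda>j. F (k j) x"] by (intro convergent_add convergent_const)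
    then show ?case by simp
  qed
  define f where "f = (\<lambda>x. lim (\<lambda>j. F (k j) x))"
  have [measurable]: "f \<in> borel_measurable leb_I" unfolding f_def by measurable
  have le: "(\<integral>\<^sup>+x. ennreal ((cmod (F m x - f x))\<^sup>2) \<partial>leb_I) \<le> ennreal ((1/4)^i)" if m: "m \<ge> k i" for m i
  proof -
    have "(\<integral>\<^sup>+x. ennreal ((cmod (F m x - f x))\<^sup>2) \<partial>leb_I) =
        (\<integral>\<^sup>+x. liminf (\<lambda>j. ennreal ((cmod (F m x - F (k j) x))\<^sup>2)) \<partial>leb_I)"
    proof (rule nn_integral_cong_AE, use conv in eventually_elim)
      case (elim x)
      then have "(\<lambda>j. F (k j) x) \<longlonglongrightarrow> f x" unfolding f_def by (simp add: convergent_LIMSEQ_iff)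
      then have "(\<lambda>j. ennreal ((cmod (F m x - F (k j) x))\<^sup>2)) \<longlonglongrightarrow> ennreal ((cmod (F m x - f x))\<^sup>2)"
        by (intro tendsto_intros)
      then show ?case by (intro lim_imp_Liminf[symmetric]) simp
    qed
    also have "\<dots> \<le> liminf (\<lambda>j. \<integral>\<^sup>+x. ennreal ((cmod (F m x - F (k j) x))\<^sup>2) \<partial>leb_I)"
      by (rule nn_integral_liminf) measurable
    also have "\<dots> \<le> ennreal ((1/4)^i)"
    proof (rule order_trans[OF Liminf_le_Limsup Limsup_bounded])
      show "eventually (\<lambda>j. (\<integral>\<^sup>+x. ennreal ((cmod (F m x - F (k j) x))\<^sup>2) \<partial>leb_I) \<le> ennreal ((1/4)^i)) sequentially"
        using eventually_ge_at_top[of i] by eventually_elim (rule knn[OF m])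
    qed simp
    finally show ?thesis .
  qed
  have sqd: "square_integrable (\<lambda>x. F m x - f x)" if "m \<ge> k i" for m i
    unfolding square_integrable_def using le[OF that]
    by (auto intro!: integrableI_bounded simp: less_top[symmetric] top_unique)
  have "square_integrable f"
    using square_integrable_diff[OF sq[of "k 0"] sqd[of 0 "k 0"]] by simp
  moreover have "(\<lambda>n. LINT x|leb_I. (cmod (F n x - f x))\<^sup>2) \<longlonglongrightarrow> 0"
    unfolding lim_sequentially
  proof (intro allI impI)
    fix e :: real assume "e > 0"
    then obtain i where i: "(1/4)^i < e" using real_arch_pow_inv[of e "1/4"] by auto
    have "dist (LINT x|leb_I. (cmod (F n x - f x))\<^sup>2) 0 < e" if "n \<ge> k i" for n
    proof -
      have "integrable leb_I (\<lambda>x. (cmod (F n x - f x))\<^sup>2)" using sqd[OF that] by (simp add: square_integrable_def)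
      then have "ennreal (LINT x|leb_I. (cmod (F n x - f x))\<^sup>2) \<le> ennreal ((1/4)^i)"
        using le[OF that] by (subst (asm) nn_integral_eq_integral) auto
      then have "(LINT x|leb_I. (cmod (F n x - f x))\<^sup>2) \<le> (1/4)^i" by (subst (asm) ennreal_le_iff) auto
      then show ?thesis using i by simp
    qed
    then show "\<exists>N. \<forall>n\<ge>N. dist (LINT x|leb_I. (cmod (F n x - f x))\<^sup>2) 0 < e" by blast
  qed
  ultimately show ?thesis by (rule that)
qed

section \<open>The Hilbert space of the problem\<close>

lemma all_less_4: "(\<forall>i<4::nat. Q i) \<longleftrightarrow> Q 0 \<and> Q 1 \<and> Q 2 \<and> Q 3"
  by (auto simp: less_Suc_eq numeral_eq_Suc)

lemma all_less_3: "(\<forall>i<3::nat. Q i) \<longleftrightarrow> Q 0 \<and> Q 1 \<and> Q 2"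
  by (auto simp: less_Suc_eq numeral_eq_Suc)

lemma sum_less_4: "sum Q {..<4::nat} = Q 0 + Q 1 + Q 2 + Q 3"
  by (simp add: numeral_eq_Suc)

lemma square_integrable_product:
  assumes "square_integrable f" "square_integrable g"
  shows "integrable leb_I (\<lambda>x. f x * cnj (g x))"
proof -
  have fm: "f \<in> borel_measurable leb_I" and gm: "g \<in> borel_measurable leb_I"
    and i: "integrable leb_I (\<lambda>x. (cmod (f x))\<^sup>2 + (cmod (g x))\<^sup>2)"
    using assms by (auto simp: square_integrable_def)
  have m: "(\<lambda>x. cnj (g x)) \<in> borel_measurable leb_I"
    using borel_measurable_continuous_onI[OF continuous_on_cnj[OF continuous_on_id]] gm
    by (rule measurable_compose_rev)
  have b: "cmod (f x * cnj (g x)) \<le> (cmod (f x))\<^sup>2 + (cmod (g x))\<^sup>2" for x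
  proof -
    have "2 * cmod (f x) * cmod (g x) \<le> (cmod (f x))\<^sup>2 + (cmod (g x))\<^sup>2" by (rule sum_squares_bound)
    moreover have "0 \<le> cmod (f x) * cmod (g x)" by simp
    ultimately show ?thesis unfolding norm_mult complex_mod_cnj by linarith
  qed
  show ?thesis
    by (rule Bochner_Integration.integrable_bound[OF i]) (use borel_measurable_times[OF fm m] b in \<open>auto intro!: always_eventually\<close>)
qed

lemma square_integrable_imp_integrable:
  assumes "square_integrable f" shows "integrable leb_I f"
proof -
  have "integrable leb_I (\<lambda>x. 1 :: real)" by (simp add: emeasure_restrict_space)
  then have "square_integrable (\<lambda>x. 1)" by (simp add: square_integrable_def)
  from square_integrable_product[OF assms this] show ?thesis by simp
qed

lemma indicator_measurable_leb_I [measurable]: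
  "(indicator {a<..<b} :: real \<Rightarrow> real) \<in> borel_measurable leb_I"
  by (intro measurable_restrict_space1 borel_measurable_indicator) auto

lemma integrable_indicator_mult:
  fixes \<phi> :: "real \<Rightarrow> 'b :: {banach, second_countable_topology}"
  assumes "integrable leb_I \<phi>" shows "integrable leb_I (\<lambda>x. indicator {a<..<b} x *\<^sub>R \<phi> x)"
proof (rule Bochner_Integration.integrable_bound[OF assms])
  have "\<phi> \<in> borel_measurable leb_I" using assms by auto
  then show "(\<lambda>x. indicator {a<..<b} x *\<^sub>R \<phi> x) \<in> borel_measurable leb_I"
    by (intro borel_measurable_scaleR indicator_measurable_leb_I)
qed (auto simp: indicator_def)

lemma L2_cases:
  obtains f where "square_integrable f" "x = abs_L2 f"
  using Quotient_rep_reflp[OF Quotient_L2, of x] Quotient_abs_rep[OF Quotient_L2, of x]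
  by (metis L2_rel_def)

lemma L2_rel_refl: "L2_rel f f \<longleftrightarrow> square_integrable f"
  by (simp add: L2_rel_def)

lemma abs_L2_eq_iff:
  assumes "square_integrable f" "square_integrable g"
  shows "abs_L2 f = abs_L2 g \<longleftrightarrow> (AE x in leb_I. f x = g x)"
  using Quotient_rel[OF Quotient_L2, of f g] assms by (auto simp: L2_rel_def)

text \<open>
  The interval has five nodes \<open>c 0 < \<dots> < c 4\<close>. Indexing the four open pieces between them, the
  constants \<open>P i\<close> and the factors \<open>w i\<close> by \<open>i < 4\<close> makes one argument serve for all pieces.
\<close>

locale transmission_problem =
  fixes h p \<alpha> \<beta> \<beta>' :: "nat \<Rightarrow> real" and q :: "real \<Rightarrow> real" and \<theta> \<gamma> \<xi> \<rho> :: real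
  assumes h: "-1 < h 1" "h 1 < h 2" "h 2 < h 3" "h 3 < 1"
    and p: "p 1 \<noteq> 0" "p 2 \<noteq> 0" "p 3 \<noteq> 0" "p 4 \<noteq> 0"
    and q: "integrable (lebesgue_on (I_set h)) q"
    and \<theta>: "\<theta> = \<alpha> 3 * \<beta> 4 - \<beta> 3 * \<alpha> 4" "\<theta> > 0"
    and \<gamma>: "\<gamma> = \<alpha> 5 * \<beta> 6 - \<beta> 5 * \<alpha> 6" "\<gamma> > 0"
    and \<xi>: "\<xi> = \<alpha> 7 * \<beta> 8 - \<beta> 7 * \<alpha> 8" "\<xi> > 0"
    and \<rho>: "\<rho> = \<beta>' 1 * \<beta> 2 - \<beta> 1 * \<beta>' 2" "\<rho> > 0"
    and \<alpha>12: "\<bar>\<alpha> 1\<bar> + \<bar>\<alpha> 2\<bar> \<noteq> 0"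
begin

definition c :: "nat \<Rightarrow> real" where
  "c i = (if i = 0 then -1 else if i = 4 then 1 else h i)"

text \<open>The numbering of the constants \<open>p\<close> starts at 1, that of the pieces at 0.\<close>

definition P :: "nat \<Rightarrow> real" where "P i = (p (Suc i))\<^sup>2"

definition w :: "nat \<Rightarrow> real" where
  "w i = (if i = 0 then 1 else if i = 1 then 1 / \<theta> else if i = 2 then 1 / (\<theta> * \<gamma>) else 1 / (\<theta> * \<gamma> * \<xi>))"

abbreviation "\<tau> \<equiv> tau h p q"
abbreviation "ip_H1 \<equiv> inner_H1 h p \<theta> \<gamma> \<xi>"
abbreviation "ip_H \<equiv> inner_H h p \<theta> \<gamma> \<xi> \<rho>"

abbreviation piece :: "nat \<Rightarrow> real set" where "piece i \<equiv> {c i<..<c (Suc i)}"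

abbreviation weight :: "nat \<Rightarrow> real" where "weight i \<equiv> w i / P i"

lemma c_simps: "c 0 = -1" "c 1 = h 1" "c 2 = h 2" "c 3 = h 3" "c 4 = 1"
  "c (Suc 0) = h 1" "c (Suc 1) = h 2" "c (Suc 2) = h 3" "c (Suc 3) = 1"
  by (simp_all add: c_def numeral_eq_Suc)

lemma c_less: "i < 4 \<Longrightarrow> c i < c (Suc i)"
  using h all_less_4[of "\<lambda>i. c i < c (Suc i)"] by (simp only: c_simps) blast

lemma c_bounds: "i < 4 \<Longrightarrow> -1 \<le> c i" "i < 4 \<Longrightarrow> c (Suc i) \<le> 1"
proof -
  have "\<forall>i<4. -1 \<le> c i \<and> c (Suc i) \<le> 1"
    unfolding all_less_4 c_simps using h by auto
  then show "i < 4 \<Longrightarrow> -1 \<le> c i" "i < 4 \<Longrightarrow> c (Suc i) \<le> 1" by auto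
qed

lemma P_pos: "i < 4 \<Longrightarrow> P i > 0"
proof -
  have "P 0 = (p 1)\<^sup>2" "P 1 = (p 2)\<^sup>2" "P 2 = (p 3)\<^sup>2" "P 3 = (p 4)\<^sup>2"
    by (simp_all add: P_def numeral_eq_Suc)
  then have "\<forall>i<4. P i > 0" unfolding all_less_4 using p by simp
  then show "i < 4 \<Longrightarrow> P i > 0" by blast
qed

lemma w_pos: "w i > 0"
  using \<theta>(2) \<gamma>(2) \<xi>(2) by (simp add: w_def)

lemma weight_pos: "i < 4 \<Longrightarrow> weight i > 0"
  using P_pos w_pos by simp

lemma piece_cover:
  assumes "x \<in> {-1..1}" "x \<notin> c ` {..4}"
  shows "\<exists>i<4. x \<in> piece i"
proof (rule ccontr)
  assume "\<not> ?thesis"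
  then have "\<forall>i<4. x \<notin> piece i" by blast
  moreover have "x \<noteq> c 0" "x \<noteq> c 1" "x \<noteq> c 2" "x \<noteq> c 3" "x \<noteq> c 4" using assms(2) by auto
  ultimately show False using assms(1) unfolding all_less_4 c_simps by (auto simp: c_simps)
qed

lemma piece_disjoint:
  assumes "i < 4" "j < 4" "x \<in> piece i" "x \<in> piece j"
  shows "i = j"
proof -
  have "\<forall>i<4. \<forall>j<4. x \<in> piece i \<longrightarrow> x \<in> piece j \<longrightarrow> i = j"
    unfolding all_less_4 c_simps using h by auto
  then show ?thesis using assms by blast
qed

lemma AE_pieces:
  assumes "\<And>i. i < 4 \<Longrightarrow> \<exists>N. negligible N \<and> (\<forall>x\<in>piece i - N. Q x)"
  shows "AE x in leb_I. Q x"
proof -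
  obtain N where N: "\<And>i. i < 4 \<Longrightarrow> negligible (N i)" "\<And>i x. i < 4 \<Longrightarrow> x \<in> piece i - N i \<Longrightarrow> Q x"
    using assms by metis
  let ?N = "(\<Union>i<4. N i) \<union> c ` {..4}"
  have "negligible ?N" using N(1) by (intro negligible_Un negligible_Union) auto
  then have "?N \<in> null_sets lebesgue" by (simp add: negligible_iff_null_sets)
  then have "AE x in lebesgue. x \<notin> ?N" by (rule AE_not_in)
  then have "AE x in leb_I. x \<notin> ?N" by (intro AE_restrict_space_iff[THEN iffD2]) (auto elim: eventually_mono)
  then show ?thesis
  proof (rule AE_mp, intro AE_I2 impI)
    fix x assume "x \<in> space leb_I" and x: "x \<notin> ?N"
    then have "x \<in> {-1..1}" by simp
    then obtain i where "i < 4" "x \<in> piece i" using piece_cover[of x] x by auto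
    then show "Q x" using N(2)[of i x] x by auto
  qed
qed

lemma AE_leb_I_D:
  assumes "AE x in leb_I. Q x"
  obtains N where "negligible N" "\<And>i x. i < 4 \<Longrightarrow> x \<in> {c i..c (Suc i)} - N \<Longrightarrow> Q x"
proof -
  have "AE x in lebesgue. x \<in> {-1..1} \<longrightarrow> Q x"
    using assms by (subst (asm) AE_restrict_space_iff) auto
  then obtain N where N: "N \<in> null_sets lebesgue" "\<And>x. x \<notin> N \<Longrightarrow> x \<in> {-1..1} \<longrightarrow> Q x"
    unfolding completion.AE_iff_null_sets by auto
  show ?thesis
  proof (rule that[of N])
    show "negligible N" using N(1) by (simp add: negligible_iff_null_sets)
    fix i x assume "i < 4" "x \<in> {c i..c (Suc i)} - N"
    then show "Q x" using N(2)[of x] c_bounds[of i] by auto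
  qed
qed

definition piece_ip :: "nat \<Rightarrow> (real \<Rightarrow> complex) \<Rightarrow> (real \<Rightarrow> complex) \<Rightarrow> complex" where
  "piece_ip i f g = (LINT x:piece i|leb_I. f x * cnj (g x))"

lemma inner_H1_eq:
  assumes "square_integrable f" "square_integrable g"
  shows "ip_H1 (abs_L2 f) (abs_L2 g) = (\<Sum>i<4. of_real (weight i) * piece_ip i f g)"
proof -
  have P: "P 0 = (p 1)\<^sup>2" "P 1 = (p 2)\<^sup>2" "P 2 = (p 3)\<^sup>2" "P 3 = (p 4)\<^sup>2"
    by (simp_all add: P_def numeral_eq_Suc)
  have w: "w 0 = 1" "w 1 = 1 / \<theta>" "w 2 = 1 / (\<theta> * \<gamma>)" "w 3 = 1 / (\<theta> * \<gamma> * \<xi>)"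
    by (simp_all add: w_def)
  show ?thesis
    using assms unfolding sum_less_4 P w c_simps piece_ip_def
    by (subst inner_H1.abs_eq) (simp_all add: L2_rel_refl mult_ac)
qed

lemma piece_ip_add:
  assumes "square_integrable f" "square_integrable f'" "square_integrable g"
  shows "piece_ip i (\<lambda>x. f x + f' x) g = piece_ip i f g + piece_ip i f' g"
proof -
  have "piece_ip i (\<lambda>x. f x + f' x) g = (LINT x|leb_I. indicator (piece i) x *\<^sub>R (f x * cnj (g x)) + indicator (piece i) x *\<^sub>R (f' x * cnj (g x)))"
    unfolding piece_ip_def set_lebesgue_integral_def by (simp add: algebra_simps scaleR_add_right)
  also have "\<dots> = piece_ip i f g + piece_ip i f' g"
    unfolding piece_ip_def set_lebesgue_integral_def
    by (intro Bochner_Integration.integral_add integrable_indicator_mult square_integrable_product assms)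
  finally show ?thesis .
qed

lemma piece_ip_scale: "piece_ip i (\<lambda>x. k * f x) g = k * piece_ip i f g"
proof -
  have "piece_ip i (\<lambda>x. k * f x) g = (LINT x|leb_I. k * (indicator (piece i) x *\<^sub>R (f x * cnj (g x))))"
    unfolding piece_ip_def set_lebesgue_integral_def by (simp add: mult_ac)
  also have "\<dots> = k * piece_ip i f g"
    unfolding piece_ip_def set_lebesgue_integral_def by (rule integral_mult_right_zero)
  finally show ?thesis .
qed

lemma piece_ip_cnj: "cnj (piece_ip i f g) = piece_ip i g f"
  unfolding piece_ip_def set_lebesgue_integral_def
  by (subst Bochner_Integration.integral_cnj[symmetric]) (simp add: mult.commute)

lemma piece_ip_self: "piece_ip i f f = of_real (LINT x:piece i|leb_I. (cmod (f x))\<^sup>2)"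
  unfolding piece_ip_def set_lebesgue_integral_def
  by (subst integral_complex_of_real[symmetric])
    (simp only: real_scaleR_def of_real_mult complex_norm_square, simp only: scaleR_conv_of_real)

lemma sum_indicator_piece:
  fixes \<phi> :: "nat \<Rightarrow> 'a::real_vector"
  assumes i: "i < 4" and x: "x \<in> piece i"
  shows "(\<Sum>j<4. indicator (piece j) x *\<^sub>R \<phi> j) = \<phi> i"
proof -
  have "(\<Sum>j<4. indicator (piece j) x *\<^sub>R \<phi> j) = (\<Sum>j\<in>{i}. indicator (piece j) x *\<^sub>R \<phi> j)"
  proof (rule sum.mono_neutral_right)
    show "\<forall>j\<in>{..<4} - {i}. indicator (piece j) x *\<^sub>R \<phi> j = 0"
    proof
      fix j assume "j \<in> {..<4} - {i}"
      then have "x \<notin> piece j" using piece_disjoint[OF i _ x, of j] by blast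
      then show "indicator (piece j) x *\<^sub>R \<phi> j = 0" by simp
    qed
  qed (use i in auto)
  also have "\<dots> = indicator (piece i) x *\<^sub>R \<phi> i" by (subst sum.insert) auto
  finally show ?thesis using x by simp
qed

lemma sum_pieces:
  fixes \<phi> :: "real \<Rightarrow> real"
  assumes "integrable leb_I \<phi>"
  shows "(\<Sum>i<4. LINT x:piece i|leb_I. \<phi> x) = (LINT x|leb_I. \<phi> x)"
proof -
  have "(\<Sum>i<4. LINT x:piece i|leb_I. \<phi> x) = (LINT x|leb_I. (\<Sum>i<4. indicator (piece i) x *\<^sub>R \<phi> x))"
    unfolding set_lebesgue_integral_def
    by (rule Bochner_Integration.integral_sum[symmetric]) (intro integrable_indicator_mult assms)
  also have "\<dots> = (LINT x|leb_I. \<phi> x)"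
  proof (rule integral_cong_AE)
    show "(\<lambda>x. \<Sum>i<4. indicator (piece i) x *\<^sub>R \<phi> x) \<in> borel_measurable leb_I"
      using assms by (intro borel_measurable_sum borel_measurable_integrable integrable_indicator_mult)
    show "AE x in leb_I. (\<Sum>i<4. indicator (piece i) x *\<^sub>R \<phi> x) = \<phi> x"
    proof (rule AE_pieces)
      fix i :: nat assume i: "i < 4"
      have "(\<Sum>j<4. indicator (piece j) x *\<^sub>R \<phi> x) = \<phi> x" if "x \<in> piece i" for x
        by (rule sum_indicator_piece[OF i that])
      then show "\<exists>N. negligible N \<and> (\<forall>x\<in>piece i - N. (\<Sum>i<4. indicator (piece i) x *\<^sub>R \<phi> x) = \<phi> x)"
        by (intro exI[of _ "{}"]) auto
    qed
  qed (use assms in auto)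
  finally show ?thesis .
qed

text \<open>
  On each piece the weight is constant, so the norm of \<open>H\<^sub>1\<close> is equivalent to the unweighted one.
\<close>

lemma inner_H1_self:
  assumes "square_integrable f"
  defines "S \<equiv> (LINT x|leb_I. (cmod (f x))\<^sup>2)"
  shows "Im (ip_H1 (abs_L2 f) (abs_L2 f)) = 0"
    "Min (weight ` {..<4}) * S \<le> Re (ip_H1 (abs_L2 f) (abs_L2 f))"
    "Re (ip_H1 (abs_L2 f) (abs_L2 f)) \<le> Max (weight ` {..<4}) * S"
proof -
  let ?b = "\<lambda>i. LINT x:piece i|leb_I. (cmod (f x))\<^sup>2"
  have eq: "ip_H1 (abs_L2 f) (abs_L2 f) = of_real (\<Sum>i<4. weight i * ?b i)"
    unfolding inner_H1_eq[OF assms(1) assms(1)] piece_ip_self by simp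
  have S: "S = (\<Sum>i<4. ?b i)"
    unfolding S_def by (rule sum_pieces[symmetric]) (use assms in \<open>simp add: square_integrable_def\<close>)
  have b: "?b i \<ge> 0" for i
    unfolding set_lebesgue_integral_def by (rule Bochner_Integration.integral_nonneg) simp
  show "Im (ip_H1 (abs_L2 f) (abs_L2 f)) = 0" unfolding eq by simp
  show "Min (weight ` {..<4}) * S \<le> Re (ip_H1 (abs_L2 f) (abs_L2 f))"
    unfolding eq S sum_distrib_left Re_complex_of_real by (intro sum_mono mult_right_mono b) auto
  show "Re (ip_H1 (abs_L2 f) (abs_L2 f)) \<le> Max (weight ` {..<4}) * S"
    unfolding eq S sum_distrib_left Re_complex_of_real by (intro sum_mono mult_right_mono b) auto
qed

lemma Min_weight: "Min (weight ` {..<4}) > 0" "Max (weight ` {..<4}) > 0"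
proof -
  show "Min (weight ` {..<4}) > 0" using weight_pos by (subst Min_gr_iff) (auto simp: lessThan_empty_iff)
  show "Max (weight ` {..<4}) > 0" using weight_pos[of 0] by (subst Max_gr_iff) (auto simp: lessThan_empty_iff intro!: bexI[of _ 0])
qed

text \<open>
  Both the definiteness and the completeness of \<open>H\<close> come from the equivalence of the norms above,
  the latter together with the Riesz-Fischer theorem and the completeness of the complex numbers.
\<close>

sublocale complex_hilbert_space scale_H "ip_H"
proof (rule complex_hilbert_space.intro)
  let ?ip1 = "ip_H1" and ?\<kappa> = "1 / (\<rho> * \<theta> * \<gamma> * \<xi>)"
  have \<kappa>: "?\<kappa> > 0" using \<rho> \<theta> \<gamma> \<xi> by simp
  show "vector_space scale_H" by (rule vector_space_H)
  have add1: "?ip1 (x + y) z = ?ip1 x z + ?ip1 y z" for x y z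
  proof -
    obtain f g k where f: "square_integrable f" "x = abs_L2 f" and g: "square_integrable g" "y = abs_L2 g"
      and k: "square_integrable k" "z = abs_L2 k" using L2_cases by metis
    have "x + y = abs_L2 (\<lambda>t. f t + g t)" using f g by (simp add: plus_L2.abs_eq L2_rel_refl)
    then show ?thesis using f g k by (simp add: inner_H1_eq square_integrable_add piece_ip_add sum.distrib distrib_left)
  qed
  have scale1: "?ip1 (scale_L2 a x) z = a * ?ip1 x z" for a x z
  proof -
    obtain f k where f: "square_integrable f" "x = abs_L2 f" and k: "square_integrable k" "z = abs_L2 k" using L2_cases by metis
    have "scale_L2 a x = abs_L2 (\<lambda>t. a * f t)" using f by (simp add: scale_L2.abs_eq L2_rel_refl)
    then show ?thesis using f k by (simp add: inner_H1_eq square_integrable_scale piece_ip_scale sum_distrib_left mult_ac)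
  qed
  have cnj1: "cnj (?ip1 x z) = ?ip1 z x" for x z
  proof -
    obtain f k where f: "square_integrable f" "x = abs_L2 f" and k: "square_integrable k" "z = abs_L2 k" using L2_cases by metis
    then show ?thesis by (simp add: inner_H1_eq piece_ip_cnj)
  qed
  fix x y z :: "L2 \<times> complex" and a
  show "ip_H (x + y) z = ip_H x z + ip_H y z"
    unfolding inner_H_def fst_add snd_add add1 by (simp only: distrib_left distrib_right add_ac)
  show "ip_H (scale_H a x) y = a * ip_H x y"
    unfolding inner_H_def scale_H_def fst_conv snd_conv scale1 by (simp add: algebra_simps)
  show "cnj (ip_H x y) = ip_H y x"
    unfolding inner_H_def by (simp add: cnj1 mult_ac)
  have self: "Re (ip_H F F) = Re (?ip1 (fst F) (fst F)) + ?\<kappa> * (cmod (snd F))\<^sup>2" for F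
    unfolding inner_H_def complex_norm_square[symmetric] by (simp flip: of_real_mult)
  have L: "Min (weight ` {..<4}) * (LINT t|leb_I. (cmod (f t))\<^sup>2) + ?\<kappa> * (cmod k)\<^sup>2 \<le> Re (ip_H (abs_L2 f, k) (abs_L2 f, k))"
    if "square_integrable f" for f k
    unfolding self using inner_H1_self[OF that] by simp
  have int_nonneg: "0 \<le> (LINT t|leb_I. (cmod (f t))\<^sup>2)" for f :: "real \<Rightarrow> complex"
    by (rule Bochner_Integration.integral_nonneg) simp
  obtain f k where f: "square_integrable f" "x = (abs_L2 f, k)" using L2_cases by (metis surj_pair)
  note nn = mult_nonneg_nonneg[OF less_imp_le[OF Min_weight(1)] int_nonneg[of f]] mult_nonneg_nonneg[OF less_imp_le[OF \<kappa>] zero_le_power2[of "cmod k"]]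
  show "0 \<le> Re (ip_H x x)"
    using L[OF f(1), of k] nn unfolding f(2) by linarith
  show "x = 0" if "Re (ip_H x x) = 0"
  proof -
    have "Min (weight ` {..<4}) * (LINT t|leb_I. (cmod (f t))\<^sup>2) = 0" "?\<kappa> * (cmod k)\<^sup>2 = 0"
      using L[OF f(1), of k] nn that unfolding f(2) by linarith+
    then have "(LINT t|leb_I. (cmod (f t))\<^sup>2) = 0" "(cmod k)\<^sup>2 = 0"
      using Min_weight(1) \<kappa> by (metis less_irrefl mult_eq_0_iff)+
    then have "(LINT t|leb_I. (cmod (f t))\<^sup>2) = 0" and k: "k = 0" by simp_all
    then have "AE t in leb_I. (cmod (f t))\<^sup>2 = 0"
      using integral_nonneg_eq_0_iff_AE[of leb_I "\<lambda>t. (cmod (f t))\<^sup>2"] f(1) by (simp add: square_integrable_def)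
    then have "AE t in leb_I. f t = 0" by simp
    then have "abs_L2 f = abs_L2 (\<lambda>t. 0)" using f(1) square_integrable_zero by (subst abs_L2_eq_iff) auto
    then show ?thesis unfolding f(2) k by (simp add: zero_L2_def zero_prod_def)
  qed
next
  let ?\<kappa> = "1 / (\<rho> * \<theta> * \<gamma> * \<xi>)"
  have \<kappa>: "?\<kappa> > 0" using \<rho> \<theta> \<gamma> \<xi> by simp
  have self: "Re (ip_H F F) = Re (ip_H1 (fst F) (fst F)) + ?\<kappa> * (cmod (snd F))\<^sup>2" for F
    unfolding inner_H_def complex_norm_square[symmetric] by (simp flip: of_real_mult)
  have int_nonneg: "0 \<le> (LINT t|leb_I. (cmod (f t))\<^sup>2)" for f :: "real \<Rightarrow> complex"
    by (rule Bochner_Integration.integral_nonneg) simp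
  fix X :: "nat \<Rightarrow> L2 \<times> complex"
  assume Cau: "\<And>e. e > 0 \<Longrightarrow> \<exists>N. \<forall>m\<ge>N. \<forall>n\<ge>N. Re (ip_H (X m - X n) (X m - X n)) < e"
  have "\<exists>f k. square_integrable f \<and> X n = (abs_L2 f, k)" for n using L2_cases by (metis surj_pair)
  then obtain F K where F: "\<And>n. square_integrable (F n)" and X: "\<And>n. X n = (abs_L2 (F n), K n)" by metis
  have diff: "(abs_L2 f, k) - (abs_L2 g, l) = (abs_L2 (\<lambda>t. f t - g t), k - l)"
    if "square_integrable f" "square_integrable g" for f g k l
    using that by (simp add: minus_L2.abs_eq L2_rel_refl)
  let ?D = "\<lambda>m n. LINT t|leb_I. (cmod (F m t - F n t))\<^sup>2"
  let ?m = "Min (weight ` {..<4})" and ?M = "Max (weight ` {..<4})"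
  have lower: "?m * ?D m n + ?\<kappa> * (cmod (K m - K n))\<^sup>2 \<le> Re (ip_H (X m - X n) (X m - X n))" for m n
    unfolding X diff[OF F F] self fst_conv snd_conv
    using inner_H1_self(2)[OF square_integrable_diff[OF F F]] by simp
  have nn: "0 \<le> ?m * ?D m n" "0 \<le> ?\<kappa> * (cmod (K m - K n))\<^sup>2" for m n
    using Min_weight int_nonneg[of "\<lambda>t. F m t - F n t"] \<kappa> by (auto intro!: mult_nonneg_nonneg)
  obtain f where f: "square_integrable f" "(\<lambda>n. LINT x|leb_I. (cmod (F n x - f x))\<^sup>2) \<longlonglongrightarrow> 0"
  proof (rule Riesz_Fischer[of F])
    fix e :: real assume "e > 0"
    then have "?m * e > 0" using Min_weight by simp
    from Cau[OF this] obtain N where N: "\<And>m n. m \<ge> N \<Longrightarrow> n \<ge> N \<Longrightarrow> Re (ip_H (X m - X n) (X m - X n)) < ?m * e"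
      by blast
    have "?D m n < e" if "m \<ge> N" "n \<ge> N" for m n
    proof -
      have "?m * ?D m n < ?m * e" using N[OF that] lower[of m n] nn[of m n] by linarith
      then show ?thesis using Min_weight(1) by simp
    qed
    then show "\<exists>N. \<forall>m\<ge>N. \<forall>n\<ge>N. ?D m n < e" by blast
  qed (rule F)
  have "Cauchy K"
  proof (rule CauchyI)
    fix e :: real assume "e > 0"
    then have "?\<kappa> * e\<^sup>2 > 0" using \<kappa> by (intro mult_pos_pos) auto
    from Cau[OF this] obtain N where N: "\<And>m n. m \<ge> N \<Longrightarrow> n \<ge> N \<Longrightarrow> Re (ip_H (X m - X n) (X m - X n)) < ?\<kappa> * e\<^sup>2"
      by blast
    have "norm (K m - K n) < e" if "m \<ge> N" "n \<ge> N" for m n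
    proof -
      have "?\<kappa> * (cmod (K m - K n))\<^sup>2 < ?\<kappa> * e\<^sup>2" using N[OF that] lower[of m n] nn[of m n] by linarith
      then have "(cmod (K m - K n))\<^sup>2 < e\<^sup>2" using \<kappa> by (simp only: mult_less_cancel_left_pos)
      then show ?thesis using \<open>e > 0\<close> by (intro power2_less_imp_less[of _ e]) auto
    qed
    then show "\<exists>M. \<forall>m\<ge>M. \<forall>n\<ge>M. norm (K m - K n) < e" by blast
  qed
  then obtain k where k: "K \<longlonglongrightarrow> k" using Cauchy_convergent_iff convergent_def by blast
  show "\<exists>x. (\<lambda>n. Re (ip_H (X n - x) (X n - x))) \<longlonglongrightarrow> 0"
  proof (rule exI[of _ "(abs_L2 f, k)"], rule tendsto_sandwich[of "\<lambda>_. 0" _ _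
      "\<lambda>n. ?M * (LINT x|leb_I. (cmod (F n x - f x))\<^sup>2) + ?\<kappa> * (cmod (K n - k))\<^sup>2"])
    have "(\<lambda>n. ?M * (LINT x|leb_I. (cmod (F n x - f x))\<^sup>2) + ?\<kappa> * (cmod (K n - k))\<^sup>2) \<longlonglongrightarrow> ?M * 0 + ?\<kappa> * (cmod (k - k))\<^sup>2"
      by (intro tendsto_intros f(2) k)
    then show "(\<lambda>n. ?M * (LINT x|leb_I. (cmod (F n x - f x))\<^sup>2) + ?\<kappa> * (cmod (K n - k))\<^sup>2) \<longlonglongrightarrow> 0" by simp
    note s = inner_H1_self[OF square_integrable_diff[OF F f(1)]]
    show "eventually (\<lambda>n. Re (ip_H (X n - (abs_L2 f, k)) (X n - (abs_L2 f, k))) \<le>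
        ?M * (LINT x|leb_I. (cmod (F n x - f x))\<^sup>2) + ?\<kappa> * (cmod (K n - k))\<^sup>2) sequentially"
      unfolding X diff[OF F f(1)] self fst_conv snd_conv using s(3) by (intro always_eventually allI) simp
    show "eventually (\<lambda>n. 0 \<le> Re (ip_H (X n - (abs_L2 f, k)) (X n - (abs_L2 f, k)))) sequentially"
    proof (intro always_eventually allI)
      fix n
      have "0 \<le> ?m * (LINT x|leb_I. (cmod (F n x - f x))\<^sup>2)" using Min_weight(1) int_nonneg by (intro mult_nonneg_nonneg) auto
      moreover have "0 \<le> ?\<kappa> * (cmod (K n - k))\<^sup>2" using \<kappa> by (intro mult_nonneg_nonneg) auto
      ultimately show "0 \<le> Re (ip_H (X n - (abs_L2 f, k)) (X n - (abs_L2 f, k)))"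
        unfolding X diff[OF F f(1)] self fst_conv snd_conv using s(2)[of n] by linarith
    qed
  qed simp
qed

end

section \<open>Functions in the domain\<close>

lemma W21_lincomb:
  assumes u: "W21 a b u u1 u2" and v: "W21 a b v v1 v2"
  shows "W21 a b (\<lambda>x. k * u x + l * v x) (\<lambda>x. k * u1 x + l * v1 x) (\<lambda>x. k * u2 x + l * v2 x)"
  unfolding W21_def
proof (intro conjI ballI)
  note ca = absolutely_integrable_continuous_real
  have u1: "u1 integrable_on {a..b}" "v1 integrable_on {a..b}"
    by (intro integrable_continuous_real W21_absolutely_continuous[OF u] W21_absolutely_continuous[OF v])+
  show "(\<lambda>x. k * u2 x + l * v2 x) absolutely_integrable_on {a..b}"
    using W21D(1)[OF u] W21D(1)[OF v] by (intro set_integral_add(1) set_integrable_mult_right) auto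
  have u2: "u2 integrable_on {a..b}" "v2 integrable_on {a..b}"
    using W21D(1)[OF u] W21D(1)[OF v] by (auto intro: set_lebesgue_integral_eq_integral(1))
  fix x assume x: "x \<in> {a..b}"
  have lin: "integral {a..x} (\<lambda>x. k * f x + l * g x) = k * integral {a..x} f + l * integral {a..x} g"
    if "f integrable_on {a..b}" "g integrable_on {a..b}" for f g :: "real \<Rightarrow> complex"
  proof -
    have sub: "{a..x} \<subseteq> {a..b}" using x by auto
    show ?thesis
      by (subst integral_add) (auto intro!: integrable_on_mult_right integrable_subinterval_real[OF that(1) sub] integrable_subinterval_real[OF that(2) sub])
  qed
  show "k * u1 x + l * v1 x = k * u1 a + l * v1 a + integral {a..x} (\<lambda>x. k * u2 x + l * v2 x)"
    unfolding lin[OF u2] using W21D(2)[OF u x] W21D(2)[OF v x] by (simp add: algebra_simps)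
  show "k * u x + l * v x = k * u a + l * v a + integral {a..x} (\<lambda>x. k * u1 x + l * v1 x)"
    unfolding lin[OF u1] using W21D(3)[OF u x] W21D(3)[OF v x] by (simp add: algebra_simps)
qed

lemma W21_cnj:
  assumes u: "W21 a b u u1 u2"
  shows "W21 a b (\<lambda>x. cnj (u x)) (\<lambda>x. cnj (u1 x)) (\<lambda>x. cnj (u2 x))"
  unfolding W21_def
proof (intro conjI ballI)
  show "(\<lambda>x. cnj (u2 x)) absolutely_integrable_on {a..b}"
    using absolutely_integrable_linear[OF W21D(1)[OF u] bounded_linear_cnj] by (simp add: o_def)
  fix x assume x: "x \<in> {a..b}"
  show "cnj (u1 x) = cnj (u1 a) + integral {a..x} (\<lambda>x. cnj (u2 x))"
    unfolding Henstock_Kurzweil_Integration.integral_cnj[symmetric] complex_cnj_add[symmetric]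
    using W21D(2)[OF u x] by (rule arg_cong)
  show "cnj (u x) = cnj (u a) + integral {a..x} (\<lambda>x. cnj (u1 x))"
    unfolding Henstock_Kurzweil_Integration.integral_cnj[symmetric] complex_cnj_add[symmetric]
    using W21D(3)[OF u x] by (rule arg_cong)
qed

text \<open>Lebesgue measure is complete, so measurability passes to functions that agree almost everywhere.\<close>

lemma square_integrable_cong_AE:
  assumes g: "square_integrable g" and eq: "AE x in leb_I. f x = g x"
  shows "square_integrable f"
proof -
  have S: "{-1..1} \<inter> space lebesgue \<in> sets (lebesgue :: real measure)" by simp
  have "(\<lambda>x. if x \<in> {-1..1} then g x else 0) \<in> borel_measurable lebesgue"
    using g by (subst borel_measurable_if) (auto simp: square_integrable_def)
  moreover have "AE x in lebesgue. (if x \<in> {-1..1} then g x else 0) = (if x \<in> {-1..1} then f x else 0)"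
    using eq by (subst (asm) AE_restrict_space_iff) (auto elim!: eventually_mono)
  ultimately have "(\<lambda>x. if x \<in> {-1..1} then f x else 0) \<in> borel_measurable lebesgue"
    by (rule borel_measurable_AE)
  then have m [measurable]: "f \<in> borel_measurable leb_I" by (subst (asm) borel_measurable_if) auto
  have [measurable]: "g \<in> borel_measurable leb_I" using g by (simp add: square_integrable_def)
  have "integrable leb_I (\<lambda>x. (cmod (f x))\<^sup>2) \<longleftrightarrow> integrable leb_I (\<lambda>x. (cmod (g x))\<^sup>2)"
    by (rule integrable_cong_AE) (use eq in \<open>auto elim!: eventually_mono\<close>)
  then show ?thesis using g m by (simp add: square_integrable_def)
qed

context transmission_problem
begin

lemma LINT_piece_eq_integral:
  fixes \<phi> :: "real \<Rightarrow> complex"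
  assumes \<phi>: "integrable leb_I \<phi>" and i: "i < 4"
  shows "(LINT x:piece i|leb_I. \<phi> x) = integral {c i..c (Suc i)} \<phi>" "\<phi> absolutely_integrable_on {c i..c (Suc i)}"
proof -
  have "set_integrable lebesgue {-1..1} \<phi>"
    using \<phi> unfolding set_integrable_def by (subst (asm) integrable_restrict_space) auto
  then have a: "\<phi> absolutely_integrable_on {-1..1}" .
  then show ac: "\<phi> absolutely_integrable_on {c i..c (Suc i)}"
    by (rule set_integrable_subset) (use c_bounds[OF i] in auto)
  have ao: "\<phi> absolutely_integrable_on piece i"
    by (rule set_integrable_subset[OF ac]) auto
  have sub: "piece i \<subseteq> {-1..1}" using c_bounds[OF i] by auto
  have "(LINT x:piece i|leb_I. \<phi> x) = (LINT x|lebesgue. indicator {-1..1} x *\<^sub>R (indicator (piece i) x *\<^sub>R \<phi> x))"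
    unfolding set_lebesgue_integral_def by (subst integral_restrict_space) auto
  also have "\<dots> = (LINT x:piece i|lebesgue. \<phi> x)"
    unfolding set_lebesgue_integral_def using sub
    by (intro Bochner_Integration.integral_cong) (auto simp: indicator_def)
  also have "\<dots> = integral (piece i) \<phi>" using ao by (rule set_lebesgue_integral_eq_integral(2))
  also have "\<dots> = integral {c i..c (Suc i)} \<phi>" by (rule integral_open_interval_real[symmetric])
  finally show "(LINT x:piece i|leb_I. \<phi> x) = integral {c i..c (Suc i)} \<phi>" .
qed

lemma piece_I_set: "i < 4 \<Longrightarrow> piece i \<subseteq> I_set h"
proof -
  have "\<forall>i<4. piece i \<subseteq> I_set h" unfolding all_less_4 c_simps I_set_def by auto
  then show "i < 4 \<Longrightarrow> piece i \<subseteq> I_set h" by blast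
qed

lemma q_integrable: "i < 4 \<Longrightarrow> (\<lambda>x. complex_of_real (q x)) absolutely_integrable_on {c i..c (Suc i)}"
proof -
  assume i: "i < 4"
  have "I_set h \<in> sets lebesgue" unfolding I_set_def by auto
  then have "q absolutely_integrable_on I_set h"
    using q unfolding set_integrable_def by (subst (asm) integrable_restrict_space) auto
  then have "q absolutely_integrable_on piece i"
    by (rule set_integrable_subset) (use piece_I_set[OF i] in auto)
  then have "q absolutely_integrable_on {c i..c (Suc i)}"
    using absolutely_integrable_on_open_interval[where f = q and a = "c i" and b = "c (Suc i)"] by simp
  from absolutely_integrable_linear[OF this bounded_linear_of_real] show ?thesis by (simp add: o_def)
qed

lemma p_fun_piece: "i < 4 \<Longrightarrow> x \<in> piece i \<Longrightarrow> p_fun h p x = P i"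
proof -
  have "P 0 = (p 1)\<^sup>2" "P 1 = (p 2)\<^sup>2" "P 2 = (p 3)\<^sup>2" "P 3 = (p 4)\<^sup>2"
    by (simp_all add: P_def numeral_eq_Suc)
  then have "\<forall>i<4. \<forall>x. x \<in> piece i \<longrightarrow> p_fun h p x = P i"
    unfolding all_less_4 c_simps p_fun_def using h by auto
  then show "i < 4 \<Longrightarrow> x \<in> piece i \<Longrightarrow> p_fun h p x = P i" by blast
qed

text \<open>
  The functions \<open>u i\<close> and \<open>u1 i\<close> are \<open>f\<close> and \<open>f'\<close> on the \<open>i\<close>-th piece, continued to its end points, and
  \<open>u2 i\<close> is \<open>f''\<close> almost everywhere. One-sided limits of \<open>f\<close> and \<open>f'\<close> thus become values of \<open>u i\<close> and \<open>u1 i\<close>.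
\<close>

definition represents :: "(real \<Rightarrow> complex) \<Rightarrow> (nat \<Rightarrow> real \<Rightarrow> complex) \<Rightarrow> (nat \<Rightarrow> real \<Rightarrow> complex) \<Rightarrow>
    (nat \<Rightarrow> real \<Rightarrow> complex) \<Rightarrow> bool" where
  "represents f u u1 u2 \<longleftrightarrow> (\<forall>i<4. W21 (c i) (c (Suc i)) (u i) (u1 i) (u2 i) \<and> (\<forall>x\<in>piece i. f x = u i x))"

lemma representsD:
  assumes "represents f u u1 u2" "i < 4"
  shows "W21 (c i) (c (Suc i)) (u i) (u1 i) (u2 i)" "\<And>x. x \<in> piece i \<Longrightarrow> f x = u i x"
  using assms by (auto simp: represents_def)

lemma tau_piece:
  assumes "i < 4" "x \<in> piece i" "(D1 f has_vector_derivative d) (at x)"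
  shows "\<tau> f x = - of_real (P i) * d + of_real (q x) * f x"
proof -
  have "((\<lambda>y. of_real (P i) * D1 f y) has_vector_derivative of_real (P i) * d) (at x)"
    using assms(3) by (rule has_vector_derivative_mult_right)
  then have "D1 (\<lambda>y. of_real (p_fun h p y) * D1 f y) x = of_real (P i) * d"
    by (intro D1_cong_open(2)[of "piece i" _ _ "\<lambda>y. of_real (P i) * D1 f y"]) (use assms p_fun_piece in auto)
  then show ?thesis by (simp add: tau_def)
qed

lemma represents_tau:
  assumes r: "represents f u u1 u2" and i: "i < 4"
  obtains N where "negligible N"
    "\<And>x. x \<in> piece i - N \<Longrightarrow> \<tau> f x = - of_real (P i) * u2 i x + of_real (q x) * u i x"
proof -
  note W = representsD[OF r i]
  obtain N where N: "negligible N" "\<And>x. x \<in> piece i - N \<Longrightarrow> (u1 i has_vector_derivative u2 i x) (at x)"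
    using W21_has_second_derivative_AE[OF W(1)] by blast
  show ?thesis
  proof (rule that[OF N(1)])
    fix x assume x: "x \<in> piece i - N"
    have "(D1 f has_vector_derivative u2 i x) (at x)"
    proof (rule D1_cong_open(1)[of "piece i"])
      show "D1 f y = u1 i y" if "y \<in> piece i" for y
        using W21_regular(2)[OF W(1) c_less[OF i] W(2) that] .
      show "(u1 i has_vector_derivative u2 i x) (at x)" by (rule N(2)[OF x])
    qed (use x in auto)
    from tau_piece[OF i _ this] show "\<tau> f x = - of_real (P i) * u2 i x + of_real (q x) * u i x"
      using x W(2)[of x] by simp
  qed
qed

lemma dom_A_regular: "f \<in> dom_A h p q \<alpha> \<beta> \<Longrightarrow> i < 4 \<Longrightarrow> regular_on (piece i) f"
proof -
  assume "f \<in> dom_A h p q \<alpha> \<beta>"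
  then have "\<forall>i<4. regular_on (piece i) f" unfolding all_less_4 c_simps dom_A_def by (auto simp: c_simps)
  then show "i < 4 \<Longrightarrow> regular_on (piece i) f" by blast
qed

text \<open>
  On the \<open>i\<close>-th piece \<open>f\<close> solves \<open>f'' = (q / P i) f - (\<tau> f) / P i\<close>, whose coefficients are integrable.
\<close>

lemma dom_A_represents:
  assumes f: "f \<in> dom_A h p q \<alpha> \<beta>"
  obtains u u1 u2 where "represents f u u1 u2"
proof -
  have ex: "\<exists>u u1 u2. W21 (c i) (c (Suc i)) u u1 u2 \<and> (\<forall>x\<in>piece i. f x = u x)" if i: "i < 4" for i
  proof -
    let ?a = "inverse (complex_of_real (P i))"
    have P: "P i \<noteq> 0" using P_pos[OF i] by simp
    have t: "\<tau> f absolutely_integrable_on {c i..c (Suc i)}"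
      using f i by (intro LINT_piece_eq_integral(2) square_integrable_imp_integrable) (simp_all add: dom_A_def)
    have r: "(\<lambda>x. ?a * of_real (q x)) absolutely_integrable_on {c i..c (Suc i)}"
      using q_integrable[OF i] by (intro set_integrable_mult_right) auto
    have g: "(\<lambda>x. - ?a * \<tau> f x) absolutely_integrable_on {c i..c (Suc i)}"
      using t by (intro set_integrable_mult_right) auto
    have "\<forall>x\<in>piece i. D1 f differentiable (at x) \<longrightarrow> D1 (D1 f) x = ?a * of_real (q x) * f x + - ?a * \<tau> f x"
    proof (intro ballI impI)
      fix x assume x: "x \<in> piece i" "D1 f differentiable (at x)"
      then have "(D1 f has_vector_derivative D1 (D1 f) x) (at x)" by (simp add: vector_derivative_works)
      from tau_piece[OF i x(1) this] show "D1 (D1 f) x = ?a * of_real (q x) * f x + - ?a * \<tau> f x"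
        using P by (simp add: field_simps)
    qed
    from regular_solution_extends[OF r g c_less[OF i] dom_A_regular[OF f i] this]
    show ?thesis by metis
  qed
  then obtain u u1 u2 where "\<And>i. i < 4 \<Longrightarrow> W21 (c i) (c (Suc i)) (u i) (u1 i) (u2 i) \<and> (\<forall>x\<in>piece i. f x = u i x)"
    by metis
  then have "represents f u u1 u2" by (simp add: represents_def)
  then show ?thesis by (rule that)
qed

abbreviation "in_dom \<equiv> dom_A h p q \<alpha> \<beta>"

text \<open>
  The conditions at the node \<open>c (i + 1)\<close>: their coefficients have the indices \<open>2 i + 3\<close> (for \<open>u\<close>) and
  \<open>2 i + 4\<close> (for \<open>u'\<close>).
\<close>

abbreviation "transmits u u1 i \<equiv>
    u (Suc i) (c (Suc i)) = of_real (\<alpha> (2*i+3)) * u i (c (Suc i)) + of_real (\<beta> (2*i+3)) * u1 i (c (Suc i)) \<and>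
    u1 (Suc i) (c (Suc i)) = of_real (\<alpha> (2*i+4)) * u i (c (Suc i)) + of_real (\<beta> (2*i+4)) * u1 i (c (Suc i))"

definition boundary_conditions ::
    "(nat \<Rightarrow> real \<Rightarrow> complex) \<Rightarrow> (nat \<Rightarrow> real \<Rightarrow> complex) \<Rightarrow> bool" where
  "boundary_conditions u u1 \<longleftrightarrow>
    of_real (\<alpha> 1) * u 0 (-1) + of_real (\<alpha> 2) * u1 0 (-1) = 0 \<and> (\<forall>i<3. transmits u u1 i)"

lemma represents_limits:
  assumes "represents f u u1 u2" "i < 4"
  shows "Rlim f (c i) = u i (c i)" "Llim f (c (Suc i)) = u i (c (Suc i))"
    "Rlim (D1 f) (c i) = u1 i (c i)" "Llim (D1 f) (c (Suc i)) = u1 i (c (Suc i))"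
    "regular_on (piece i) f"
  using W21_regular[OF representsD(1)[OF assms] c_less[OF assms(2)] representsD(2)[OF assms]] by auto

lemma represents_dom_iff:
  assumes r: "represents f u u1 u2"
  shows "f \<in> in_dom \<longleftrightarrow> square_integrable f \<and> square_integrable (\<tau> f) \<and> boundary_conditions u u1"
    "bN b1 b2 f = of_real b1 * u 3 1 - of_real b2 * u1 3 1"
proof -
  have 4: "(0::nat) < 4" "(1::nat) < 4" "(2::nat) < 4" "(3::nat) < 4" by auto
  have R: "regular_on {-1<..<h 1} f" "regular_on {h 1<..<h 2} f" "regular_on {h 2<..<h 3} f" "regular_on {h 3<..<1} f"
    using represents_limits(5)[OF r 4(1)] represents_limits(5)[OF r 4(2)] represents_limits(5)[OF r 4(3)] represents_limits(5)[OF r 4(4)]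
    unfolding c_simps by (simp_all add: c_simps)
  have s: "Suc 0 = 1" "Suc 1 = 2" "Suc 2 = 3" "Suc 3 = 4" by simp_all
  note l0 = represents_limits(1-4)[OF r 4(1), unfolded c_simps s]
  note l1 = represents_limits(1-4)[OF r 4(2), unfolded c_simps s]
  note l2 = represents_limits(1-4)[OF r 4(3), unfolded c_simps s]
  note l3 = represents_limits(1-4)[OF r 4(4), unfolded c_simps s]
  have n: "2*0+3 = (3::nat)" "2*0+4 = (4::nat)" "2*1+3 = (5::nat)" "2*1+4 = (6::nat)" "2*2+3 = (7::nat)" "2*2+4 = (8::nat)"
    by simp_all
  show "f \<in> in_dom \<longleftrightarrow> square_integrable f \<and> square_integrable (\<tau> f) \<and> boundary_conditions u u1"
    unfolding dom_A_def mem_Collect_eq tau1_def jump0_def jump1_def boundary_conditions_def all_less_3 l0 l1 l2 l3 n c_simps s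
    using R by (auto simp: algebra_simps)
  show "bN b1 b2 f = of_real b1 * u 3 1 - of_real b2 * u1 3 1"
    unfolding bN_def l3 ..
qed

lemma represents_lincomb:
  assumes "represents f u u1 u2" "represents g v v1 v2"
  shows "represents (\<lambda>x. k * f x + l * g x) (\<lambda>i x. k * u i x + l * v i x) (\<lambda>i x. k * u1 i x + l * v1 i x)
    (\<lambda>i x. k * u2 i x + l * v2 i x)"
  using assms W21_lincomb unfolding represents_def by auto

lemma boundary_conditions_lincomb:
  assumes "boundary_conditions u u1" "boundary_conditions v v1"
  shows "boundary_conditions (\<lambda>i x. k * u i x + l * v i x) (\<lambda>i x. k * u1 i x + l * v1 i x)"
proof -
  have 1: "of_real (\<alpha> 1) * (k * u 0 (-1) + l * v 0 (-1)) + of_real (\<alpha> 2) * (k * u1 0 (-1) + l * v1 0 (-1)) =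
    k * (of_real (\<alpha> 1) * u 0 (-1) + of_real (\<alpha> 2) * u1 0 (-1)) + l * (of_real (\<alpha> 1) * v 0 (-1) + of_real (\<alpha> 2) * v1 0 (-1))"
    by (simp add: algebra_simps)
  show ?thesis using assms unfolding boundary_conditions_def 1 by (auto simp: algebra_simps)
qed

lemma tau_lincomb:
  assumes r: "represents f u u1 u2" and s: "represents g v v1 v2"
  shows "AE x in leb_I. \<tau> (\<lambda>x. k * f x + l * g x) x = k * \<tau> f x + l * \<tau> g x"
proof (rule AE_pieces)
  fix i :: nat assume i: "i < 4"
  obtain N1 where N1: "negligible N1" "\<And>x. x \<in> piece i - N1 \<Longrightarrow> \<tau> f x = - of_real (P i) * u2 i x + of_real (q x) * u i x"
    using represents_tau[OF r i] by blast
  obtain N2 where N2: "negligible N2" "\<And>x. x \<in> piece i - N2 \<Longrightarrow> \<tau> g x = - of_real (P i) * v2 i x + of_real (q x) * v i x"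
    using represents_tau[OF s i] by blast
  obtain N3 where N3: "negligible N3" "\<And>x. x \<in> piece i - N3 \<Longrightarrow> \<tau> (\<lambda>x. k * f x + l * g x) x =
      - of_real (P i) * (k * u2 i x + l * v2 i x) + of_real (q x) * (k * u i x + l * v i x)"
    using represents_tau[OF represents_lincomb[OF r s] i] by blast
  show "\<exists>N. negligible N \<and> (\<forall>x\<in>piece i - N. \<tau> (\<lambda>x. k * f x + l * g x) x = k * \<tau> f x + l * \<tau> g x)"
  proof (intro exI[of _ "N1 \<union> N2 \<union> N3"] conjI ballI)
    show "negligible (N1 \<union> N2 \<union> N3)" using N1 N2 N3 by (intro negligible_Un)
    fix x assume x: "x \<in> piece i - (N1 \<union> N2 \<union> N3)"
    show "\<tau> (\<lambda>x. k * f x + l * g x) x = k * \<tau> f x + l * \<tau> g x"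
    proof -
      have e: "x \<in> piece i - N1" "x \<in> piece i - N2" "x \<in> piece i - N3" using x by blast+
      show ?thesis unfolding N1(2)[OF e(1)] N2(2)[OF e(2)] N3(2)[OF e(3)] by (simp add: algebra_simps)
    qed
  qed
qed

lemma dom_A_square_integrable:
  "f \<in> in_dom \<Longrightarrow> square_integrable f" "f \<in> in_dom \<Longrightarrow> square_integrable (\<tau> f)"
  by (auto simp: dom_A_def)

lemma dom_lincomb:
  assumes f: "f \<in> in_dom" and g: "g \<in> in_dom"
  shows "(\<lambda>x. k * f x + l * g x) \<in> in_dom"
    "AE x in leb_I. \<tau> (\<lambda>x. k * f x + l * g x) x = k * \<tau> f x + l * \<tau> g x"
    "bN b1 b2 (\<lambda>x. k * f x + l * g x) = k * bN b1 b2 f + l * bN b1 b2 g"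
proof -
  obtain u u1 u2 where r: "represents f u u1 u2" using dom_A_represents[OF f] .
  obtain v v1 v2 where s: "represents g v v1 v2" using dom_A_represents[OF g] .
  note rs = represents_lincomb[OF r s, of k l]
  show t: "AE x in leb_I. \<tau> (\<lambda>x. k * f x + l * g x) x = k * \<tau> f x + l * \<tau> g x"
    by (rule tau_lincomb[OF r s])
  have "square_integrable (\<tau> (\<lambda>x. k * f x + l * g x))"
    by (rule square_integrable_cong_AE[OF _ t])
      (intro square_integrable_add square_integrable_scale dom_A_square_integrable f g)
  moreover have "square_integrable (\<lambda>x. k * f x + l * g x)"
    by (intro square_integrable_add square_integrable_scale dom_A_square_integrable f g)
  moreover have "boundary_conditions (\<lambda>i x. k * u i x + l * v i x) (\<lambda>i x. k * u1 i x + l * v1 i x)"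
    using f g represents_dom_iff(1)[OF r] represents_dom_iff(1)[OF s] by (intro boundary_conditions_lincomb) auto
  ultimately show "(\<lambda>x. k * f x + l * g x) \<in> in_dom" using represents_dom_iff(1)[OF rs] by blast
  show "bN b1 b2 (\<lambda>x. k * f x + l * g x) = k * bN b1 b2 f + l * bN b1 b2 g"
    unfolding represents_dom_iff(2)[OF rs] represents_dom_iff(2)[OF r] represents_dom_iff(2)[OF s] by (simp add: algebra_simps)
qed

end

section \<open>Linearity and symmetry\<close>

lemma continuous_eq_0_if_AE:
  fixes u :: "real \<Rightarrow> complex"
  assumes "a < b" "continuous_on {a..b} u" "negligible N" "\<And>x. x \<in> {a<..<b} - N \<Longrightarrow> u x = 0" "x \<in> {a..b}"
  shows "u x = 0"
proof -
  have "interior N = {}"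
    using open_not_negligible[of "interior N"] assms(3) interior_subset negligible_subset by blast
  then have N: "closure (- N) = UNIV" by (simp add: closure_complement)
  have "{a<..<b} \<inter> closure (- N) \<subseteq> closure ({a<..<b} \<inter> - N)"
    by (rule open_Int_closure_subset) simp
  then have "closure {a<..<b} \<subseteq> closure ({a<..<b} - N)"
    unfolding N by (metis Diff_eq closure_mono closure_closure inf_top_right)
  moreover have "closure ({a<..<b} - N) \<subseteq> closure {a<..<b}" by (intro closure_mono) auto
  ultimately have "closure ({a<..<b} - N) = {a..b}" using assms(1) by simp
  then show ?thesis
    using continuous_constant_on_closure[of "{a<..<b} - N" u 0 x] assms by simp
qed

context transmission_problem
begin

lemma represents_AE_zero:
  assumes r: "represents f u u1 u2" and z: "AE x in leb_I. f x = 0" and i: "i < 4" and x: "x \<in> {c i..c (Suc i)}"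
  shows "u i x = 0" "u1 i x = 0"
proof -
  obtain N where N: "negligible N" "\<And>i x. i < 4 \<Longrightarrow> x \<in> {c i..c (Suc i)} - N \<Longrightarrow> f x = 0"
    using AE_leb_I_D[OF z] by blast
  note W = representsD[OF r i] and ci = c_less[OF i]
  have u0: "u i y = 0" if "y \<in> {c i..c (Suc i)}" for y
  proof (rule continuous_eq_0_if_AE[OF ci W21_absolutely_continuous(4)[OF W(1)] N(1) _ that])
    fix y assume "y \<in> piece i - N"
    then show "u i y = 0" using N(2)[OF i, of y] W(2)[of y] by auto
  qed
  then show "u i x = 0" using x by blast
  show "u1 i x = 0"
  proof (rule continuous_eq_0_if_AE[OF ci W21_absolutely_continuous(3)[OF W(1)] negligible_empty _ x])
    fix y assume y: "y \<in> piece i - {}"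
    show "u1 i y = 0"
    proof (rule vector_derivative_unique_at)
      show "(u i has_vector_derivative u1 i y) (at y)" using W21_has_derivative[OF W(1)] y by simp
      show "(u i has_vector_derivative 0) (at y)"
        by (rule D1_cong_open(1)[of "piece i" y _ "\<lambda>_. 0"]) (use y u0 in auto)
    qed
  qed
qed

text \<open>This makes the operator well defined on classes modulo equality almost everywhere.\<close>

lemma dom_AE_zero:
  assumes f: "f \<in> in_dom" and z: "AE x in leb_I. f x = 0"
  shows "AE x in leb_I. \<tau> f x = 0" "bN b1 b2 f = 0"
proof -
  obtain u u1 u2 where r: "represents f u u1 u2" using dom_A_represents[OF f] .
  note zero = represents_AE_zero[OF r z]
  have r0: "represents f (\<lambda>_ _. 0) (\<lambda>_ _. 0) (\<lambda>_ _. 0)"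
    unfolding represents_def
  proof (intro allI impI conjI ballI)
    fix i :: nat assume i: "i < 4"
    show "W21 (c i) (c (Suc i)) (\<lambda>_. 0) (\<lambda>_. 0) (\<lambda>_. 0)"
      by (simp add: W21_def absolutely_integrable_on_def)
    fix x assume x: "x \<in> piece i"
    then show "f x = 0" using representsD(2)[OF r i x] zero(1)[OF i, of x] by auto
  qed
  show "AE x in leb_I. \<tau> f x = 0"
  proof (rule AE_pieces)
    fix i :: nat assume "i < 4"
    then show "\<exists>N. negligible N \<and> (\<forall>x\<in>piece i - N. \<tau> f x = 0)"
      using represents_tau[OF r0] by (metis add_0 mult_zero_right)
  qed
  show "bN b1 b2 f = 0" unfolding represents_dom_iff(2)[OF r0] by simp
qed

abbreviation "A \<equiv> op_A h p q \<alpha> \<beta> \<beta>'"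

lemma op_A_cases:
  assumes "(F, AF) \<in> A"
  obtains f where "f \<in> in_dom" "F = (abs_L2 f, bN (\<beta>' 1) (\<beta>' 2) f)"
    "AF = (abs_L2 (\<tau> f), - bN (\<beta> 1) (\<beta> 2) f)"
  using assms unfolding op_A_def by blast

lemma op_AI: "f \<in> in_dom \<Longrightarrow> ((abs_L2 f, bN (\<beta>' 1) (\<beta>' 2) f), (abs_L2 (\<tau> f), - bN (\<beta> 1) (\<beta> 2) f)) \<in> A"
  unfolding op_A_def by blast

lemma abs_L2_lincomb:
  assumes "square_integrable f" "square_integrable g"
  shows "abs_L2 (\<lambda>x. k * f x + l * g x) = scale_L2 k (abs_L2 f) + scale_L2 l (abs_L2 g)"
  using assms by (simp add: scale_L2.abs_eq plus_L2.abs_eq L2_rel_refl square_integrable_scale)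

lemma op_A_lincomb:
  assumes "(F, AF) \<in> A" "(G, AG) \<in> A"
  shows "(scale_H k F + scale_H l G, scale_H k AF + scale_H l AG) \<in> A"
proof -
  obtain f where f: "f \<in> in_dom" "F = (abs_L2 f, bN (\<beta>' 1) (\<beta>' 2) f)"
    "AF = (abs_L2 (\<tau> f), - bN (\<beta> 1) (\<beta> 2) f)" using op_A_cases[OF assms(1)] .
  obtain g where g: "g \<in> in_dom" "G = (abs_L2 g, bN (\<beta>' 1) (\<beta>' 2) g)"
    "AG = (abs_L2 (\<tau> g), - bN (\<beta> 1) (\<beta> 2) g)" using op_A_cases[OF assms(2)] .
  note d = dom_lincomb[OF f(1) g(1), where k = k and l = l]
  note sq = dom_A_square_integrable
  have "abs_L2 (\<tau> (\<lambda>x. k * f x + l * g x)) = abs_L2 (\<lambda>x. k * \<tau> f x + l * \<tau> g x)"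
    by (rule abs_L2_eq_iff[THEN iffD2, OF sq(2)[OF d(1)] _ d(2)])
      (intro square_integrable_add square_integrable_scale sq(2) f(1) g(1))
  then have "abs_L2 (\<tau> (\<lambda>x. k * f x + l * g x)) = scale_L2 k (fst AF) + scale_L2 l (fst AG)"
    unfolding f(3) g(3) fst_conv using abs_L2_lincomb[OF sq(2)[OF f(1)] sq(2)[OF g(1)]] by simp
  moreover have "abs_L2 (\<lambda>x. k * f x + l * g x) = scale_L2 k (fst F) + scale_L2 l (fst G)"
    unfolding f(2) g(2) fst_conv using abs_L2_lincomb[OF sq(1)[OF f(1)] sq(1)[OF g(1)]] by simp
  ultimately show ?thesis
    using op_AI[OF d(1)] unfolding d(3) by (simp add: scale_H_def plus_prod_def f g algebra_simps)
qed

lemma linear_A: "linear_operator scale_H A"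
proof -
  interpret V: vector_space scale_H by (rule vector_space_H)
  have zero: "(0, 0) \<in> A" if "(F, AF) \<in> A" for F AF
    using op_A_lincomb[OF that that, of 0 0] by simp
  have val: "AF = 0" if zAF: "(0, AF) \<in> A" for AF
  proof -
    obtain f where f: "f \<in> in_dom" "0 = (abs_L2 f, bN (\<beta>' 1) (\<beta>' 2) f)"
      "AF = (abs_L2 (\<tau> f), - bN (\<beta> 1) (\<beta> 2) f)" using op_A_cases[OF zAF] .
    have "abs_L2 f = abs_L2 (\<lambda>x. 0)" using f(2) by (simp add: zero_prod_def zero_L2_def)
    then have "AE x in leb_I. f x = 0"
      using dom_A_square_integrable(1)[OF f(1)] square_integrable_zero by (subst (asm) abs_L2_eq_iff) auto
    note z = dom_AE_zero[OF f(1) this]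
    have "abs_L2 (\<tau> f) = abs_L2 (\<lambda>x. 0)"
      using dom_A_square_integrable(2)[OF f(1)] square_integrable_zero z(1) by (subst abs_L2_eq_iff) auto
    then show ?thesis unfolding f(3) z(2) by (simp add: zero_prod_def zero_L2_def)
  qed
  have "(\<lambda>x. 0) \<in> in_dom"
  proof -
    have r0: "represents (\<lambda>x. 0) (\<lambda>_ _. 0) (\<lambda>_ _. 0) (\<lambda>_ _. 0)"
      by (simp add: represents_def W21_def absolutely_integrable_on_def)
    have "\<tau> (\<lambda>x. 0) = (\<lambda>x. 0)" by (simp add: tau_def)
    then show ?thesis unfolding represents_dom_iff(1)[OF r0] by (simp add: boundary_conditions_def square_integrable_zero)
  qed
  from zero[OF op_AI[OF this]] have 0: "(0, 0) \<in> A" .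
  have "single_valued A"
  proof (rule single_valuedI)
    fix F AF AG assume "(F, AF) \<in> A" "(F, AG) \<in> A"
    from op_A_lincomb[OF this, of 1 "-1"] have "(0, AF - AG) \<in> A" by simp
    then show "AF = AG" using val by fastforce
  qed
  moreover have "(F + G, AF + AG) \<in> A" if "(F, AF) \<in> A" "(G, AG) \<in> A" for F AF G AG
    using op_A_lincomb[OF that, of 1 1] by simp
  moreover have "(scale_H k F, scale_H k AF) \<in> A" if "(F, AF) \<in> A" for k F AF
    using op_A_lincomb[OF that that, of k 0] by simp
  ultimately show ?thesis
    unfolding linear_operator_def using 0 by blast
qed

text \<open>
  The factors \<open>w i\<close> of the inner product compensate the determinants \<open>\<theta>\<close>, \<open>\<gamma>\<close>, \<open>\<xi>\<close> by which the
  transmission conditions multiply Wronskians.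
\<close>

lemma w_Suc:
  assumes "i < 3"
  shows "w (Suc i) * (\<alpha> (2*i+3) * \<beta> (2*i+4) - \<beta> (2*i+3) * \<alpha> (2*i+4)) = w i"
proof -
  have w: "w 0 = 1" "w 1 = 1 / \<theta>" "w 2 = 1 / (\<theta> * \<gamma>)" "w 3 = 1 / (\<theta> * \<gamma> * \<xi>)"
    by (simp_all add: w_def)
  have n: "2*0+3 = (3::nat)" "2*0+4 = (4::nat)" "2*1+3 = (5::nat)" "2*1+4 = (6::nat)" "2*2+3 = (7::nat)" "2*2+4 = (8::nat)"
    "Suc 0 = 1" "Suc 1 = 2" "Suc 2 = 3" by simp_all
  have "\<forall>i<3. w (Suc i) * (\<alpha> (2*i+3) * \<beta> (2*i+4) - \<beta> (2*i+3) * \<alpha> (2*i+4)) = w i"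
    unfolding all_less_3 n w \<theta>(1)[symmetric] \<gamma>(1)[symmetric] \<xi>(1)[symmetric]
    using \<theta>(2) \<gamma>(2) \<xi>(2) by simp
  then show ?thesis using assms by blast
qed

lemma piece_ip_Lagrange:
  assumes f: "f \<in> in_dom" "represents f u u1 u2" and g: "g \<in> in_dom" "represents g v v1 v2" and i: "i < 4"
  defines "W \<equiv> \<lambda>x. u1 i x * cnj (v i x) - u i x * cnj (v1 i x)"
  shows "piece_ip i (\<tau> f) g - piece_ip i f (\<tau> g) = - of_real (P i) * (W (c (Suc i)) - W (c i))"
proof -
  note sq = dom_A_square_integrable
  note p1 = square_integrable_product[OF sq(2)[OF f(1)] sq(1)[OF g(1)]]
  note p2 = square_integrable_product[OF sq(1)[OF f(1)] sq(2)[OF g(1)]]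
  note L1 = LINT_piece_eq_integral[OF p1 i] and L2 = LINT_piece_eq_integral[OF p2 i]
  have "piece_ip i (\<tau> f) g - piece_ip i f (\<tau> g) =
      integral {c i..c (Suc i)} (\<lambda>x. \<tau> f x * cnj (g x) - f x * cnj (\<tau> g x))"
    unfolding piece_ip_def L1(1) L2(1)
    by (rule integral_diff[symmetric]) (rule set_lebesgue_integral_eq_integral(1)[OF L1(2)] set_lebesgue_integral_eq_integral(1)[OF L2(2)])+
  also have "\<dots> = - of_real (P i) * (W (c (Suc i)) - W (c i))"
  proof (rule integral_unique)
    obtain N1 where N1: "negligible N1" "\<And>x. x \<in> piece i - N1 \<Longrightarrow> \<tau> f x = - of_real (P i) * u2 i x + of_real (q x) * u i x"
      using represents_tau[OF f(2) i] by blast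
    obtain N2 where N2: "negligible N2" "\<And>x. x \<in> piece i - N2 \<Longrightarrow> \<tau> g x = - of_real (P i) * v2 i x + of_real (q x) * v i x"
      using represents_tau[OF g(2) i] by blast
    have "((\<lambda>x. u2 i x * cnj (v i x) - u i x * cnj (v2 i x)) has_integral W (c (Suc i)) - W (c i)) {c i..c (Suc i)}"
      unfolding W_def
      using Lagrange_identity[OF representsD(1)[OF f(2) i] W21_cnj[OF representsD(1)[OF g(2) i]]] c_less[OF i] by simp
    then have "((\<lambda>x. - of_real (P i) * (u2 i x * cnj (v i x) - u i x * cnj (v2 i x))) has_integral
        - of_real (P i) * (W (c (Suc i)) - W (c i))) {c i..c (Suc i)}"
      by (rule has_integral_mult_right)
    then show "((\<lambda>x. \<tau> f x * cnj (g x) - f x * cnj (\<tau> g x)) has_integral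
        - of_real (P i) * (W (c (Suc i)) - W (c i))) {c i..c (Suc i)}"
    proof (rule has_integral_spike[rotated 2])
      show "negligible (N1 \<union> N2 \<union> {c i, c (Suc i)})" using N1 N2 by (auto intro!: negligible_Un)
      fix x assume x: "x \<in> {c i..c (Suc i)} - (N1 \<union> N2 \<union> {c i, c (Suc i)})"
      then have p: "x \<in> piece i" "x \<in> piece i - N1" "x \<in> piece i - N2" by auto
      show "\<tau> f x * cnj (g x) - f x * cnj (\<tau> g x) = - of_real (P i) * (u2 i x * cnj (v i x) - u i x * cnj (v2 i x))"
        unfolding N1(2)[OF p(2)] N2(2)[OF p(3)] representsD(2)[OF f(2) i p(1)] representsD(2)[OF g(2) i p(1)]
        by (simp add: algebra_simps)
    qed
  qed
  finally show ?thesis .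
qed

text \<open>Both pairs of values lie on the same line, so they are linearly dependent.\<close>

lemma separated_condition_Wronskian:
  fixes y0 y1 z0 z1 :: complex
  assumes "of_real (\<alpha> 1) * y0 + of_real (\<alpha> 2) * y1 = 0" "of_real (\<alpha> 1) * z0 + of_real (\<alpha> 2) * z1 = 0"
  shows "y1 * z0 - y0 * z1 = 0"
proof -
  have "of_real (\<alpha> 1) * (y1 * z0 - y0 * z1) = y1 * (of_real (\<alpha> 1) * z0 + of_real (\<alpha> 2) * z1) - z1 * (of_real (\<alpha> 1) * y0 + of_real (\<alpha> 2) * y1)"
    "of_real (\<alpha> 2) * (y1 * z0 - y0 * z1) = z0 * (of_real (\<alpha> 1) * y0 + of_real (\<alpha> 2) * y1) - y0 * (of_real (\<alpha> 1) * z0 + of_real (\<alpha> 2) * z1)"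
    by (simp_all add: algebra_simps)
  then have "of_real (\<alpha> 1) * (y1 * z0 - y0 * z1) = 0" "of_real (\<alpha> 2) * (y1 * z0 - y0 * z1) = 0"
    unfolding assms by simp_all
  then show ?thesis using \<alpha>12 by (cases "\<alpha> 1 = 0") auto
qed

text \<open>
  By Lagrange's identity the difference of the two inner products in \<open>H\<^sub>1\<close> is a sum of Wronskians at
  the nodes. It telescopes by the transmission conditions; the term at \<open>-1\<close> vanishes, and the term at
  \<open>1\<close> cancels against the second component, because the pair \<open>(N', N)\<close> of boundary forms has
  determinant \<open>\<rho>\<close> up to sign.
\<close>

lemma symmetric_A:
  assumes "(F, AF) \<in> A" "(G, AG) \<in> A"
  shows "ip_H AF G = ip_H F AG"
proof -
  obtain f where f: "f \<in> in_dom" "F = (abs_L2 f, bN (\<beta>' 1) (\<beta>' 2) f)"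
    "AF = (abs_L2 (\<tau> f), - bN (\<beta> 1) (\<beta> 2) f)" using op_A_cases[OF assms(1)] .
  obtain g where g: "g \<in> in_dom" "G = (abs_L2 g, bN (\<beta>' 1) (\<beta>' 2) g)"
    "AG = (abs_L2 (\<tau> g), - bN (\<beta> 1) (\<beta> 2) g)" using op_A_cases[OF assms(2)] .
  obtain u u1 u2 where u: "represents f u u1 u2" using dom_A_represents[OF f(1)] .
  obtain v v1 v2 where v: "represents g v v1 v2" using dom_A_represents[OF g(1)] .
  note sq = dom_A_square_integrable
  have bu: "boundary_conditions u u1" and bv: "boundary_conditions v v1" using f(1) g(1) represents_dom_iff(1)[OF u] represents_dom_iff(1)[OF v] by auto
  define W where "W = (\<lambda>i x. u1 i x * cnj (v i x) - u i x * cnj (v1 i x))"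
  have step: "of_real (w i) * W i (c (Suc i)) = of_real (w (Suc i)) * W (Suc i) (c (Suc i))" if i: "i < 3" for i
  proof -
    have "W (Suc i) (c (Suc i)) = of_real (\<alpha> (2*i+3) * \<beta> (2*i+4) - \<beta> (2*i+3) * \<alpha> (2*i+4)) * W i (c (Suc i))"
      using bu bv i unfolding boundary_conditions_def W_def by (simp add: algebra_simps)
    then show ?thesis unfolding w_Suc[OF i, symmetric] by simp
  qed
  have W0: "W 0 (c 0) = 0"
  proof -
    have "of_real (\<alpha> 1) * cnj (v 0 (-1)) + of_real (\<alpha> 2) * cnj (v1 0 (-1)) = cnj (of_real (\<alpha> 1) * v 0 (-1) + of_real (\<alpha> 2) * v1 0 (-1))"
      by simp
    also have "of_real (\<alpha> 1) * v 0 (-1) + of_real (\<alpha> 2) * v1 0 (-1) = 0" using bv unfolding boundary_conditions_def by blast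
    finally have "of_real (\<alpha> 1) * cnj (v 0 (-1)) + of_real (\<alpha> 2) * cnj (v1 0 (-1)) = 0" by simp
    then show ?thesis unfolding W_def c_simps using bu by (intro separated_condition_Wronskian) (auto simp: boundary_conditions_def)
  qed
  have "ip_H1 (fst AF) (fst G) - ip_H1 (fst F) (fst AG) =
      (\<Sum>i<4. of_real (weight i) * (piece_ip i (\<tau> f) g - piece_ip i f (\<tau> g)))"
    unfolding f g fst_conv by (simp add: inner_H1_eq sq f(1) g(1) sum_subtractf[symmetric] algebra_simps)
  also have "\<dots> = (\<Sum>i<4. of_real (w i) * (W i (c i) - W i (c (Suc i))))"
  proof (rule sum.cong[OF refl])
    fix i :: nat assume "i \<in> {..<4}"
    then have i: "i < 4" by simp
    show "of_real (weight i) * (piece_ip i (\<tau> f) g - piece_ip i f (\<tau> g)) = of_real (w i) * (W i (c i) - W i (c (Suc i)))"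
      unfolding piece_ip_Lagrange[OF f(1) u g(1) v i] W_def using P_pos[OF i] by (simp add: field_simps)
  qed
  also have "\<dots> = of_real (w 0) * W 0 (c 0) - of_real (w 3) * W 3 (c 4)"
  proof -
    have "\<forall>i<3. of_real (w i) * W i (c (Suc i)) = of_real (w (Suc i)) * W (Suc i) (c (Suc i))" using step by blast
    then show ?thesis unfolding sum_less_4 all_less_3 right_diff_distrib
      by (simp add: numeral_eq_Suc)
  qed
  also have "\<dots> = - of_real (w 3) * W 3 1" unfolding W0 by (simp add: c_simps)
  finally have 1: "ip_H1 (fst AF) (fst G) - ip_H1 (fst F) (fst AG) = - of_real (w 3) * W 3 1" .
  have "snd AF * cnj (snd G) - snd F * cnj (snd AG) = of_real \<rho> * W 3 1"
    unfolding f g snd_conv represents_dom_iff(2)[OF u] represents_dom_iff(2)[OF v] W_def \<rho>(1) by (simp add: algebra_simps)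
  then have "of_real (1 / (\<rho> * \<theta> * \<gamma> * \<xi>)) * (snd AF * cnj (snd G)) - of_real (1 / (\<rho> * \<theta> * \<gamma> * \<xi>)) * (snd F * cnj (snd AG)) =
      of_real (1 / (\<rho> * \<theta> * \<gamma> * \<xi>)) * (of_real \<rho> * W 3 1)"
    by (simp only: right_diff_distrib[symmetric])
  also have "\<dots> = of_real (w 3) * W 3 1" using \<rho>(2) by (simp add: w_def)
  finally show ?thesis using 1 unfolding inner_H_def by (simp add: algebra_simps add_eq_0_iff eq_diff_eq)
qed

section \<open>Surjectivity and self-adjointness\<close>

text \<open>The equation \<open>\<tau> y - z y = \<psi>\<close> on the \<open>i\<close>-th piece, solved for \<open>y''\<close>.\<close>

abbreviation "ode_rhs z \<psi> i y \<equiv>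
    (\<lambda>x. inverse (of_real (P i)) * (of_real (q x) - z) * y x + - inverse (of_real (P i)) * \<psi> x)"

text \<open>
  The equation is solved from left to right: the initial data on each piece come from the values
  of the solution on the preceding piece by the transmission conditions.
\<close>

lemma transmission_initial_value_problem:
  fixes y0 y1 :: complex
  assumes \<psi>: "square_integrable \<psi>" and n: "n \<le> 4"
  shows "\<exists>u u1. (\<forall>i<n. W21 (c i) (c (Suc i)) (u i) (u1 i) (ode_rhs z \<psi> i (u i))) \<and>
     (0 < n \<longrightarrow> u 0 (c 0) = y0 \<and> u1 0 (c 0) = y1) \<and>
     (\<forall>i. Suc i < n \<longrightarrow> transmits u u1 i)"
  using n
proof (induction n)
  case 0
  then show ?case by simp
next
  case (Suc n)
  then obtain u u1 where IH: "\<And>i. i < n \<Longrightarrow> W21 (c i) (c (Suc i)) (u i) (u1 i) (ode_rhs z \<psi> i (u i))"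
     "0 < n \<Longrightarrow> u 0 (c 0) = y0 \<and> u1 0 (c 0) = y1"
     "\<And>i. Suc i < n \<Longrightarrow> transmits u u1 i"
    by auto
  have n4: "n < 4" using Suc.prems by simp
  define a0 where "a0 = (case n of 0 \<Rightarrow> y0 | Suc i \<Rightarrow> of_real (\<alpha> (2*i+3)) * u i (c (Suc i)) + of_real (\<beta> (2*i+3)) * u1 i (c (Suc i)))"
  define a1 where "a1 = (case n of 0 \<Rightarrow> y1 | Suc i \<Rightarrow> of_real (\<alpha> (2*i+4)) * u i (c (Suc i)) + of_real (\<beta> (2*i+4)) * u1 i (c (Suc i)))"
  have r: "(\<lambda>x. inverse (of_real (P n)) * (of_real (q x) - z)) absolutely_integrable_on {c n..c (Suc n)}"
  proof -
    have "(\<lambda>x. z) absolutely_integrable_on {c n..c (Suc n)}"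
      by (intro absolutely_integrable_continuous_real continuous_intros)
    then show ?thesis
      using q_integrable[OF n4] by (intro set_integrable_mult_right set_integral_diff(1)) auto
  qed
  have g: "(\<lambda>x. - inverse (of_real (P n)) * \<psi> x) absolutely_integrable_on {c n..c (Suc n)}"
    using LINT_piece_eq_integral(2)[OF square_integrable_imp_integrable[OF \<psi>] n4]
    by (intro set_integrable_mult_right) auto
  obtain y y' where y: "W21 (c n) (c (Suc n)) y y' (ode_rhs z \<psi> n y)"
      "y (c n) = a0" "y' (c n) = a1"
    using Caratheodory_second_order[OF r g less_imp_le[OF c_less[OF n4]]] by blast
  show ?case
  proof (rule exI[of _ "u(n := y)"], rule exI[of _ "u1(n := y')"], intro conjI allI impI)
    fix i assume "i < Suc n"
    then show "W21 (c i) (c (Suc i)) ((u(n := y)) i) ((u1(n := y')) i) (ode_rhs z \<psi> i ((u(n := y)) i))"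
      using IH(1)[of i] y(1) by (cases "i = n") auto
  next
    show "(u(n := y)) 0 (c 0) = y0" "(u1(n := y')) 0 (c 0) = y1"
      using IH(2) y(2,3) by (auto simp: a0_def a1_def)
  next
    fix i assume i: "Suc i < Suc n"
    show "(u(n := y)) (Suc i) (c (Suc i)) = of_real (\<alpha> (2*i+3)) * (u(n := y)) i (c (Suc i)) + of_real (\<beta> (2*i+3)) * (u1(n := y')) i (c (Suc i))"
      "(u1(n := y')) (Suc i) (c (Suc i)) = of_real (\<alpha> (2*i+4)) * (u(n := y)) i (c (Suc i)) + of_real (\<beta> (2*i+4)) * (u1(n := y')) i (c (Suc i))"
      using IH(3)[of i] y(2,3) i by (cases "Suc i = n"; auto simp: a0_def a1_def)+
  qed
qed

lemma square_integrable_piece: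
  assumes "continuous_on {c i..c (Suc i)} u"
  shows "square_integrable (\<lambda>x. indicator (piece i) x *\<^sub>R u x)"
proof -
  have "u \<in> borel_measurable (lebesgue_on (piece i))"
    by (intro continuous_imp_measurable_on_sets_lebesgue continuous_on_subset[OF assms]) auto
  then have "(\<lambda>x. if x \<in> piece i then u x else 0) \<in> borel_measurable lebesgue"
    by (subst borel_measurable_if) auto
  moreover have "(\<lambda>x. if x \<in> piece i then u x else 0) = (\<lambda>x. indicator (piece i) x *\<^sub>R u x)"
    by (auto simp: indicator_def)
  ultimately have m [measurable]: "(\<lambda>x. indicator (piece i) x *\<^sub>R u x) \<in> borel_measurable leb_I"
    using measurable_restrict_space1 by metis
  have "bounded (u ` {c i..c (Suc i)})" using assms by (intro compact_imp_bounded compact_continuous_image) auto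
  then obtain b where b: "\<And>x. x \<in> {c i..c (Suc i)} \<Longrightarrow> cmod (u x) \<le> b" unfolding bounded_iff by blast
  have c: "integrable leb_I (\<lambda>x. b\<^sup>2)" by (simp add: emeasure_restrict_space)
  have "(cmod (indicator (piece i) x *\<^sub>R u x))\<^sup>2 \<le> b\<^sup>2" for x
  proof (cases "x \<in> piece i")
    case True
    then show ?thesis using b[of x] by (auto intro!: power_mono)
  qed simp
  then have "integrable leb_I (\<lambda>x. (cmod (indicator (piece i) x *\<^sub>R u x))\<^sup>2)"
    by (intro Bochner_Integration.integrable_bound[OF c
        borel_measurable_power[OF measurable_compose[OF m borel_measurable_norm]]]) auto
  then show ?thesis using m by (simp add: square_integrable_def)
qed

lemma inhomogeneous_solution:
  fixes y0 y1 :: complex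
  assumes \<psi>: "square_integrable \<psi>" and y: "of_real (\<alpha> 1) * y0 + of_real (\<alpha> 2) * y1 = 0"
  obtains f u u1 u2 where "f \<in> in_dom" "represents f u u1 u2" "u 0 (c 0) = y0" "u1 0 (c 0) = y1"
    "AE x in leb_I. \<tau> f x = z * f x + \<psi> x"
proof -
  obtain u u1 where U: "\<forall>i<4. W21 (c i) (c (Suc i)) (u i) (u1 i) (ode_rhs z \<psi> i (u i))"
     "u 0 (c 0) = y0 \<and> u1 0 (c 0) = y1"
     "\<forall>i. Suc i < 4 \<longrightarrow> transmits u u1 i"
    using transmission_initial_value_problem[OF \<psi> order_refl, of z y0 y1] by auto
  define u2 where "u2 = (\<lambda>i. ode_rhs z \<psi> i (u i))"
  define f where "f = (\<lambda>x. \<Sum>i<4. indicator (piece i) x *\<^sub>R u i x)"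
  have W: "W21 (c i) (c (Suc i)) (u i) (u1 i) (u2 i)" if "i < 4" for i using U(1) that by (simp add: u2_def)
  have fu: "f x = u i x" if "i < 4" "x \<in> piece i" for i x
    unfolding f_def by (rule sum_indicator_piece[OF that])
  have r: "represents f u u1 u2" using W fu by (simp add: represents_def)
  have "square_integrable (\<lambda>x. \<Sum>i<n. indicator (piece i) x *\<^sub>R u i x)" if "n \<le> 4" for n
    using that
  proof (induction n)
    case (Suc n)
    then show ?case
      using square_integrable_add[OF _ square_integrable_piece[OF W21_absolutely_continuous(4)[OF W[of n]]]] by simp
  qed (simp add: square_integrable_zero)
  then have sf: "square_integrable f" unfolding f_def by simp
  have t: "AE x in leb_I. \<tau> f x = z * f x + \<psi> x"
  proof (rule AE_pieces)
    fix i :: nat assume i: "i < 4"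
    obtain N where N: "negligible N" "\<And>x. x \<in> piece i - N \<Longrightarrow> \<tau> f x = - of_real (P i) * u2 i x + of_real (q x) * u i x"
      using represents_tau[OF r i] by blast
    have "\<tau> f x = z * f x + \<psi> x" if x: "x \<in> piece i - N" for x
    proof -
      have "complex_of_real (P i) \<noteq> 0" using P_pos[OF i] by simp
      then have "of_real (P i) * u2 i x = (of_real (q x) - z) * u i x - \<psi> x" by (simp add: u2_def field_simps)
      then show ?thesis unfolding N(2)[OF x] using fu[OF i, of x] x by (simp add: algebra_simps)
    qed
    then show "\<exists>N. negligible N \<and> (\<forall>x\<in>piece i - N. \<tau> f x = z * f x + \<psi> x)" using N(1) by blast
  qed
  have st: "square_integrable (\<tau> f)"
    by (rule square_integrable_cong_AE[OF _ t]) (intro square_integrable_add square_integrable_scale sf \<psi>)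
  have "boundary_conditions u u1" unfolding boundary_conditions_def using U(2,3) y by (auto simp: c_simps)
  then have "f \<in> in_dom" using represents_dom_iff(1)[OF r] sf st by blast
  then show ?thesis using r U(2) t that by blast
qed

text \<open>
  One solution \<open>f0\<close> of \<open>(\<tau> - z) f0 = \<psi>\<close> takes care of the first component of \<open>K\<close>. The solution \<open>\<phi>\<close> of
  \<open>(\<tau> - z) \<phi> = 0\<close> with initial data \<open>(\<alpha>\<^sub>2, - \<alpha>\<^sub>1)\<close> adjusts the second one: \<open>A - z\<close> maps it to \<open>(0, s)\<close>, and
  \<open>s \<noteq> 0\<close>, since otherwise \<open>z\<close> would be a non-real eigenvalue of a symmetric operator.
\<close>

lemma surjective_A:
  assumes z: "Im z \<noteq> 0"
  shows "\<exists>F AF. (F, AF) \<in> A \<and> AF - scale_H z F = K"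
proof -
  interpret V: vector_space scale_H by (rule vector_space_H)
  interpret L: vector_space scale_L2 by (rule vector_space_L2)
  obtain \<psi> k where K: "square_integrable \<psi>" "K = (abs_L2 \<psi>, k)" using L2_cases by (metis surj_pair)
  have graph: "fst (AF - scale_H z F) = abs_L2 \<psi>"
    if "f \<in> in_dom" "square_integrable \<psi>" "AE x in leb_I. \<tau> f x = z * f x + \<psi> x"
      "F = (abs_L2 f, l)" "AF = (abs_L2 (\<tau> f), m)" for f \<psi> F AF l m
  proof -
    note sq = dom_A_square_integrable[OF that(1)]
    have "fst (AF - scale_H z F) = abs_L2 (\<lambda>x. \<tau> f x - z * f x)"
      using sq by (simp add: that scale_H_def minus_prod_def scale_L2.abs_eq minus_L2.abs_eq L2_rel_refl square_integrable_scale)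
    also have "\<dots> = abs_L2 \<psi>"
      using that(3) by (subst abs_L2_eq_iff) (auto intro!: square_integrable_diff square_integrable_scale sq that(2))
    finally show ?thesis .
  qed
  obtain f0 where f0: "f0 \<in> in_dom" "AE x in leb_I. \<tau> f0 x = z * f0 x + \<psi> x"
    using inhomogeneous_solution[OF K(1), where ?y0.0 = 0 and ?y1.0 = 0 and z = z] by auto
  define F0 A0 where "F0 = (abs_L2 f0, bN (\<beta>' 1) (\<beta>' 2) f0)"
    and "A0 = (abs_L2 (\<tau> f0), - bN (\<beta> 1) (\<beta> 2) f0)"
  have FA0: "(F0, A0) \<in> A" unfolding F0_def A0_def by (rule op_AI[OF f0(1)])
  have 0: "fst (A0 - scale_H z F0) = abs_L2 \<psi>" by (rule graph[OF f0(1) K(1) f0(2) F0_def A0_def])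
  obtain \<phi> v v1 v2 where \<phi>: "\<phi> \<in> in_dom" "represents \<phi> v v1 v2" "v 0 (c 0) = of_real (\<alpha> 2)" "v1 0 (c 0) = - of_real (\<alpha> 1)"
      "AE x in leb_I. \<tau> \<phi> x = z * \<phi> x + 0"
  proof -
    have y: "of_real (\<alpha> 1) * complex_of_real (\<alpha> 2) + of_real (\<alpha> 2) * - complex_of_real (\<alpha> 1) = 0"
      by simp
    show ?thesis using inhomogeneous_solution[OF square_integrable_zero y, where z = z] that by blast
  qed
  define F1 A1 where "F1 = (abs_L2 \<phi>, bN (\<beta>' 1) (\<beta>' 2) \<phi>)"
    and "A1 = (abs_L2 (\<tau> \<phi>), - bN (\<beta> 1) (\<beta> 2) \<phi>)"
  have FA1: "(F1, A1) \<in> A" unfolding F1_def A1_def by (rule op_AI[OF \<phi>(1)])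
  have 1: "fst (A1 - scale_H z F1) = 0"
    using graph[OF \<phi>(1) square_integrable_zero \<phi>(5) F1_def A1_def] by (simp add: zero_L2_def)
  have "snd (A1 - scale_H z F1) \<noteq> 0"
  proof
    assume "snd (A1 - scale_H z F1) = 0"
    then have "A1 = scale_H z F1" using 1 by (simp add: prod_eq_iff)
    then have "F1 = 0" using symmetric_eigenvalue_real[OF symmetric_A _ z] FA1 by blast
    then have "abs_L2 \<phi> = abs_L2 (\<lambda>x. 0)" by (simp add: F1_def zero_prod_def zero_L2_def)
    then have "AE x in leb_I. \<phi> x = 0"
      using dom_A_square_integrable(1)[OF \<phi>(1)] square_integrable_zero by (subst (asm) abs_L2_eq_iff) auto
    from represents_AE_zero[OF \<phi>(2) this, of 0 "c 0"] have "\<alpha> 2 = 0" "\<alpha> 1 = 0"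
      using \<phi>(3,4) c_less[of 0] by auto
    then show False using \<alpha>12 by simp
  qed
  note s = this
  define t where "t = (k - snd (A0 - scale_H z F0)) / snd (A1 - scale_H z F1)"
  have "(scale_H 1 F0 + scale_H t F1, scale_H 1 A0 + scale_H t A1) \<in> A" by (rule op_A_lincomb[OF FA0 FA1])
  moreover have "(scale_H 1 A0 + scale_H t A1) - scale_H z (scale_H 1 F0 + scale_H t F1) = K"
  proof -
    have "(scale_H 1 A0 + scale_H t A1) - scale_H z (scale_H 1 F0 + scale_H t F1) =
        (A0 - scale_H z F0) + scale_H t (A1 - scale_H z F1)"
      by (simp add: V.scale_right_distrib V.scale_right_diff_distrib mult.commute)
    also have "\<dots> = K"
    proof (rule prod_eqI)
      show "fst ((A0 - scale_H z F0) + scale_H t (A1 - scale_H z F1)) = fst K"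
        unfolding fst_add 0 using 1 K(2) by (simp add: scale_H_def)
      show "snd ((A0 - scale_H z F0) + scale_H t (A1 - scale_H z F1)) = snd K"
        unfolding snd_add using s K(2) by (simp add: scale_H_def t_def)
    qed
    finally show ?thesis .
  qed
  ultimately show ?thesis by blast
qed

theorem self_adjoint_A: "self_adjoint_operator scale_H ip_H A"
  by (rule self_adjointI[OF linear_A symmetric_A surjective_A]) auto

end

theorem theorem1p1:
  fixes h p \<alpha> \<beta> \<beta>' :: "nat \<Rightarrow> real" and q :: "real \<Rightarrow> real" and \<theta> \<gamma> \<xi> \<rho> :: real
  assumes "-1 < h 1" and "h 1 < h 2" and "h 2 < h 3" and "h 3 < 1"
    and "p 1 \<noteq> 0" and "p 2 \<noteq> 0" and "p 3 \<noteq> 0" and "p 4 \<noteq> 0"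
    and "integrable (lebesgue_on (I_set h)) q"
    and "\<theta> = \<alpha> 3 * \<beta> 4 - \<beta> 3 * \<alpha> 4" and "\<theta> > 0"
    and "\<gamma> = \<alpha> 5 * \<beta> 6 - \<beta> 5 * \<alpha> 6" and "\<gamma> > 0"
    and "\<xi> = \<alpha> 7 * \<beta> 8 - \<beta> 7 * \<alpha> 8" and "\<xi> > 0"
    and "\<rho> = \<beta>' 1 * \<beta> 2 - \<beta> 1 * \<beta>' 2" and "\<rho> > 0"
    and "\<bar>\<alpha> 1\<bar> + \<bar>\<alpha> 2\<bar> \<noteq> 0"
  shows "self_adjoint_operator scale_H (inner_H h p \<theta> \<gamma> \<xi> \<rho>) (op_A h p q \<alpha> \<beta> \<beta>')"
proof -
  interpret transmission_problem h p \<alpha> \<beta> \<beta>' q \<theta> \<gamma> \<xi> \<rho>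
    by (rule transmission_problem.intro) (fact assms)+
  show ?thesis by (rule self_adjoint_A)
qed

end
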